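(* Let $d=1$, let $0<\epsilon\leq 1$, and let $u^0,v^0\in H^1_0(\Omega)$. Let $u_\epsilon$ be the unique weak solution of the wave equation with coefficient $a_\epsilon$, vanishing source $f\equiv 0$, homogeneous Dirichlet boundary conditions and initial values $u^0$, $v^0$, where $a_\epsilon=\epsilon^2$ in the $\epsilon$-periodic set $\Omega_\epsilon$ and $a_\epsilon=1$ in $\Omega\setminus\Omega_\epsilon$ (see context). Then there is $\hat u\in L^2(0,T;H^1_0(\Omega))$ with $\partial_t\hat u\in L^2(0,T;L^2(\Omega))$ such that $u_\epsilon$ two-scale converges to $\hat u$ as $\epsilon\to 0$. Moreover, $\hat u$ is explicitly given by \[\hat u(x,t)=u^0(x)+v^0(x)\,t .\]
   Context: $\Omega\subset\mathbb{R}^d$ is an open, connected Lipschitz domain (here $d=1$, so an interval), and $T>0$ is a fixed final time, independent of $\epsilon$. Let $Y=(0,1)^d$ be the unit cell and $\Sigma\subset Y$ a subdomain; for $d=1$ it is only assumed that $\Sigma$ is a true subdomain (subinterval), i.e. $\Sigma\neq Y$. Set \[\Omega_\epsilon=\Bigl(\bigcup_{j\in\mathbb{Z}^d}\epsilon(j+\Sigma)\Bigr)\cap\Omega .\] The coefficient is $a_\epsilon=a_0$ in $\Omega_\epsilon$ and $a_\epsilon=1$ elsewhere in $\Omega$; here $a_0=\epsilon^2$. Weak solution: $u_\epsilon\in L^2(0,T;H^1_0(\Omega))$ with $\partial_tu_\epsilon\in L^2(0,T;L^2(\Omega))$ and $\partial_{tt}u_\epsilon\in L^2(0,T;H^{-1}(\Omega))$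 satisfies \[\langle\partial_{tt}u_\epsilon,v\rangle+(a_\epsilon\nabla u_\epsilon,\nabla v)_{L^2(\Omega)}=(f,v)_{L^2(\Omega)}\quad\text{for all }v\in H^1_0(\Omega)\text{ and a.e. }t\in[0,T],\] with $u_\epsilon(\cdot,0)=u^0$ and $\partial_tu_\epsilon(\cdot,0)=v^0$, where $\langle\cdot,\cdot\rangle$ is the duality pairing between $H^{-1}(\Omega)$ and $H^1_0(\Omega)$. Two-scale convergence (with $t$ as a parameter): $u_\epsilon$ two-scale converges to $\overline u\in L^2((0,T)\times\Omega\times Y)$ if for every smooth $\psi=\psi(t,x,y)$, compactly supported in $(0,T)\times\Omega$ with respect to $(t,x)$ and $Y$-periodic in $y$, \[\lim_{\epsilon\to0}\int_0^T\int_\Omega u_\epsilon(x,t)\,\psi\bigl(t,x,\tfrac{x}{\epsilon}\bigr)\,dx\,dt=\int_0^T\int_\Omega\int_Y\overline u(x,y,t)\,\psi(t,x,y)\,dy\,dx\,dt .\] A function $\hat u(x,t)$ is regarded as a two-scale limit that is constant in $y$. *)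

theory Defs
  imports "HOL-Analysis.Analysis"
begin

text \<open>
  Elements of Lebesgue, Sobolev and dual spaces are represented by functions
  (representatives), so the norms below are seminorms on representatives: two representatives
  denote the same element iff the norm of their difference is 0.
\<close>

subsection \<open>Test functions\<close>

primrec C_k :: "nat \<Rightarrow> ('a::euclidean_space \<Rightarrow> real) \<Rightarrow> bool" where
  "C_k 0 f \<longleftrightarrow> continuous_on UNIV f"
| "C_k (Suc k) f \<longleftrightarrow>
     (\<forall>x. f differentiable (at x)) \<and> (\<forall>b\<in>Basis. C_k k (\<lambda>x. frechet_derivative f (at x) b))"

definition smooth :: "('a::euclidean_space \<Rightarrow> real) \<Rightarrow> bool" where
  "smooth f \<longleftrightarrow> (\<forall>k. C_k k f)"

definition test_functions :: "real set \<Rightarrow> (real \<Rightarrow> real) set" where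
  "test_functions U =
     {\<phi>. smooth \<phi> \<and> compact (closure {x. \<phi> x \<noteq> 0}) \<and> closure {x. \<phi> x \<noteq> 0} \<subseteq> U}"


subsection \<open>Function spaces on an open set of reals\<close>

definition L2 :: "real set \<Rightarrow> (real \<Rightarrow> real) set" where
  "L2 \<Omega> = {g. g \<in> borel_measurable (lebesgue_on \<Omega>) \<and> integrable (lebesgue_on \<Omega>) (\<lambda>x. (g x)\<^sup>2)}"

definition L2_inner :: "real set \<Rightarrow> (real \<Rightarrow> real) \<Rightarrow> (real \<Rightarrow> real) \<Rightarrow> real" where
  "L2_inner \<Omega> g h = (LINT x|lebesgue_on \<Omega>. g x * h x)"

definition L2_norm :: "real set \<Rightarrow> (real \<Rightarrow> real) \<Rightarrow> real" where
  "L2_norm \<Omega> g = sqrt (L2_inner \<Omega> g g)"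

definition has_weak_deriv :: "real set \<Rightarrow> (real \<Rightarrow> real) \<Rightarrow> (real \<Rightarrow> real) \<Rightarrow> bool" where
  "has_weak_deriv \<Omega> g h \<longleftrightarrow> g \<in> L2 \<Omega> \<and> h \<in> L2 \<Omega> \<and>
     (\<forall>\<phi>\<in>test_functions \<Omega>. L2_inner \<Omega> g (deriv \<phi>) = - L2_inner \<Omega> h \<phi>)"

text \<open>The weak derivative is unique only up to null sets, hence the choice of a representative.\<close>

definition weak_deriv :: "real set \<Rightarrow> (real \<Rightarrow> real) \<Rightarrow> real \<Rightarrow> real" where
  "weak_deriv \<Omega> g = (SOME h. has_weak_deriv \<Omega> g h)"

definition H1 :: "real set \<Rightarrow> (real \<Rightarrow> real) set" where
  "H1 \<Omega> = {g. \<exists>h. has_weak_deriv \<Omega> g h}"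

definition H1_norm :: "real set \<Rightarrow> (real \<Rightarrow> real) \<Rightarrow> real" where
  "H1_norm \<Omega> g = sqrt ((L2_norm \<Omega> g)\<^sup>2 + (L2_norm \<Omega> (weak_deriv \<Omega> g))\<^sup>2)"

definition H1_0 :: "real set \<Rightarrow> (real \<Rightarrow> real) set" where
  "H1_0 \<Omega> = {g \<in> H1 \<Omega>. \<exists>\<phi>. (\<forall>n::nat. \<phi> n \<in> test_functions \<Omega>) \<and>
     (\<lambda>n. H1_norm \<Omega> (\<lambda>x. \<phi> n x - g x)) \<longlonglongrightarrow> 0}"

text \<open>
  Members of the dual of \<open>H1_0\<close> are constrained only on \<open>H1_0\<close>. Boundedness makes them respect
  equality almost everywhere.
\<close>

definition H_minus1 :: "real set \<Rightarrow> ((real \<Rightarrow> real) \<Rightarrow> real) set" where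
  "H_minus1 \<Omega> = {F.
     (\<forall>v\<in>H1_0 \<Omega>. \<forall>w\<in>H1_0 \<Omega>. F (\<lambda>x. v x + w x) = F v + F w) \<and>
     (\<forall>c. \<forall>v\<in>H1_0 \<Omega>. F (\<lambda>x. c * v x) = c * F v) \<and>
     (\<exists>C. \<forall>v\<in>H1_0 \<Omega>. \<bar>F v\<bar> \<le> C * H1_norm \<Omega> v)}"

definition H_minus1_norm :: "real set \<Rightarrow> ((real \<Rightarrow> real) \<Rightarrow> real) \<Rightarrow> real" where
  "H_minus1_norm \<Omega> F = (SUP v\<in>{v \<in> H1_0 \<Omega>. H1_norm \<Omega> v \<le> 1}. \<bar>F v\<bar>)"


subsection \<open>Bochner spaces over the time interval\<close>

text \<open>
  The target space is given by a carrier \<open>X\<close> and a seminorm \<open>N\<close> on real-valued functions.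
  The type \<open>'b\<close> is \<open>real\<close> for the function spaces and \<open>real \<Rightarrow> real\<close> for the dual space.
\<close>

definition bochner_simple :: "real \<Rightarrow> ('b \<Rightarrow> real) set \<Rightarrow> (real \<Rightarrow> 'b \<Rightarrow> real) \<Rightarrow> bool" where
  "bochner_simple T X s \<longleftrightarrow> finite (s ` {0<..<T}) \<and> s ` {0<..<T} \<subseteq> X \<and>
     (\<forall>w. {t\<in>{0<..<T}. s t = w} \<in> sets lebesgue)"

definition simple_integral :: "real \<Rightarrow> (real \<Rightarrow> 'b \<Rightarrow> real) \<Rightarrow> 'b \<Rightarrow> real" where
  "simple_integral T s =
     (\<lambda>b. \<Sum>w\<in>s ` {0<..<T}. measure lebesgue {t\<in>{0<..<T}. s t = w} * w b)"

definition bochner_L2 ::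
    "real \<Rightarrow> ('b \<Rightarrow> real) set \<Rightarrow> (('b \<Rightarrow> real) \<Rightarrow> real) \<Rightarrow> (real \<Rightarrow> 'b \<Rightarrow> real) set" where
  "bochner_L2 T X N = {u.
     (AE t in lebesgue_on {0<..<T}. u t \<in> X) \<and>
     (\<exists>s. (\<forall>n::nat. bochner_simple T X (s n)) \<and>
        (AE t in lebesgue_on {0<..<T}. (\<lambda>n. N (\<lambda>b. s n t b - u t b)) \<longlonglongrightarrow> 0)) \<and>
     integrable (lebesgue_on {0<..<T}) (\<lambda>t. (N (u t))\<^sup>2)}"

definition has_bochner_integral_in ::
    "real \<Rightarrow> ('b \<Rightarrow> real) set \<Rightarrow> (('b \<Rightarrow> real) \<Rightarrow> real) \<Rightarrow> (real \<Rightarrow> 'b \<Rightarrow> real) \<Rightarrow> ('b \<Rightarrow> real) \<Rightarrow> bool"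
  where
  "has_bochner_integral_in T X N f I \<longleftrightarrow>
     (AE t in lebesgue_on {0<..<T}. f t \<in> X) \<and> I \<in> X \<and>
     (\<exists>s. (\<forall>n::nat. bochner_simple T X (s n) \<and>
             integrable (lebesgue_on {0<..<T}) (\<lambda>t. N (\<lambda>b. s n t b - f t b))) \<and>
        (\<lambda>n. LINT t|lebesgue_on {0<..<T}. N (\<lambda>b. s n t b - f t b)) \<longlonglongrightarrow> 0 \<and>
        (\<lambda>n. N (\<lambda>b. simple_integral T (s n) b - I b)) \<longlonglongrightarrow> 0)"

text \<open>
  \<open>w\<close> is the weak derivative of \<open>u\<close>: the Bochner integrals of \<open>\<phi>' u\<close> and \<open>- \<phi> w\<close> over \<open>(0,T)\<close>
  agree in \<open>X\<close> for all test functions \<open>\<phi>\<close>.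
\<close>

definition has_time_deriv ::
    "real \<Rightarrow> ('b \<Rightarrow> real) set \<Rightarrow> (('b \<Rightarrow> real) \<Rightarrow> real) \<Rightarrow>
     (real \<Rightarrow> 'b \<Rightarrow> real) \<Rightarrow> (real \<Rightarrow> 'b \<Rightarrow> real) \<Rightarrow> bool" where
  "has_time_deriv T X N u w \<longleftrightarrow> (\<forall>\<phi>\<in>test_functions {0<..<T}. \<exists>I.
     has_bochner_integral_in T X N (\<lambda>t b. deriv \<phi> t * u t b) I \<and>
     has_bochner_integral_in T X N (\<lambda>t b. - \<phi> t * w t b) I)"

text \<open>
  Initial values are those of the representative that is continuous on \<open>[0,T]\<close> with values in
  \<open>X\<close>; elements of Bochner spaces are only determined almost everywhere in time.
\<close>

definition has_initial_value ::
    "real \<Rightarrow> ('b \<Rightarrow> real) set \<Rightarrow> (('b \<Rightarrow> real) \<Rightarrow> real) \<Rightarrow> (real \<Rightarrow> 'b \<Rightarrow> real) \<Rightarrow> ('b \<Rightarrow> real) \<Rightarrow> bool"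
  where
  "has_initial_value T X N u g \<longleftrightarrow> (\<exists>w.
     (\<forall>t\<in>{0..T}. w t \<in> X \<and> ((\<lambda>s. N (\<lambda>b. w s b - w t b)) \<longlongrightarrow> 0) (at t within {0..T})) \<and>
     (AE t in lebesgue_on {0<..<T}. N (\<lambda>b. w t b - u t b) = 0) \<and>
     N (\<lambda>b. w 0 b - g b) = 0)"


subsection \<open>The wave equation with oscillating coefficient\<close>

definition periodic_set :: "real set \<Rightarrow> real set \<Rightarrow> real \<Rightarrow> real set" where
  "periodic_set \<Omega> S \<epsilon> = (\<Union>j::int. (\<lambda>s. \<epsilon> * (of_int j + s)) ` S) \<inter> \<Omega>"

definition coefficient :: "real \<Rightarrow> real set \<Rightarrow> real set \<Rightarrow> real \<Rightarrow> real \<Rightarrow> real" where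
  "coefficient a0 \<Omega> S \<epsilon> x = (if x \<in> periodic_set \<Omega> S \<epsilon> then a0 else 1)"

text \<open>
  The second time derivative and the initial velocity are taken in the dual space, where
  \<open>L2\<close> is embedded by \<open>g \<mapsto> L2_inner \<Omega> g\<close>.
\<close>

definition weak_wave_solution ::
    "real \<Rightarrow> real set \<Rightarrow> (real \<Rightarrow> real) \<Rightarrow> (real \<Rightarrow> real \<Rightarrow> real) \<Rightarrow> (real \<Rightarrow> real) \<Rightarrow> (real \<Rightarrow> real) \<Rightarrow>
     (real \<Rightarrow> real \<Rightarrow> real) \<Rightarrow> bool" where
  "weak_wave_solution T \<Omega> a f u0 v0 u \<longleftrightarrow>
     u \<in> bochner_L2 T (H1_0 \<Omega>) (H1_norm \<Omega>) \<and>
     (\<exists>u' u''.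
        u' \<in> bochner_L2 T (L2 \<Omega>) (L2_norm \<Omega>) \<and>
        has_time_deriv T (L2 \<Omega>) (L2_norm \<Omega>) u u' \<and>
        u'' \<in> bochner_L2 T (H_minus1 \<Omega>) (H_minus1_norm \<Omega>) \<and>
        has_time_deriv T (H_minus1 \<Omega>) (H_minus1_norm \<Omega>) (\<lambda>t. L2_inner \<Omega> (u' t)) u'' \<and>
        (\<forall>v\<in>H1_0 \<Omega>. AE t in lebesgue_on {0<..<T}.
           u'' t v + L2_inner \<Omega> (\<lambda>x. a x * weak_deriv \<Omega> (u t) x) (weak_deriv \<Omega> v)
             = L2_inner \<Omega> (f t) v) \<and>
        has_initial_value T (L2 \<Omega>) (L2_norm \<Omega>) u u0 \<and>
        has_initial_value T (H_minus1 \<Omega>) (H_minus1_norm \<Omega>)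
          (\<lambda>t. L2_inner \<Omega> (u' t)) (L2_inner \<Omega> v0))"


subsection \<open>Two-scale convergence\<close>

definition two_scale_test_functions :: "real \<Rightarrow> real set \<Rightarrow> (real \<times> real \<times> real \<Rightarrow> real) set" where
  "two_scale_test_functions T \<Omega> = {\<psi>. smooth \<psi> \<and>
     (\<exists>K. compact K \<and> K \<subseteq> {0<..<T} \<times> \<Omega> \<and> (\<forall>t x y. (t, x) \<notin> K \<longrightarrow> \<psi> (t, x, y) = 0)) \<and>
     (\<forall>t x y. \<psi> (t, x, y + 1) = \<psi> (t, x, y))}"

text \<open>The limit has the argument order \<open>t x y\<close>.\<close>

definition two_scale_converges ::
    "real \<Rightarrow> real set \<Rightarrow> (real \<Rightarrow> real \<Rightarrow> real \<Rightarrow> real) \<Rightarrow> (real \<Rightarrow> real \<Rightarrow> real \<Rightarrow> real) \<Rightarrow> bool" where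
  "two_scale_converges T \<Omega> u ubar \<longleftrightarrow>
     (\<lambda>(t, x, y). ubar t x y) \<in> borel_measurable (lebesgue_on ({0<..<T} \<times> \<Omega> \<times> {0<..<1})) \<and>
     integrable (lebesgue_on ({0<..<T} \<times> \<Omega> \<times> {0<..<1})) (\<lambda>(t, x, y). (ubar t x y)\<^sup>2) \<and>
     (\<forall>\<psi>\<in>two_scale_test_functions T \<Omega>.
        ((\<lambda>\<epsilon>. LINT t|lebesgue_on {0<..<T}. LINT x|lebesgue_on \<Omega>. u \<epsilon> t x * \<psi> (t, x, x / \<epsilon>))
         \<longlongrightarrow> (LINT t|lebesgue_on {0<..<T}. LINT x|lebesgue_on \<Omega>.
               LINT y|lebesgue_on {0<..<1}. ubar t x y * \<psi> (t, x, y))) (at_right 0))"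

end

theory Submission
  imports Defs
begin

text \<open>
  Integrating the equation in time replaces the usual energy, which would need \<open>\<partial>\<^sub>t u\<close> as a test
  function, by \<open>\<parallel>u(t)\<parallel>\<^sup>2 + B(\<integral>\<^sub>0\<^sup>t u, \<integral>\<^sub>0\<^sup>t u) = \<parallel>u0\<parallel>\<^sup>2 + 2 \<integral>\<^sub>0\<^sup>t (u, v0)\<close> with \<open>B(v, w) = \<integral> a\<^sub>\<epsilon> v' w'\<close>.
  This bounds \<open>u\<close> uniformly in \<open>\<epsilon>\<close>. In one dimension every test function \<open>g\<close> is \<open>L\<^sup>2\<close>-close to the staircase
  \<open>z(x) = g(\<epsilon> \<theta>(x/\<epsilon>))\<close>, which varies only where \<open>a\<^sub>\<epsilon> = \<epsilon>\<^sup>2\<close>, so \<open>B(z, z) = O(\<epsilon>\<^sup>2)\<close>; testing the twice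
  integrated equation with \<open>z\<close> gives \<open>(u(t), g) \<rightarrow> (u0 + t v0, g)\<close> uniformly in \<open>t\<close>. Together with
  \<open>limsup \<parallel>u(t)\<parallel>\<^sup>2 \<le> \<parallel>u0\<parallel>\<^sup>2 + 2 \<integral>\<^sub>0\<^sup>t (u0 + s v0, v0) ds = \<parallel>u0 + t v0\<parallel>\<^sup>2\<close> this yields strong convergence in \<open>L\<^sup>2\<close>.
  Two-scale convergence follows because \<open>x/\<epsilon>\<close> equidistributes modulo 1.
\<close>

subsection \<open>Smooth functions of one real variable\<close>

text \<open>The energy identity rests on two integrated equations. The first,
  \<open>u(t) = u0 + \<integral> u'\<close> in L2, may be paired with \<open>u(t)\<close> itself;
  the second, \<open>u'(t) = v0 - \<integral> A u\<close> in the dual of \<open>H1_0\<close>, with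
  \<open>A\<close> the operator of \<open>B\<close>, may be paired with \<open>u(t)\<close> for
  almost every \<open>t\<close>. Expanding both gives double time integrals of symmetric kernels,
  over a square or over the triangle \<open>r < t\<close>, and symmetry makes the triangle half of
  the square. The form term has a good sign, so it drops out of the bound for \<open>u\<close>. It
  is then bounded itself and controls \<open>B(\<integral> u, z)\<close> by Cauchy-Schwarz; hence
  smallness of \<open>B(z, z)\<close> alone trivialises the limit equation for \<open>z\<close>.
  This smallness is one-dimensional in nature: a function of one variable may be constant on every
  stiff interval and still follow any profile, with bounded slope on the soft intervals. Solutions
  are determined only up to null sets of times, so everywhere defined representatives with dominated
  simple approximants are introduced before double time integrals are formed.\<close>

lemma C_k_Suc_real:
  fixes f :: "real \<Rightarrow> real"
  shows "C_k (Suc k) f \<longleftrightarrow> (\<forall>x. f differentiable (at x)) \<and> C_k k (deriv f)"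
proof -
  have "(\<lambda>x. frechet_derivative f (at x) 1) = deriv f" if "\<forall>x. f differentiable (at x)"
  proof
    fix x
    have "(f has_real_derivative deriv f x) (at x)"
      using that by (simp add: DERIV_deriv_iff_real_differentiable)
    then show "frechet_derivative f (at x) 1 = deriv f x"
      by (simp add: has_field_derivative_def frechet_derivative_at[symmetric])
  qed
  then show ?thesis by auto
qed

lemma C_k_SucI:
  fixes f :: "real \<Rightarrow> real"
  assumes "\<And>x. (f has_real_derivative f' x) (at x)" and "C_k k f'"
  shows "C_k (Suc k) f"
proof -
  have "deriv f = f'" using assms(1) DERIV_imp_deriv by blast
  then show ?thesis
    unfolding C_k_Suc_real using assms real_differentiable_def by blast
qed

lemma C_k_SucD:
  fixes f :: "real \<Rightarrow> real"
  assumes "C_k (Suc k) f"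
  shows "(f has_real_derivative deriv f x) (at x)" "C_k k (deriv f)"
  using assms unfolding C_k_Suc_real DERIV_deriv_iff_real_differentiable by blast+

lemma C_k_continuous:
  fixes f :: "real \<Rightarrow> real"
  assumes "C_k k f" shows "continuous_on UNIV f"
proof (cases k)
  case 0 then show ?thesis using assms by simp
next
  case (Suc j)
  then show ?thesis using C_k_SucD(1)[of j f] assms
    by (metis DERIV_continuous_on has_field_derivative_at_within)
qed

lemma C_k_less:
  fixes f :: "real \<Rightarrow> real"
  assumes "C_k (Suc k) f" shows "C_k k f"
  using assms
proof (induction k arbitrary: f)
  case 0
  then show ?case using C_k_continuous[OF 0] by simp
next
  case (Suc k)
  then show ?case by (meson C_k_SucD C_k_SucI)
qed

lemma C_k_const: "C_k k (\<lambda>x::real. c::real)"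
proof (induction k arbitrary: c)
  case (Suc k)
  show ?case by (rule C_k_SucI[where f'="\<lambda>_. 0"]) (auto intro: Suc)
qed auto

lemma C_k_id: "C_k k (\<lambda>x::real. x)"
proof (cases k)
  case (Suc j)
  show ?thesis unfolding Suc
    by (rule C_k_SucI[where f'="\<lambda>_. 1"]) (auto intro: C_k_const)
qed auto

lemma C_k_add:
  fixes f g :: "real \<Rightarrow> real"
  assumes "C_k k f" "C_k k g" shows "C_k k (\<lambda>x. f x + g x)"
  using assms
proof (induction k arbitrary: f g)
  case 0 then show ?case by (auto intro: continuous_intros)
next
  case (Suc k)
  show ?case
    by (rule C_k_SucI[where f'="\<lambda>x. deriv f x + deriv g x"])
       (use Suc.prems Suc.IH[of "deriv f" "deriv g"] C_k_SucD in \<open>auto intro!: derivative_eq_intros\<close>)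
qed

lemma C_k_mult:
  fixes f g :: "real \<Rightarrow> real"
  assumes "C_k k f" "C_k k g" shows "C_k k (\<lambda>x. f x * g x)"
  using assms
proof (induction k arbitrary: f g)
  case 0 then show ?case by (auto intro: continuous_intros)
next
  case (Suc k)
  note D = C_k_SucD[OF Suc.prems(1)] C_k_SucD[OF Suc.prems(2)] C_k_less[OF Suc.prems(1)] C_k_less[OF Suc.prems(2)]
  show ?case
  proof (rule C_k_SucI[where f'="\<lambda>x. deriv f x * g x + f x * deriv g x"])
    show "((\<lambda>x. f x * g x) has_real_derivative deriv f x * g x + f x * deriv g x) (at x)" for x
      using D by (auto intro!: derivative_eq_intros)
    show "C_k k (\<lambda>x. deriv f x * g x + f x * deriv g x)"
      using D Suc.IH by (intro C_k_add) blast+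
  qed
qed

lemma C_k_compose:
  fixes f g :: "real \<Rightarrow> real"
  assumes "C_k k f" "C_k k g" shows "C_k k (\<lambda>x. f (g x))"
  using assms
proof (induction k arbitrary: f g)
  case 0 then show ?case by (auto intro: continuous_on_compose2)
next
  case (Suc k)
  note D = C_k_SucD[OF Suc.prems(1)] C_k_SucD[OF Suc.prems(2)] C_k_less[OF Suc.prems(2)]
  show ?case
  proof (rule C_k_SucI[where f'="\<lambda>x. deriv f (g x) * deriv g x"])
    show "((\<lambda>x. f (g x)) has_real_derivative deriv f (g x) * deriv g x) (at x)" for x
      by (rule DERIV_chain2) (use D in auto)
    show "C_k k (\<lambda>x. deriv f (g x) * deriv g x)"
      using D Suc.IH by (intro C_k_mult) blast+
  qed
qed

lemma smooth_const: "smooth (\<lambda>x::real. c::real)"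
  and smooth_id: "smooth (\<lambda>x::real. x)"
  and smooth_add: "smooth f \<Longrightarrow> smooth g \<Longrightarrow> smooth (\<lambda>x::real. f x + g x)"
  and smooth_mult: "smooth f \<Longrightarrow> smooth g \<Longrightarrow> smooth (\<lambda>x::real. f x * g x)"
  and smooth_compose: "smooth f \<Longrightarrow> smooth g \<Longrightarrow> smooth (\<lambda>x::real. f (g x))"
  by (auto simp: smooth_def C_k_const C_k_id intro: C_k_add C_k_mult C_k_compose)

lemma smooth_cmult: "smooth f \<Longrightarrow> smooth (\<lambda>x::real. c * f x)"
  by (intro smooth_mult smooth_const)

lemma smooth_diff: "smooth f \<Longrightarrow> smooth g \<Longrightarrow> smooth (\<lambda>x::real. f x - g x)"
  using smooth_add[of f "\<lambda>x. (-1) * g x"] smooth_cmult[of g "-1"] by simp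

lemma smooth_deriv:
  fixes f :: "real \<Rightarrow> real"
  assumes "smooth f"
  shows "(f has_real_derivative deriv f x) (at x)" "smooth (deriv f)"
  using assms C_k_SucD unfolding smooth_def by blast+

text \<open>A primitive of a smooth function lies in \<open>C_k (Suc k)\<close> for every
  \<open>k\<close>, and \<open>C_k_less\<close> gives back the one order gained.\<close>

lemma smooth_antideriv:
  fixes f :: "real \<Rightarrow> real"
  assumes "\<And>x. (f has_real_derivative f' x) (at x)" and "smooth f'"
  shows "smooth f"
  unfolding smooth_def
proof
  fix k show "C_k k f"
    using C_k_less[OF C_k_SucI[OF assms(1)]] assms(2) unfolding smooth_def by blast
qed

lemma smooth_continuous_on: "smooth (f :: real \<Rightarrow> real) \<Longrightarrow> continuous_on A f"
  unfolding smooth_def by (meson C_k_continuous continuous_on_subset subset_UNIV)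

text \<open>Differentiating the cosine only advances its phase by pi/2, so an induction over all
  phases \<open>c\<close> closes without a separate treatment of the sine.\<close>

lemma smooth_cos: "smooth (cos :: real \<Rightarrow> real)"
proof -
  have "C_k k (\<lambda>x::real. cos (x + c))" for k c
  proof (induction k arbitrary: c)
    case 0 then show ?case by (auto intro!: continuous_intros)
  next
    case (Suc k)
    show ?case
    proof (rule C_k_SucI[where f'="\<lambda>x. cos (x + (c + pi/2))"])
      show "((\<lambda>x. cos (x + c)) has_real_derivative cos (x + (c + pi / 2))) (at x)" for x
        by (auto intro!: derivative_eq_intros simp: minus_sin_cos_eq algebra_simps)
      show "C_k k (\<lambda>x. cos (x + (c + pi / 2)))" by (rule Suc)
    qed
  qed
  from this[of _ 0] show ?thesis by (simp add: smooth_def)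
qed

section \<open>Flat functions, primitives and smooth steps\<close>

definition flat_exp :: "real \<Rightarrow> real" where
  "flat_exp x = (if x > 0 then exp (- inverse x) else 0)"

text \<open>The functions \<open>F n\<close>, equal to exp(-1/x) / x^n for x > 0 and to 0 elsewhere,
  are closed under differentiation up to linear combinations. At 0 the difference quotient of
  \<open>F n\<close> is \<open>F (Suc n)\<close> itself, which tends to 0 because the exponential
  beats every power of 1/x.\<close>

lemma smooth_flat_exp: "smooth flat_exp"
proof -
  define F :: "nat \<Rightarrow> real \<Rightarrow> real"
    where "F n x = (if x > 0 then inverse x ^ n * exp (- inverse x) else 0)" for n x
  have lim: "(F n \<longlongrightarrow> 0) (at_right 0)" for n
  proof -
    have "((\<lambda>x. inverse x ^ n / exp (inverse x)) \<longlongrightarrow> (0::real)) (at_right 0)"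
      using tendsto_power_div_exp_0 filterlim_inverse_at_top_right by (rule filterlim_compose)
    moreover have "\<forall>\<^sub>F x in at_right (0::real). inverse x ^ n / exp (inverse x) = F n x"
      unfolding F_def by (auto simp: eventually_at_filter exp_minus divide_inverse)
    ultimately show ?thesis by (rule Lim_transform_eventually)
  qed
  have lim0: "(F n \<longlongrightarrow> 0) (at 0)" for n
  proof -
    have "\<forall>\<^sub>F x in at_left (0::real). 0 = F n x"
      unfolding F_def by (auto simp: eventually_at_filter)
    then have "(F n \<longlongrightarrow> 0) (at_left 0)"
      using Lim_transform_eventually[OF tendsto_const] by blast
    then show ?thesis using lim by (simp add: filterlim_split_at)
  qed
  have D: "(F n has_real_derivative F (Suc (Suc n)) x - real n * F (Suc n) x) (at x)" for n x
  proof (cases x "0::real" rule: linorder_cases)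
    case greater
    have "((\<lambda>x. inverse x ^ n * exp (- inverse x)) has_real_derivative
        F (Suc (Suc n)) x - real n * F (Suc n) x) (at x)"
    proof -
      define i where "i = inverse x"
      \<comment> \<open>For n = 0 the exponent \<open>n - Suc 0\<close> is truncated to 0; the
        factor \<open>real n\<close> vanishes then, so the identity persists.\<close>
      have i: "real n * i ^ (n - Suc 0) * (i * i) = real n * i ^ Suc n" by (cases n) auto
      have "((\<lambda>x. inverse x ^ n * exp (- inverse x)) has_real_derivative
          - (real n * i ^ (n - Suc 0) * (i * i)) * exp (- i) + (i * i) * exp (- i) * i ^ n) (at x)"
        using greater by (auto intro!: derivative_eq_intros simp: i_def)
      then show ?thesis using greater unfolding i by (simp add: F_def i_def[symmetric] algebra_simps)
    qed
    then show ?thesis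
    proof (rule has_field_derivative_transform_within_open[where S="{0<..}"])
    qed (use greater in \<open>auto simp: F_def\<close>)
  next
    case less
    have "((\<lambda>x. 0) has_real_derivative F (Suc (Suc n)) x - real n * F (Suc n) x) (at x)"
      using less by (simp add: F_def)
    then show ?thesis
    proof (rule has_field_derivative_transform_within_open[where S="{..<0}"])
    qed (use less in \<open>auto simp: F_def\<close>)
  next
    case equal
    have "(\<lambda>h. (F n h - F n 0) / h) = F (Suc n)"
      by (auto simp: F_def fun_eq_iff divide_inverse)
    then have "(F n has_real_derivative 0) (at 0)"
      using lim0[of "Suc n"] by (simp add: DERIV_def F_def)
    then show ?thesis using equal by (simp add: F_def)
  qed
  have "C_k k (F n)" for k n
  proof (induction k arbitrary: n)
    case 0
    show ?case unfolding C_k.simps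
      by (rule DERIV_continuous_on) (rule has_field_derivative_at_within[OF D])
  next
    case (Suc k)
    have "C_k k (\<lambda>x. F (Suc (Suc n)) x + (- real n) * F (Suc n) x)"
      by (intro C_k_add C_k_mult C_k_const Suc)
    then show ?case using C_k_SucI[OF D] by simp
  qed
  then have "smooth (F 0)" by (simp add: smooth_def)
  also have "F 0 = flat_exp" by (auto simp: F_def flat_exp_def)
  finally show ?thesis .
qed

lemma flat_exp_pos_iff: "flat_exp x > 0 \<longleftrightarrow> x > 0"
  and flat_exp_nonneg: "flat_exp x \<ge> 0"
  and flat_exp_eq_0: "x \<le> 0 \<Longrightarrow> flat_exp x = 0"
  by (auto simp: flat_exp_def)

text \<open>The difference of the two integrals is the signed integral from 0, since one of them
  vanishes for either sign of \<open>x\<close>. On a bounded window it differs by a constant from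
  the integral with fixed lower end \<open>-R\<close>, to which the fundamental theorem
  applies.\<close>

lemma antiderivative_exists:
  fixes f :: "real \<Rightarrow> real"
  assumes "continuous_on UNIV f"
  obtains g where "\<And>x. (g has_real_derivative f x) (at x)"
proof -
  define g where "g x = integral {0..x} f - integral {x..0} f" for x
  have int: "f integrable_on {a..b}" for a b
    using assms continuous_on_subset integrable_continuous_interval by blast
  have "(g has_real_derivative f x) (at x)" for x
  proof -
    define R where "R = \<bar>x\<bar> + 1"
    have eq: "g y = integral {-R..y} f - integral {-R..0} f" if "y \<in> {-R<..<R}" for y
    proof (cases "y \<ge> 0")
      case True
      have "integral {-R..0} f + integral {0..y} f = integral {-R..y} f"
        using that True by (intro Henstock_Kurzweil_Integration.integral_combine int) auto
      moreover have "integral {y..0} f = 0" using True by (cases "y = 0") auto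
      ultimately show ?thesis by (simp add: g_def)
    next
      case False
      have "integral {-R..y} f + integral {y..0} f = integral {-R..0} f"
        using that False by (intro Henstock_Kurzweil_Integration.integral_combine int) auto
      then show ?thesis using False by (simp add: g_def)
    qed
    have "((\<lambda>y. integral {-R..y} f) has_real_derivative f x) (at x within {-R..R})"
      using assms continuous_on_subset by (intro integral_has_real_derivative) (auto simp: R_def)
    then have "((\<lambda>y. integral {-R..y} f) has_real_derivative f x) (at x)"
      by (subst (asm) at_within_interior) (auto simp: R_def)
    then have "((\<lambda>y. integral {-R..y} f - integral {-R..0} f) has_real_derivative f x) (at x)"
      by (auto intro!: derivative_eq_intros)
    then show ?thesis
      by (rule has_field_derivative_transform_within_open[where S="{-R<..<R}"])
         (auto simp: eq R_def)
  qed
  then show ?thesis using that by blast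
qed

lemma smooth_flat_exp_comp: "smooth f \<Longrightarrow> smooth (\<lambda>x::real. flat_exp (f x))"
  by (rule smooth_compose[OF smooth_flat_exp])

text \<open>The step is the normalised primitive of
  \<open>flat_exp (x - c) * flat_exp (d - x)\<close>, a bump positive exactly on (c, d). Sign and
  support of the derivative are recorded because such derivatives later act as approximate Dirac
  masses.\<close>

lemma smooth_step_exists:
  fixes c d :: real
  assumes "c < d"
  obtains s where "smooth s" "\<And>x. x \<le> c \<Longrightarrow> s x = 0" "\<And>x. x \<ge> d \<Longrightarrow> s x = 1"
    "\<And>x. 0 \<le> s x" "\<And>x. s x \<le> 1" "\<And>x. deriv s x \<ge> 0" "\<And>x. x \<notin> {c<..<d} \<Longrightarrow> deriv s x = 0"
proof -
  define b where "b x = flat_exp (x - c) * flat_exp (d - x)" for x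
  have sb: "smooth b" unfolding b_def
    by (intro smooth_mult smooth_flat_exp_comp smooth_diff smooth_id smooth_const)
  obtain g where g: "\<And>x. (g has_real_derivative b x) (at x)"
    using antiderivative_exists[OF smooth_continuous_on[OF sb]] by blast
  have b0: "b x \<ge> 0" for x by (simp add: b_def flat_exp_nonneg)
  have bz: "b x = 0" if "x \<notin> {c<..<d}" for x
    using that by (auto simp: b_def flat_exp_eq_0 not_less)
  have mono: "g x \<le> g y" if "x \<le> y" for x y
    using that g b0 DERIV_nonneg_imp_nondecreasing by metis
  have left: "g x = g c" if "x \<le> c" for x
  proof -
    have "g x \<ge> g c" 
      using that g bz by (intro DERIV_nonpos_imp_nonincreasing[of x c g]) (auto intro!: exI[of _ "b _"])
    then show ?thesis using mono that by (simp add: order_antisym)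
  qed
  have right: "g x = g d" if "x \<ge> d" for x
  proof -
    have "g d \<ge> g x"
      using that g bz by (intro DERIV_nonpos_imp_nonincreasing[of d x g]) (auto intro!: exI[of _ "b _"])
    then show ?thesis using mono that by (simp add: order_antisym)
  qed
  \<comment> \<open>The normalising factor is positive: by the mean value theorem it is
    \<open>d - c\<close> times the bump at an interior point.\<close>
  have lt: "g c < g d"
  proof -
    obtain z where z: "z > c" "z < d" "g d - g c = (d - c) * b z"
      using MVT2[of c d g b] assms g by blast
    have "b z > 0" using z by (simp add: b_def flat_exp_pos_iff)
    with z assms show ?thesis by (metis diff_gt_0_iff_gt mult_pos_pos)
  qed
  define s where "s x = (1 / (g d - g c)) * (g x - g c)" for x
  have sg: "smooth g" by (rule smooth_antideriv[OF g sb])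
  have ds: "(s has_real_derivative b x / (g d - g c)) (at x)" for x
    unfolding s_def using lt g by (auto intro!: derivative_eq_intros)
  have der: "deriv s x = b x / (g d - g c)" for x using ds DERIV_imp_deriv by blast
  have bnd: "g c \<le> g x" "g x \<le> g d" for x
  proof -
    show "g c \<le> g x" using left mono by (metis linear order_refl)
    show "g x \<le> g d" using right mono by (metis linear order_refl)
  qed
  show ?thesis
  proof
    show "smooth s" unfolding s_def by (intro smooth_cmult smooth_diff sg smooth_const)
    show "s x = 0" if "x \<le> c" for x using left[OF that] by (simp add: s_def)
    show "s x = 1" if "x \<ge> d" for x using right[OF that] lt by (simp add: s_def)
    show "0 \<le> s x" "s x \<le> 1" for x using bnd[of x] lt by (auto simp: s_def divide_simps)
    show "deriv s x \<ge> 0" for x using b0[of x] lt by (simp add: der)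
    show "deriv s x = 0" if "x \<notin> {c<..<d}" for x using bz[OF that] by (simp add: der)
  qed
qed

text \<open>A choice function for steps, so that sequences with shrinking transition intervals can
  be written as terms.\<close>

definition smooth_step :: "real \<Rightarrow> real \<Rightarrow> real \<Rightarrow> real" where
  "smooth_step a b = (SOME s. smooth s \<and> (\<forall>x\<le>a. s x = 0) \<and> (\<forall>x\<ge>b. s x = 1) \<and> (\<forall>x. 0 \<le> s x \<and> s x \<le> 1) \<and>
     (\<forall>x. deriv s x \<ge> 0) \<and> (\<forall>x. x \<notin> {a<..<b} \<longrightarrow> deriv s x = 0))"

lemma smooth_step:
  assumes "a < b"
  shows "smooth (smooth_step a b)" "x \<le> a \<Longrightarrow> smooth_step a b x = 0" "x \<ge> b \<Longrightarrow> smooth_step a b x = 1"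
    "0 \<le> smooth_step a b x" "smooth_step a b x \<le> 1" "deriv (smooth_step a b) x \<ge> 0"
    "x \<notin> {a<..<b} \<Longrightarrow> deriv (smooth_step a b) x = 0"
proof -
  have "\<exists>s. smooth s \<and> (\<forall>x\<le>a. s x = 0) \<and> (\<forall>x\<ge>b. s x = 1) \<and> (\<forall>x. 0 \<le> s x \<and> s x \<le> 1) \<and>
     (\<forall>x. deriv s x \<ge> 0) \<and> (\<forall>x. x \<notin> {a<..<b} \<longrightarrow> deriv s x = 0)"
    by (rule smooth_step_exists[OF assms]) auto
  from someI_ex[OF this]
  show "smooth (smooth_step a b)" "x \<le> a \<Longrightarrow> smooth_step a b x = 0" "x \<ge> b \<Longrightarrow> smooth_step a b x = 1"
    "0 \<le> smooth_step a b x" "smooth_step a b x \<le> 1" "deriv (smooth_step a b) x \<ge> 0"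
    "x \<notin> {a<..<b} \<Longrightarrow> deriv (smooth_step a b) x = 0"
    unfolding smooth_step_def by blast+
qed

section \<open>Periodic functions and the staircase\<close>

lemma periodic_of_int:
  fixes q :: "real \<Rightarrow> 'a"
  assumes "\<And>y. q (y + 1) = q y"
  shows "q (y + of_int j) = q y"
proof -
  have nat: "q (y + of_nat n) = q y" for y n
  proof (induction n)
    case (Suc n)
    have "q (y + of_nat (Suc n)) = q ((y + of_nat n) + 1)" by (simp add: algebra_simps)
    then show ?case using assms Suc by simp
  qed simp
  show ?thesis
  proof (cases "j \<ge> 0")
    case True
    then show ?thesis using nat[of y "nat j"] by simp
  next
    case False
    then show ?thesis using nat[of "y + of_int j" "nat (-j)"] by simp
  qed
qed

lemma periodic_frac:
  fixes q :: "real \<Rightarrow> 'a"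
  assumes "\<And>y. q (y + 1) = q y"
  shows "q y = q (frac y)"
  using periodic_of_int[of q "frac y" "\<lfloor>y\<rfloor>"] assms by (simp add: frac_def)

text \<open>\<open>\<theta>' \<ge> 0\<close> is obtained from \<open>flat_exp (cos (2 \<pi> (x - m)) - cos (2 \<pi> r))\<close>, which is positive
  exactly at distance less than \<open>r\<close> from \<open>m + \<int>\<close>.\<close>

lemma staircase_exists:
  fixes S :: "real set"
  assumes "open S" "S \<noteq> {}"
  obtains \<theta> where "smooth \<theta>" "\<And>x. deriv \<theta> x \<noteq> 0 \<Longrightarrow> \<exists>j::int. x - of_int j \<in> S"
    "\<And>x. \<bar>\<theta> x - x\<bar> \<le> 1" "bounded (range (deriv \<theta>))"
proof -
  obtain m r0 where r0: "r0 > 0" "ball m r0 \<subseteq> S"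
    using assms open_contains_ball by blast
  \<comment> \<open>The bound 1/4 puts \<open>2 * pi * r\<close> into [0, pi], where the cosine
    decreases; at distance at most 1/2 from \<open>m\<close> a comparison of cosines is therefore a
    comparison of distances.\<close>
  define r where "r = min (r0/2) (1/4)"
  have r: "r > 0" "r \<le> 1/4" "ball m r \<subseteq> S" using r0 by (auto simp: r_def)
  define p where "p x = flat_exp (cos (2 * pi * (x - m)) - cos (2 * pi * r))" for x
  have sp: "smooth p" unfolding p_def
    by (intro smooth_flat_exp_comp smooth_diff smooth_const smooth_compose[OF smooth_cos] smooth_cmult smooth_id)
  obtain g where g: "\<And>x. (g has_real_derivative p x) (at x)"
    using antiderivative_exists[OF smooth_continuous_on[OF sp]] by blast
  have sg: "smooth g" by (rule smooth_antideriv[OF g sp])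
  have p0: "p x \<ge> 0" for x by (simp add: p_def flat_exp_nonneg)
  have mono: "g x \<le> g y" if "x \<le> y" for x y
    using that g p0 DERIV_nonneg_imp_nondecreasing by metis
  have p1: "p x \<le> 1" for x by (simp add: p_def flat_exp_def)
  have per: "p (x + of_int j) = p x" for x and j :: int
  proof -
    have "2 * pi * (x + of_int j - m) = 2 * pi * (x - m) + 2 * pi * of_int j" by (simp add: algebra_simps)
    then have "cos (2 * pi * (x + of_int j - m)) = cos (2 * pi * (x - m))"
      by (simp add: cos_add)
    then show ?thesis by (simp add: p_def)
  qed
  have supp: "\<exists>j::int. x - of_int j \<in> S" if "p x \<noteq> 0" for x
  proof -
    \<comment> \<open>Subtracting the nearest integer places \<open>y\<close> within 1/2 of
      \<open>m\<close>, the range in which the cosine determines the distance.\<close>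
    define j where "j = round (x - m)"
    define y where "y = x - of_int j"
    have y: "\<bar>y - m\<bar> \<le> 1/2" using of_int_round_abs_le[of "x - m"] by (simp add: y_def j_def algebra_simps abs_minus_commute)
    have "p y \<noteq> 0" using that per[of y j] by (simp add: y_def)
    then have "cos (2 * pi * (y - m)) > cos (2 * pi * r)"
      using flat_exp_eq_0 unfolding p_def by (meson diff_gt_0_iff_gt not_le)
    then have *: "cos (2 * pi * \<bar>y - m\<bar>) > cos (2 * pi * r)"
      by (cases "y - m \<ge> 0") (auto simp: abs_if cos_diff algebra_simps)
    have "\<bar>y - m\<bar> < r"
    proof (rule ccontr)
      assume "\<not> ?thesis"
      then have "cos (2 * pi * \<bar>y - m\<bar>) \<le> cos (2 * pi * r)"
        using y r by (intro cos_monotone_0_pi_le) auto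
      with * show False by simp
    qed
    then have "y \<in> ball m r" by (simp add: dist_real_def abs_minus_commute)
    then show ?thesis using r y_def by blast
  qed
  have lt: "g 0 < g 1"
  proof -
    have pm: "p m > 0"
      using cos_monotone_0_pi[of 0 "2*pi*r"] r by (simp add: p_def flat_exp_pos_iff)
    define y where "y = frac m"
    have py: "p y > 0" using per[of y "\<lfloor>m\<rfloor>"] pm by (simp add: y_def frac_def)
    have y: "0 \<le> y" "y < 1" by (auto simp: y_def frac_lt_1)
    \<comment> \<open>Equality would make the monotone \<open>g\<close> constant on [0,1] and so
      force \<open>p\<close> to vanish on (0,1), against \<open>p y > 0\<close> and
      continuity.\<close>
    have "g 0 \<noteq> g 1"
    proof
      assume eq: "g 0 = g 1"
      have const: "g x = g 0" if "x \<in> {0..1}" for x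
        using that mono[of 0 x] mono[of x 1] eq by auto
      have cont: "isCont p y" using smooth_continuous_on[OF sp, of UNIV] by (simp add: continuous_on_eq_continuous_at)
      then have "\<forall>\<^sub>F x in at y. p x > 0" using py by (simp add: isCont_def order_tendstoD(1))
      then obtain e where e: "e > 0" "\<And>x. x \<noteq> y \<Longrightarrow> dist x y < e \<Longrightarrow> p x > 0"
        unfolding eventually_at by auto
      \<comment> \<open>\<open>y\<close> may be the end point 0, so the contradiction is sought at a
        point \<open>z > y\<close> inside (0,1) that is still close to \<open>y\<close>.\<close>
      define z where "z = min (y + e/2) ((y + 1)/2)"
      have z: "y < z" "z < 1" "dist z y < e" using e y by (auto simp: z_def dist_real_def min_def)
      have "p z > 0" using e z by auto
      moreover have "((\<lambda>_. g 0) has_real_derivative p z) (at z)"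
        by (rule has_field_derivative_transform_within_open[OF g, where S="{0<..<1}"])
           (use z y in \<open>auto intro: const\<close>)
      then have "p z = 0" using DERIV_const DERIV_unique by blast
      ultimately show False by simp
    qed
    then show ?thesis using mono[of 0 1] by simp
  qed
  define Z where "Z = g 1 - g 0"
  have Z: "Z > 0" using lt by (simp add: Z_def)
  define \<theta> where "\<theta> x = (1 / Z) * (g x - g 0)" for x
  have d: "(\<theta> has_real_derivative p x / Z) (at x)" for x
    unfolding \<theta>_def using Z g by (auto intro!: derivative_eq_intros)
  have der: "deriv \<theta> x = p x / Z" for x using d DERIV_imp_deriv by blast
  \<comment> \<open>\<open>Z\<close> is the increase of \<open>g\<close> over one period. After
    division by it, \<theta> gains exactly 1 per period, so \<theta> minus the identity is periodic;
    on [0,1] both functions take values in [0,1], which is the source of the bound 1.\<close>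
  have shift: "\<theta> (x + 1) - (x + 1) = \<theta> x - x" for x
  proof -
    have "((\<lambda>x. g (x + 1) - g x) has_real_derivative 0) (at x)" for x
    proof -
      have "((\<lambda>x. g (x + 1)) has_real_derivative p (x + 1) * 1) (at x)"
        by (rule DERIV_chain2[OF g]) (auto intro!: derivative_eq_intros)
      then show ?thesis using g[of x] per[of x 1] by (auto intro!: derivative_eq_intros)
    qed
    then have "g (x + 1) - g x = g (0 + 1) - g 0"
      using DERIV_isconst_all[of "\<lambda>x. g (x + 1) - g x"] by blast
    then show ?thesis using Z by (simp add: \<theta>_def Z_def field_simps)
  qed
  show ?thesis
  proof
    show "smooth \<theta>" unfolding \<theta>_def by (intro smooth_cmult smooth_diff sg smooth_const)
    show "\<exists>j::int. x - of_int j \<in> S" if "deriv \<theta> x \<noteq> 0" for x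
      using that supp by (auto simp: der)
    show "\<bar>\<theta> x - x\<bar> \<le> 1" for x
    proof -
      have "\<theta> x - x = \<theta> (frac x) - frac x"
        by (rule periodic_frac[where q="\<lambda>x. \<theta> x - x"]) (rule shift)
      moreover have "\<theta> (frac x) \<in> {0..1}"
        using mono[of 0 "frac x"] mono[of "frac x" 1] frac_lt_1[of x] Z
        by (auto simp: \<theta>_def Z_def field_simps)
      moreover have "0 \<le> frac x" "frac x \<le> 1" using frac_lt_1[of x] by (auto simp: less_imp_le)
      ultimately show ?thesis unfolding abs_le_iff atLeastAtMost_iff by linarith
    qed
    show "bounded (range (deriv \<theta>))"
      unfolding bounded_iff by (rule exI[of _ "1/Z"]) (use p0 p1 Z in \<open>auto simp: der divide_simps\<close>)
  qed
qed


subsection \<open>Test functions\<close>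

lemma test_functions_smooth: "\<phi> \<in> test_functions U \<Longrightarrow> smooth \<phi>"
  by (simp add: test_functions_def)

lemma test_functions_outside:
  assumes "\<phi> \<in> test_functions U" "x \<notin> U" shows "\<phi> x = 0"
  using assms closure_subset[of "{x. \<phi> x \<noteq> 0}"] unfolding test_functions_def by auto

lemma test_functionsI:
  assumes "smooth \<phi>" "compact K" "K \<subseteq> U" "\<And>x. x \<notin> K \<Longrightarrow> \<phi> x = 0"
  shows "\<phi> \<in> test_functions U"
proof -
  have "closure {x. \<phi> x \<noteq> 0} \<subseteq> K"
    using assms by (intro closure_minimal) (auto intro: compact_imp_closed)
  then show ?thesis using assms
    unfolding test_functions_def by (auto simp: compact_eq_bounded_closed intro: bounded_subset)
qed

text \<open>The complement of the closed support is open and the function is constant there, so one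
  compact set serves the function and its derivative.\<close>

lemma test_functions_support:
  assumes "\<phi> \<in> test_functions U"
  obtains K where "compact K" "K \<subseteq> U" "\<And>x. x \<notin> K \<Longrightarrow> \<phi> x = 0" "\<And>x. x \<notin> K \<Longrightarrow> deriv \<phi> x = 0"
proof -
  define K where "K = closure {x. \<phi> x \<noteq> 0}"
  have K: "compact K" "K \<subseteq> U" "\<And>x. x \<notin> K \<Longrightarrow> \<phi> x = 0"
    using assms closure_subset[of "{x. \<phi> x \<noteq> 0}"] unfolding test_functions_def K_def by auto
  have "deriv \<phi> x = 0" if "x \<notin> K" for x
  proof -
    have "((\<lambda>_. 0) has_real_derivative 0) (at x)" by simp
    then have "(\<phi> has_real_derivative 0) (at x)"
      by (rule has_field_derivative_transform_within_open[where S="- K"])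
         (use that K compact_imp_closed in auto)
    then show ?thesis by (rule DERIV_imp_deriv)
  qed
  then show ?thesis using that K by blast
qed

lemma test_functions_deriv: "\<phi> \<in> test_functions U \<Longrightarrow> deriv \<phi> \<in> test_functions U"
  by (meson test_functionsI test_functions_smooth test_functions_support smooth_deriv(2))

lemma test_functions_add:
  assumes "\<phi> \<in> test_functions U" "\<psi> \<in> test_functions U"
  shows "(\<lambda>x. \<phi> x + \<psi> x) \<in> test_functions U"
proof -
  obtain K where "compact K" "K \<subseteq> U" "\<And>x. x \<notin> K \<Longrightarrow> \<phi> x = 0"
    using test_functions_support[OF assms(1)] by metis
  moreover obtain L where "compact L" "L \<subseteq> U" "\<And>x. x \<notin> L \<Longrightarrow> \<psi> x = 0"
    using test_functions_support[OF assms(2)] by metis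
  ultimately show ?thesis
    using smooth_add[OF assms[THEN test_functions_smooth]]
    by (intro test_functionsI[of _ "K \<union> L"] compact_Un) auto
qed

lemma test_functions_cmult:
  assumes "\<phi> \<in> test_functions U"
  shows "(\<lambda>x. c * \<phi> x) \<in> test_functions U"
proof -
  obtain K where "compact K" "K \<subseteq> U" "\<And>x. x \<notin> K \<Longrightarrow> \<phi> x = 0"
    using test_functions_support[OF assms(1)] by metis
  then show ?thesis
    using smooth_cmult[OF test_functions_smooth[OF assms]]
    by (intro test_functionsI[of _ K]) auto
qed

lemma compact_real_bounded_by:
  fixes K :: "real set" assumes "compact K" obtains R where "R > 0" "K \<subseteq> {-R..R}"
proof -
  obtain R where "R > 0" "\<And>x. x \<in> K \<Longrightarrow> \<bar>x\<bar> \<le> R"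
    using compact_imp_bounded[OF assms] unfolding bounded_pos by auto
  then show ?thesis using that[of R] by (force simp: abs_le_iff)
qed

section \<open>Integrals of compactly supported functions\<close>

lemma integrable_compact_support:
  fixes f :: "real \<Rightarrow> real"
  assumes "continuous_on UNIV f" "compact K" "\<And>x. x \<notin> K \<Longrightarrow> f x = 0"
  shows "integrable lborel f" "integrable lebesgue f"
proof -
  have *: "(\<lambda>x. indicator K x *\<^sub>R f x) = f" using assms(3) by (auto simp: fun_eq_iff indicator_def)
  show "integrable lborel f"
    using borel_integrable_compact[OF assms(2) continuous_on_subset[OF assms(1)]] * by auto
  then show "integrable lebesgue f"
    using assms(1) by (subst integrable_completion) (auto intro: borel_measurable_continuous_onI)
qed

lemma smooth_borel_measurable: "smooth f \<Longrightarrow> f \<in> borel_measurable (lebesgue :: real measure)"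
  by (rule measurable_completion) (simp add: borel_measurable_continuous_onI smooth_continuous_on)

lemma integrable_lebesgue_on_subset:
  fixes f :: "real \<Rightarrow> real"
  assumes "integrable lebesgue f" "A \<in> sets lebesgue"
  shows "integrable (lebesgue_on A) f"
  using assms by (simp add: integrable_restrict_space integrable_real_mult_indicator mult.commute)

lemma integral_lebesgue_on_eq:
  fixes f :: "real \<Rightarrow> real"
  assumes "A \<in> sets lebesgue" "\<And>x. x \<notin> A \<Longrightarrow> f x = 0"
  shows "(LINT x|lebesgue_on A. f x) = (LINT x|lebesgue. f x)"
  using assms by (auto simp: integral_restrict_space indicator_def intro!: Bochner_Integration.integral_cong)

text \<open>On an interval that exceeds the support by 1 on either side, both boundary terms of the
  fundamental theorem vanish.\<close>

lemma integral_deriv_compact_support: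
  fixes f :: "real \<Rightarrow> real"
  assumes d: "\<And>x. (f has_real_derivative f' x) (at x)" and c: "continuous_on UNIV f'"
    and K: "compact K" "\<And>x. x \<notin> K \<Longrightarrow> f x = 0" "\<And>x. x \<notin> K \<Longrightarrow> f' x = 0"
  shows "(LINT x|lebesgue. f' x) = 0"
proof -
  obtain R where R: "R > 0" "K \<subseteq> {-R..R}" using compact_real_bounded_by[OF K(1)] .
  have "integral\<^sup>L lborel (\<lambda>x. indicator {-R-1..R+1} x *\<^sub>R f' x) = f (R+1) - f (-R-1)"
    using R c d by (intro integral_FTC_atLeastAtMost)
      (auto simp: has_real_derivative_iff_has_vector_derivative[symmetric] intro: has_field_derivative_at_within continuous_on_subset)
  also have "f (R+1) = 0" using R by (intro K) auto
  also have "f (-R-1) = 0" using R by (intro K) auto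
  also have "(\<lambda>x. indicator {-R-1..R+1} x *\<^sub>R f' x) = f'"
  proof
    fix x show "indicator {-R-1..R+1} x *\<^sub>R f' x = f' x"
      by (cases "x \<in> K") (use R K in \<open>auto simp: indicator_def\<close>)
  qed
  finally show ?thesis
    using c by (subst integral_completion) (auto intro: borel_measurable_continuous_onI)
qed

lemma test_functions_integral_by_parts:
  assumes "\<phi> \<in> test_functions U" "\<psi> \<in> test_functions U" "U \<in> sets lebesgue"
  shows "(LINT x|lebesgue_on U. \<phi> x * deriv \<psi> x) = - (LINT x|lebesgue_on U. deriv \<phi> x * \<psi> x)"
proof -
  obtain K where K: "compact K" "K \<subseteq> U" "\<And>x. x \<notin> K \<Longrightarrow> \<phi> x = 0" "\<And>x. x \<notin> K \<Longrightarrow> deriv \<phi> x = 0"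
    using test_functions_support[OF assms(1)] by metis
  note sm = test_functions_smooth[OF assms(1)] test_functions_smooth[OF assms(2)]
  have "(LINT x|lebesgue. \<phi> x * deriv \<psi> x + deriv \<phi> x * \<psi> x) = 0"
  proof (rule integral_deriv_compact_support[where f="\<lambda>x. \<phi> x * \<psi> x" and K=K])
    show "((\<lambda>x. \<phi> x * \<psi> x) has_real_derivative \<phi> x * deriv \<psi> x + deriv \<phi> x * \<psi> x) (at x)" for x
      using smooth_deriv(1)[OF sm(1)] smooth_deriv(1)[OF sm(2)] by (auto intro!: derivative_eq_intros)
    show "continuous_on UNIV (\<lambda>x. \<phi> x * deriv \<psi> x + deriv \<phi> x * \<psi> x)"
      by (intro continuous_intros smooth_continuous_on sm smooth_deriv)
  qed (use K in auto)
  moreover have "integrable lebesgue (\<lambda>x. \<phi> x * deriv \<psi> x)" "integrable lebesgue (\<lambda>x. deriv \<phi> x * \<psi> x)"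
    using K by (auto intro!: integrable_compact_support[of _ K] smooth_continuous_on smooth_mult sm smooth_deriv)
  ultimately have "(LINT x|lebesgue. \<phi> x * deriv \<psi> x) = - (LINT x|lebesgue. deriv \<phi> x * \<psi> x)" by simp
  then show ?thesis
    using K assms(3) by (subst (1 2) integral_lebesgue_on_eq) auto
qed

section \<open>Vanishing integrals and the fundamental lemma\<close>

lemma sigma_finite_lebesgue: "sigma_finite_measure (lebesgue :: 'a::euclidean_space measure)"
proof
  obtain A :: "'a set set" where "countable A" "A \<subseteq> sets lborel" "\<Union>A = space lborel"
    "\<forall>a\<in>A. emeasure lborel a \<noteq> \<infinity>"
    using sigma_finite_measure.sigma_finite_countable[OF sigma_finite_lborel] by metis
  then show "\<exists>A::'a set set. countable A \<and> A \<subseteq> sets lebesgue \<and> \<Union>A = space lebesgue \<and>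
      (\<forall>a\<in>A. emeasure lebesgue a \<noteq> \<infinity>)"
    by (intro exI[of _ A]) (auto simp: subset_eq)
qed

text \<open>The sets over which \<open>f\<close> integrates to 0 form a Dynkin system, and the open
  intervals are an intersection-stable generator of the Borel sets. A Lebesgue set differs from a
  Borel set by a null set, and a function with zero integral over every measurable set vanishes
  almost everywhere.\<close>

lemma vanishing_interval_integrals:
  fixes f :: "real \<Rightarrow> real"
  assumes int: "integrable lebesgue f"
    and supp: "\<And>x. x \<notin> {c<..<d} \<Longrightarrow> f x = 0"
    and zero: "\<And>a b. a < b \<Longrightarrow> (LINT x:{a<..<b}|lebesgue. f x) = 0"
  shows "AE x in lebesgue. f x = 0"
proof (rule sigma_finite_measure.density_zero[OF _ int])
  show "sigma_finite_measure (lebesgue :: real measure)" by (rule sigma_finite_lebesgue)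
  have si: "set_integrable lebesgue B f" if "B \<in> sets lebesgue" for B
    using int that unfolding set_integrable_def by (intro integrable_mult_indicator)
  have borel: "(LINT x:A|lebesgue. f x) = 0" if A: "A \<in> sets borel" for A
  proof -
    define G where "G = range (\<lambda>(a,b). {a<..<b::real})"
    have Int: "Int_stable G"
    proof (rule Int_stableI)
      fix A B assume "A \<in> G" "B \<in> G"
      then obtain a b a' b' where "A = {a<..<b}" "B = {a'<..<b'}" by (auto simp: G_def)
      then have "A \<inter> B = (\<lambda>(a,b). {a<..<b}) (max a a', min b b')" by auto
      then show "A \<inter> B \<in> G" unfolding G_def by blast
    qed
    have "borel = sigma UNIV G"
    proof -
      have "range (\<lambda>(a, b). box a b :: real set) = G" by (simp add: G_def box_real)
      then show ?thesis using borel_eq_box[where 'a=real] by simp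
    qed
    then have "A \<in> sigma_sets UNIV G" using A by (metis sets_measure_of subset_UNIV Pow_UNIV)
    have "sigma_sets UNIV G = sets borel"
      unfolding \<open>borel = sigma UNIV G\<close> by (rule sets_measure_of[symmetric]) simp
    then have G_leb: "B \<in> sets lebesgue" if "B \<in> sigma_sets UNIV G" for B
      using that by simp
    moreover have "G \<subseteq> Pow UNIV" by simp
    moreover note Int \<open>A \<in> sigma_sets UNIV G\<close>
    ultimately have "Int_stable G" "G \<subseteq> Pow UNIV" "A \<in> sigma_sets UNIV G" by simp_all
    then show ?thesis
    proof (induction A rule: sigma_sets_induct_disjoint)
      case (basic A)
      then obtain a b where A: "A = {a<..<b}" by (auto simp: G_def)
      then show ?case using zero by (cases "a < b") (auto simp: set_lebesgue_integral_def)
    next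
      case (compl A)
      have Ab: "A \<in> sets lebesgue" using compl(1) by (rule G_leb)
      have "(LINT x:UNIV|lebesgue. f x) = (LINT x:A|lebesgue. f x) + (LINT x:UNIV - A|lebesgue. f x)"
      proof -
        have "UNIV - A \<in> sets lebesgue" using Ab by (intro sets.Diff) auto
        then have "(LINT x:A \<union> (UNIV - A)|lebesgue. f x) = (LINT x:A|lebesgue. f x) + (LINT x:UNIV - A|lebesgue. f x)"
          using Ab by (intro set_integral_Un si) auto
        then show ?thesis by simp
      qed
      \<comment> \<open>Complements need the integral over the whole line: bounded support turns it
        into an integral over a slightly larger interval. \<open>min\<close> and \<open>max\<close>
        make this interval nonempty in either order of \<open>c\<close> and
        \<open>d\<close>.\<close>
      moreover have "(LINT x:UNIV|lebesgue. f x) = (LINT x:{min c d - 1<..<max c d + 1}|lebesgue. f x)"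
        unfolding set_lebesgue_integral_def
      proof (rule Bochner_Integration.integral_cong)
        show "indicator UNIV x *\<^sub>R f x = indicator {min c d - 1<..<max c d + 1} x *\<^sub>R f x" for x
          using supp[of x] by (cases "x \<in> {c<..<d}") (auto simp: indicator_def)
      qed simp
      moreover have "\<dots> = 0" by (rule zero) auto
      ultimately show ?case using compl by simp
    next
      case (union A)
      have Ab: "A i \<in> sets lebesgue" for i
        using union(2) G_leb by blast
      have "(LINT x:(\<Union>i. A i)|lebesgue. f x) = (\<Sum>i. (LINT x:(A i)|lebesgue. f x))"
        using union(1) Ab int
        by (intro lebesgue_integral_countable_add)
           (auto simp: disjoint_family_on_def intro!: si sets.countable_UN)
      then show ?case using union by simp
    qed (auto simp: G_def set_lebesgue_integral_def)
  qed
  fix A :: "real set" assume "A \<in> sets lebesgue"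
  then obtain S N N' where *: "A = S \<union> N" "S \<in> sets lborel" "N' \<in> null_sets lborel" "N \<subseteq> N'"
    by (auto elim: sets_completionE)
  have N': "AE x in lebesgue. x \<notin> N'" using *(3) by (intro AE_not_in null_sets_completionI)
  have "(LINT x:A|lebesgue. f x) = (LINT x:S|lebesgue. f x)"
    unfolding set_lebesgue_integral_def
  proof (rule integral_cong_AE)
    have "S \<in> sets lebesgue" using *(2) by simp
    then show "(\<lambda>x. indicator A x *\<^sub>R f x) \<in> borel_measurable lebesgue"
        "(\<lambda>x. indicator S x *\<^sub>R f x) \<in> borel_measurable lebesgue"
      using si \<open>A \<in> sets lebesgue\<close> unfolding set_integrable_def by (blast intro: borel_measurable_integrable)+
    show "AE x in lebesgue. indicator A x *\<^sub>R f x = indicator S x *\<^sub>R f x"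
      using N' by eventually_elim (use * in \<open>auto simp: indicator_def\<close>)
  qed
  also have "\<dots> = 0" using * by (intro borel) auto
  finally show "(LINT x:A|lebesgue. f x) = 0" .
qed

text \<open>Each function is the product of a step rising just after \<open>c\<close> and a step
  falling just before \<open>d\<close>. At a point of (c, d) both factors equal 1 once the width is
  below its distance to the ends; outside (c, d) one factor vanishes.\<close>

lemma interval_bump_sequence:
  fixes c d :: real
  assumes "c < d"
  obtains \<phi> where "\<And>n::nat. smooth (\<phi> n)" "\<And>n x. x \<notin> {c..d} \<Longrightarrow> \<phi> n x = 0" "\<And>n x. \<bar>\<phi> n x\<bar> \<le> 1"
    "\<And>x. (\<lambda>n. \<phi> n x) \<longlonglongrightarrow> indicator {c<..<d} x"
proof -
  define \<delta> where "\<delta> n = (d - c) / of_nat (n + 3)" for n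
  have \<delta>: "\<delta> n > 0" "\<delta> \<longlonglongrightarrow> 0" for n
    using assms LIMSEQ_ignore_initial_segment[OF lim_const_over_n, of "d - c" 3] unfolding \<delta>_def by simp_all
  define \<phi> where "\<phi> = (\<lambda>n x. smooth_step c (c + \<delta> n) x * (1 - smooth_step (d - \<delta> n) d x))"
  show ?thesis
  proof
    show "smooth (\<phi> n)" for n
      unfolding \<phi>_def
      by (rule smooth_mult[OF smooth_step(1) smooth_diff[OF smooth_const smooth_step(1)]]) (use \<delta>(1)[of n] in simp_all)
    show "\<phi> n x = 0" if "x \<notin> {c..d}" for n x
      using that smooth_step(2)[of c "c + \<delta> n" x] smooth_step(3)[of "d - \<delta> n" d x] \<delta>(1)[of n] by (auto simp: \<phi>_def)
    show "\<bar>\<phi> n x\<bar> \<le> 1" for n x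
      using smooth_step(4,5)[of c "c + \<delta> n" x] smooth_step(4,5)[of "d - \<delta> n" d x] \<delta>(1)[of n]
      by (auto simp: \<phi>_def abs_mult intro!: mult_le_one)
    show "(\<lambda>n. \<phi> n x) \<longlonglongrightarrow> indicator {c<..<d} x" for x
    proof (cases "x \<in> {c<..<d}")
      case True
      then have "\<forall>\<^sub>F n in sequentially. \<delta> n < min (x - c) (d - x)"
        using \<delta>(2) by (intro order_tendstoD(2)[OF \<delta>(2)]) auto
      then have "\<forall>\<^sub>F n in sequentially. 1 = \<phi> n x"
      proof eventually_elim
        case (elim n)
        then show ?case
          using smooth_step(3)[of c "c + \<delta> n" x] smooth_step(2)[of "d - \<delta> n" d x] \<delta>(1)[of n] by (auto simp: \<phi>_def)
      qed
      then have "(\<lambda>n. \<phi> n x) \<longlonglongrightarrow> 1" by (rule Lim_transform_eventually[OF tendsto_const])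
      then show ?thesis using True by simp
    next
      case False
      have "\<phi> n x = 0" for n
        using False smooth_step(2)[of c "c + \<delta> n" x] smooth_step(3)[of "d - \<delta> n" d x] \<delta>(1)[of n]
        unfolding \<phi>_def by (cases "x \<le> c") auto
      then show ?thesis using False by simp
    qed
  qed
qed

text \<open>Test functions bounded by 1 converge to the indicator of an interval whose closure lies
  in \<open>U\<close>, so by dominated convergence \<open>h\<close> integrates to 0 over it. As
  \<open>h\<close> is integrable on compact intervals only, the conclusion is first local and then
  glued over a countable cover.\<close>

lemma fundamental_lemma_calculus_of_variations:
  fixes h :: "real \<Rightarrow> real"
  assumes U: "open U" and h: "h \<in> borel_measurable (lebesgue_on U)"
    and int: "\<And>c d. {c..d} \<subseteq> U \<Longrightarrow> integrable (lebesgue_on {c..d}) h"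
    and zero: "\<And>\<phi>. \<phi> \<in> test_functions U \<Longrightarrow> (LINT x|lebesgue_on U. h x * \<phi> x) = 0"
  shows "AE x in lebesgue_on U. h x = 0"
proof -
  have Ub: "U \<in> sets lebesgue" using U by simp
  have interval: "(LINT x:{c<..<d}|lebesgue. h x) = 0" if cd: "c < d" "{c..d} \<subseteq> U" for c d
  proof -
    obtain \<phi> where \<phi>: "\<And>n::nat. smooth (\<phi> n)" "\<And>n x. x \<notin> {c..d} \<Longrightarrow> \<phi> n x = 0" "\<And>n x. \<bar>\<phi> n x\<bar> \<le> 1"
      "\<And>x. (\<lambda>n. \<phi> n x) \<longlonglongrightarrow> indicator {c<..<d} x"
      using interval_bump_sequence[OF cd(1)] by metis
    have test: "\<phi> n \<in> test_functions U" for n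
      by (rule test_functionsI[of _ "{c..d}"]) (use \<phi> cd in auto)
    have hi: "integrable lebesgue (\<lambda>x. indicator {c..d} x * h x)"
      using int[OF cd(2)] by (simp add: integrable_restrict_space)
    have eq: "indicator U x * (h x * \<phi> n x) = indicator {c..d} x * h x * \<phi> n x" for n x
      using \<phi>(2) cd by (cases "x \<in> {c..d}") (auto simp: indicator_def)
    have "(\<lambda>n. LINT x|lebesgue. indicator {c..d} x * h x * \<phi> n x) \<longlonglongrightarrow>
        (LINT x|lebesgue. indicator {c..d} x * h x * indicator {c<..<d} x)"
    proof (rule integral_dominated_convergence[where w="\<lambda>x. \<bar>indicator {c..d} x * h x\<bar>"])
      show "(\<lambda>x. indicator {c..d} x * h x * \<phi> n x) \<in> borel_measurable lebesgue" for n
        by (rule borel_measurable_times[OF borel_measurable_integrable[OF hi] smooth_borel_measurable[OF \<phi>(1)]])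
      show "AE x in lebesgue. (\<lambda>n. indicator {c..d} x * h x * \<phi> n x) \<longlonglongrightarrow> indicator {c..d} x * h x * indicator {c<..<d} x"
        using \<phi>(4) by (intro AE_I2 tendsto_mult tendsto_const)
      show "AE x in lebesgue. norm (indicator {c..d} x * h x * \<phi> n x) \<le> \<bar>indicator {c..d} x * h x\<bar>" for n
        using \<phi>(3) by (intro AE_I2) (auto simp: abs_mult intro!: mult_right_le_one_le)
    next
      show "(\<lambda>x. indicator {c..d} x * h x * indicator {c<..<d} x) \<in> borel_measurable lebesgue"
        by (rule borel_measurable_times[OF borel_measurable_integrable[OF hi]]) (simp add: borel_measurable_indicator)
    qed (use hi in simp)
    moreover have "(LINT x|lebesgue. indicator {c..d} x * h x * \<phi> n x) = 0" for n
      using zero[OF test[of n]] Ub by (simp add: integral_restrict_space eq)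
    moreover have "indicator {c..d} x * h x * indicator {c<..<d} x = indicator {c<..<d} x * h x" for x
      by (auto simp: indicator_def)
    ultimately show ?thesis
      unfolding set_lebesgue_integral_def using LIMSEQ_unique[OF _ tendsto_const] by auto
  qed
  have local: "AE x in lebesgue. x \<in> {c<..<d} \<longrightarrow> h x = 0" if cd: "{c..d} \<subseteq> U" for c d
  proof -
    have hi: "integrable lebesgue (\<lambda>x. indicator {c<..<d} x * h x)"
    proof -
      have "integrable lebesgue (\<lambda>x. indicator {c..d} x * h x)"
        using int[OF cd] by (simp add: integrable_restrict_space)
      moreover have "{c<..<d} \<in> sets lebesgue" by simp
      ultimately have "integrable lebesgue (\<lambda>x. indicator {c<..<d} x * (indicator {c..d} x * h x))"
        using integrable_mult_indicator[of "{c<..<d}" lebesgue "\<lambda>x. indicator {c..d} x * h x"]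
        unfolding real_scaleR_def by blast
      moreover have "indicator {c<..<d} x * (indicator {c..d} x * h x) = indicator {c<..<d} x * h x" for x
        by (auto simp: indicator_def)
      ultimately show ?thesis by simp
    qed
    have "AE x in lebesgue. indicator {c<..<d} x * h x = 0"
    proof (rule vanishing_interval_integrals[OF hi, where c=c and d=d])
      fix a b :: real assume "a < b"
      show "(LINT x:{a<..<b}|lebesgue. indicator {c<..<d} x * h x) = 0"
      proof (cases "max a c < min b d")
        case True
        have "(LINT x:{a<..<b}|lebesgue. indicator {c<..<d} x * h x) = (LINT x:{max a c<..<min b d}|lebesgue. h x)"
          unfolding set_lebesgue_integral_def by (rule Bochner_Integration.integral_cong) (auto simp: indicator_def)
        also have "\<dots> = 0" using True cd by (intro interval) auto
        finally show ?thesis .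
      next
        case False
        then have "indicator {a<..<b} x * (indicator {c<..<d} x * h x) = 0" for x
          by (auto simp: indicator_def)
        then show ?thesis unfolding set_lebesgue_integral_def real_scaleR_def by (simp only: Bochner_Integration.integral_zero)
      qed
    qed auto
    then show ?thesis by eventually_elim (auto simp: indicator_def split: if_splits)
  qed
  \<comment> \<open>The cover consists of closed intervals while the local statement concerns open
    ones; the two end points of each interval are a null set.\<close>
  obtain D where D: "countable D" "D \<subseteq> Pow U" "\<And>X. X \<in> D \<Longrightarrow> \<exists>a b. X = cbox a b" "\<Union>D = U"
    using open_countable_Union_open_cbox[OF U] by metis
  have "AE x in lebesgue. \<forall>X\<in>D. x \<in> X \<longrightarrow> h x = 0"
  proof (subst AE_ball_countable[OF D(1)], intro ballI)
    fix X assume X: "X \<in> D"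
    then obtain c d where c: "X = {c..d}" using D(3) by (metis interval_cbox)
    have "AE x in lebesgue. x \<noteq> c \<and> x \<noteq> d"
      by (intro AE_conjI AE_completion AE_lborel_singleton)
    moreover have "AE x in lebesgue. x \<in> {c<..<d} \<longrightarrow> h x = 0"
      using local X c D(2) by blast
    ultimately show "AE x in lebesgue. x \<in> X \<longrightarrow> h x = 0"
      by eventually_elim (auto simp: c)
  qed
  then show ?thesis
    using D(4) Ub by (auto simp: AE_restrict_space_iff elim: eventually_mono)
qed


subsection \<open>The fundamental theorem for weak derivatives\<close>

text \<open>Passes to the Henstock-Kurzweil integral over the closed interval, where the fundamental
  theorem and additivity over adjacent intervals are at hand.\<close>

lemma lint_Ioo_eq_integral:
  fixes h :: "real \<Rightarrow> real"
  assumes "integrable (lebesgue_on {a<..<b}) h"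
  shows "(LINT t|lebesgue_on {a<..<b}. h t) = integral {a..b} h" "h integrable_on {a..b}"
proof -
  show "(LINT t|lebesgue_on {a<..<b}. h t) = integral {a..b} h"
    using assms by (simp add: lebesgue_integral_eq_integral integral_open_interval_real)
  show "h integrable_on {a..b}"
    using integrable_on_lebesgue_on[OF assms] by (simp add: integrable_on_open_interval_real)
qed

lemma integrable_lebesgue_on_mono:
  fixes f :: "real \<Rightarrow> real"
  assumes "integrable (lebesgue_on B) f" "A \<subseteq> B" "A \<in> sets lebesgue" "B \<in> sets lebesgue"
  shows "integrable (lebesgue_on A) f"
proof -
  have "integrable lebesgue (\<lambda>x. indicator B x *\<^sub>R f x)"
    using assms by (simp add: integrable_restrict_space)
  from integrable_lebesgue_on_subset[OF this assms(3)]
  show ?thesis using assms(2)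
    by (auto cong: Bochner_Integration.integrable_cong simp: subset_iff elim!: Bochner_Integration.integrable_cong[THEN iffD1, rotated 2])
qed

lemma continuous_integrable_Ioo:
  fixes m :: "real \<Rightarrow> real"
  assumes "continuous_on {a..b} m" shows "integrable (lebesgue_on {a<..<b}) m"
  by (rule integrable_lebesgue_on_mono[OF continuous_imp_integrable_real[OF assms]]) auto

text \<open>The derivative of a step is a nonnegative weight of total mass 1 concentrated on (c,
  c'). Integrating against it is an averaging and differs from \<open>m c\<close> by at most the
  oscillation of \<open>m\<close> there.\<close>

lemma step_integral_close:
  fixes m :: "real \<Rightarrow> real"
  assumes m: "continuous_on {0..T} m" and c: "0 < c" "c < c'" "c' < T"
    and s: "smooth s" "\<And>x. x \<le> c \<Longrightarrow> s x = 0" "\<And>x. x \<ge> c' \<Longrightarrow> s x = 1"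
      "\<And>x. deriv s x \<ge> 0" "\<And>x. x \<notin> {c<..<c'} \<Longrightarrow> deriv s x = 0"
    and e: "\<And>t. t \<in> {c..c'} \<Longrightarrow> \<bar>m t - m c\<bar> \<le> e"
  shows "\<bar>(LINT t|lebesgue_on {0<..<T}. deriv s t * m t) - m c\<bar> \<le> e"
proof -
  note ds = smooth_continuous_on[OF smooth_deriv(2)[OF s(1)]]
  have i1: "integrable (lebesgue_on {0<..<T}) (deriv s)" by (rule continuous_integrable_Ioo[OF ds])
  have i2: "integrable (lebesgue_on {0<..<T}) (\<lambda>t. deriv s t * m t)"
    by (intro continuous_integrable_Ioo continuous_on_mult ds m)
  have "(LINT t|lebesgue_on {0<..<T}. deriv s t) = integral {0..T} (deriv s)"
    by (rule lint_Ioo_eq_integral[OF i1])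
  also have "\<dots> = s T - s 0"
    using c smooth_deriv(1)[OF s(1)]
    by (intro integral_unique fundamental_theorem_of_calculus)
       (auto simp: has_real_derivative_iff_has_vector_derivative[symmetric] intro: has_field_derivative_at_within)
  also have "\<dots> = 1" using c s by simp
  finally have one: "(LINT t|lebesgue_on {0<..<T}. deriv s t) = 1" .
  have "(LINT t|lebesgue_on {0<..<T}. deriv s t * m t) - m c = (LINT t|lebesgue_on {0<..<T}. deriv s t * m t - deriv s t * m c)"
    using i1 i2 one by simp
  also have "\<bar>\<dots>\<bar> \<le> (LINT t|lebesgue_on {0<..<T}. \<bar>deriv s t * m t - deriv s t * m c\<bar>)"
    by (rule integral_abs_bound)
  also have "\<dots> \<le> (LINT t|lebesgue_on {0<..<T}. deriv s t * e)"
  proof (rule integral_mono)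
    fix t
    have "\<bar>deriv s t * m t - deriv s t * m c\<bar> = deriv s t * \<bar>m t - m c\<bar>"
      using s(4)[of t] by (simp add: abs_mult right_diff_distrib[symmetric])
    also have "\<dots> \<le> deriv s t * e"
      using s(4)[of t] s(5)[of t] e[of t] by (cases "t \<in> {c<..<c'}") (auto intro!: mult_left_mono)
    finally show "\<bar>deriv s t * m t - deriv s t * m c\<bar> \<le> deriv s t * e" .
  qed (use i1 i2 in auto)
  also have "\<dots> = e" using one by simp
  finally show ?thesis .
qed

text \<open>The test functions are differences of two smooth steps at \<open>c\<close> and \<open>d\<close>: their derivatives
  concentrate at these points, while they tend to the indicator function of the interval between.\<close>

lemma weak_derivative_increment:
  fixes m h :: "real \<Rightarrow> real"
  assumes m: "continuous_on {0..T} m" and h: "integrable (lebesgue_on {0<..<T}) h"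
    and weak: "\<And>\<phi>. \<phi> \<in> test_functions {0<..<T} \<Longrightarrow>
      (LINT t|lebesgue_on {0<..<T}. deriv \<phi> t * m t) = - (LINT t|lebesgue_on {0<..<T}. \<phi> t * h t)"
    and cd: "0 < c" "c < d" "d < T"
  shows "m d - m c = integral {c..d} h"
proof -
  \<comment> \<open>Transitions of width at most \<eta> keep the step at \<open>c\<close> finished
    before \<open>d\<close> and the step at \<open>d\<close> finished before
    \<open>T\<close>.\<close>
  define \<eta> where "\<eta> = min (d - c) (T - d) / 2"
  have \<eta>: "\<eta> > 0" "c + \<eta> < d" "d + \<eta> < T" using cd by (auto simp: \<eta>_def min_def field_simps)
  define \<delta> where "\<delta> n = \<eta> / of_nat (n + 1)" for n
  have \<delta>: "\<delta> n > 0" "\<delta> n \<le> \<eta>" for n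
    using \<eta> mult_left_mono[of 1 "real (n + 1)" \<eta>] by (simp_all add: \<delta>_def field_simps)
  have \<delta>_lim: "\<delta> \<longlonglongrightarrow> 0"
    using LIMSEQ_ignore_initial_segment[OF lim_const_over_n, of \<eta> 1] unfolding \<delta>_def by simp
  define \<phi> where "\<phi> = (\<lambda>n x. smooth_step c (c + \<delta> n) x - smooth_step d (d + \<delta> n) x)"
  have sm: "smooth (smooth_step a (a + \<delta> n))" for a n using \<delta>(1)[of n] by (intro smooth_step(1)) simp
  have test: "\<phi> n \<in> test_functions {0<..<T}" for n
  proof (rule test_functionsI[where K="{c..d + \<eta>}"])
    show "smooth (\<phi> n)" unfolding \<phi>_def by (rule smooth_diff[OF sm sm])
    show "\<phi> n x = 0" if "x \<notin> {c..d + \<eta>}" for x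
    proof (cases "x < c")
      case True
      then show ?thesis
        using smooth_step(2)[of c "c + \<delta> n" x] smooth_step(2)[of d "d + \<delta> n" x] \<delta>[of n] cd by (simp add: \<phi>_def)
    next
      case False
      then show ?thesis
        using that smooth_step(3)[of c "c + \<delta> n" x] smooth_step(3)[of d "d + \<delta> n" x] \<delta>[of n] cd by (simp add: \<phi>_def)
    qed
  qed (use cd \<eta> in auto)
  have der: "deriv (\<phi> n) x = deriv (smooth_step c (c + \<delta> n)) x - deriv (smooth_step d (d + \<delta> n)) x" for n x
    unfolding \<phi>_def using smooth_deriv(1)[OF sm] by (intro DERIV_imp_deriv DERIV_diff)
  have conv: "(\<lambda>n. LINT t|lebesgue_on {0<..<T}. deriv (smooth_step a (a + \<delta> n)) t * m t) \<longlonglongrightarrow> m a"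
    if a: "0 < a" "a + \<eta> < T" for a
  proof (rule LIMSEQ_I)
    fix r :: real assume "0 < r"
    have "isCont m a" using m a \<eta>(1) by (intro continuous_on_interior[OF m]) auto
    then obtain \<rho> where \<rho>: "\<rho> > 0" "\<And>t. \<bar>t - a\<bar> < \<rho> \<Longrightarrow> \<bar>m t - m a\<bar> < r / 2"
      using \<open>0 < r\<close> unfolding continuous_at_real_range by (metis half_gt_zero real_norm_def)
    obtain N where N: "\<And>n. n \<ge> N \<Longrightarrow> \<delta> n < \<rho>"
      using order_tendstoD(2)[OF \<delta>_lim \<rho>(1)] unfolding eventually_sequentially by blast
    have "norm ((LINT t|lebesgue_on {0<..<T}. deriv (smooth_step a (a + \<delta> n)) t * m t) - m a) < r" if "n \<ge> N" for n
    proof -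
      have "\<bar>(LINT t|lebesgue_on {0<..<T}. deriv (smooth_step a (a + \<delta> n)) t * m t) - m a\<bar> \<le> r / 2"
      proof (rule step_integral_close[OF m, where c'="a + \<delta> n"])
        show "\<bar>m t - m a\<bar> \<le> r / 2" if "t \<in> {a..a + \<delta> n}" for t
          using that N[OF \<open>n \<ge> N\<close>] by (intro less_imp_le \<rho>(2)) auto
      qed (use a \<delta>[of n] smooth_step[of a "a + \<delta> n"] in auto)
      then show ?thesis using \<open>0 < r\<close> by simp
    qed
    then show "\<exists>no. \<forall>n\<ge>no. norm ((LINT t|lebesgue_on {0<..<T}. deriv (smooth_step a (a + \<delta> n)) t * m t) - m a) < r"
      by blast
  qed
  have "(LINT t|lebesgue_on {0<..<T}. deriv (\<phi> n) t * m t) =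
      (LINT t|lebesgue_on {0<..<T}. deriv (smooth_step c (c + \<delta> n)) t * m t) -
      (LINT t|lebesgue_on {0<..<T}. deriv (smooth_step d (d + \<delta> n)) t * m t)" for n
    unfolding der left_diff_distrib
    by (intro Bochner_Integration.integral_diff continuous_integrable_Ioo continuous_on_mult m
        smooth_continuous_on smooth_deriv(2) sm)
  then have lim1: "(\<lambda>n. LINT t|lebesgue_on {0<..<T}. deriv (\<phi> n) t * m t) \<longlonglongrightarrow> m c - m d"
    using tendsto_diff[OF conv[of c] conv[of d]] cd \<eta> by simp
  have lim2: "(\<lambda>n. LINT t|lebesgue_on {0<..<T}. \<phi> n t * h t) \<longlonglongrightarrow>
      (LINT t|lebesgue_on {0<..<T}. indicator {c<..d} t * h t)"
  proof (rule integral_dominated_convergence[where w="\<lambda>t. \<bar>h t\<bar>"])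
    show "(\<lambda>t. indicator {c<..d} t * h t) \<in> borel_measurable (lebesgue_on {0<..<T})"
      by (intro borel_measurable_times borel_measurable_integrable[OF h] measurable_restrict_space1
          borel_measurable_indicator) simp
    show "(\<lambda>t. \<phi> n t * h t) \<in> borel_measurable (lebesgue_on {0<..<T})" for n
      using smooth_borel_measurable[OF test_functions_smooth[OF test]]
      by (intro borel_measurable_times borel_measurable_integrable[OF h] measurable_restrict_space1)
    have "\<bar>\<phi> n t\<bar> \<le> 1" for n t
      using smooth_step(4,5)[of c "c + \<delta> n" t] smooth_step(4,5)[of d "d + \<delta> n" t] \<delta>(1)[of n]
      unfolding \<phi>_def abs_le_iff by linarith
    then show "AE t in lebesgue_on {0<..<T}. norm (\<phi> n t * h t) \<le> \<bar>h t\<bar>" for n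
      by (intro AE_I2) (simp add: abs_mult mult_left_le_one_le)
    have "(\<lambda>n. \<phi> n t) \<longlonglongrightarrow> indicator {c<..d} t" for t
    proof -
      have step: "(\<lambda>n. smooth_step a (a + \<delta> n) t) \<longlonglongrightarrow> indicator {a<..} t" for a
      proof (cases "t > a")
        case True
        then have "\<forall>\<^sub>F n in sequentially. \<delta> n < t - a"
          by (intro order_tendstoD(2)[OF \<delta>_lim]) auto
        then have "\<forall>\<^sub>F n in sequentially. 1 = smooth_step a (a + \<delta> n) t"
        proof eventually_elim
          case (elim n)
          then show ?case using smooth_step(3)[of a "a + \<delta> n" t] \<delta>(1)[of n] by auto
        qed
        then have "(\<lambda>n. smooth_step a (a + \<delta> n) t) \<longlonglongrightarrow> 1" by (rule Lim_transform_eventually[OF tendsto_const])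
        then show ?thesis using True by simp
      next
        case False
        then have "smooth_step a (a + \<delta> n) t = 0" for n using smooth_step(2)[of a "a + \<delta> n" t] \<delta>(1)[of n] by auto
        then show ?thesis using False by simp
      qed
      \<comment> \<open>A step is 0 at its own threshold, so the limit is the indicator of a
        half-open interval, without \<open>c\<close> and with \<open>d\<close>.\<close>
      have "indicator {c<..d} t = indicator {c<..} t - (indicator {d<..} t :: real)"
        using cd by (auto simp: indicator_def)
      then show ?thesis unfolding \<phi>_def using tendsto_diff[OF step[of c] step[of d]] by simp
    qed
    then show "AE t in lebesgue_on {0<..<T}. (\<lambda>n. \<phi> n t * h t) \<longlonglongrightarrow> indicator {c<..d} t * h t"
      by (intro AE_I2 tendsto_mult_right)
  qed (use h in auto)
  have "(LINT t|lebesgue_on {0<..<T}. indicator {c<..d} t * h t) = (LINT t|lebesgue_on {c<..d}. h t)"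
    using cd by (auto simp: integral_restrict_space indicator_def intro!: Bochner_Integration.integral_cong)
  also have "\<dots> = integral {c<..d} h"
  proof (rule lebesgue_integral_eq_integral)
    have "{c<..d} \<subseteq> {0<..<T}" using cd by (auto simp: subset_eq)
    then show "integrable (lebesgue_on {c<..d}) h" by (rule integrable_lebesgue_on_mono[OF h]) auto
  qed simp
  also have "\<dots> = integral {c..d} h"
  proof (rule integral_subset_negligible)
    have "{c..d} - {c<..d} = {c}" using cd by auto
    then show "negligible ({c..d} - {c<..d})" by simp
  qed auto
  finally have "m c - m d = - integral {c..d} h"
    using LIMSEQ_unique[OF lim1] tendsto_minus[OF lim2] weak[OF test] by simp
  then show ?thesis by simp
qed

text \<open>Subtracting the primitive of \<open>h\<close> leaves a function with equal values at all
  interior times. Test functions vanish near 0 and \<open>T\<close>, so these times are reached by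
  continuity of \<open>m\<close>; through the time 0 initial values enter.\<close>

lemma weak_derivative_fundamental_theorem:
  fixes m h :: "real \<Rightarrow> real"
  assumes m: "continuous_on {0..T} m" and h: "integrable (lebesgue_on {0<..<T}) h"
    and weak: "\<And>\<phi>. \<phi> \<in> test_functions {0<..<T} \<Longrightarrow>
      (LINT t|lebesgue_on {0<..<T}. deriv \<phi> t * m t) = - (LINT t|lebesgue_on {0<..<T}. \<phi> t * h t)"
    and t: "0 \<le> t" "t \<le> T"
  shows "m t = m 0 + (LINT s|lebesgue_on {0<..<t}. h s)"
proof (cases "T > 0")
  case False
  then have "t = 0" using t by simp
  then show ?thesis by simp
next
  case True
  define M where "M x = m x - integral {0..x} h" for x
  have hi: "h integrable_on {0..T}" using lint_Ioo_eq_integral(2)[OF h] .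
  have contM: "continuous_on {0..T} M"
    unfolding M_def by (intro continuous_on_diff m indefinite_integral_continuous_1 hi)
  have inc: "M c = M d" if "0 < c" "c < d" "d < T" for c d
  proof -
    have "integral {0..c} h + integral {c..d} h = integral {0..d} h"
      using that by (intro Henstock_Kurzweil_Integration.integral_combine integrable_on_subinterval[OF hi]) auto
    then show ?thesis using weak_derivative_increment[OF m h weak that] by (simp add: M_def)
  qed
  have const: "M x = M (T / 2)" if "x \<in> {0<..<T}" for x
  proof (cases x "T/2" rule: linorder_cases)
    case less
    then show ?thesis using that True by (intro inc) auto
  next
    case greater
    then show ?thesis using that True by (intro inc[symmetric]) auto
  next
    case equal
    then show ?thesis by (rule arg_cong)
  qed
  have const': "M x = M (T / 2)" if "x \<in> {0..T}" for x
  proof (rule continuous_constant_on_closure[of "{0<..<T}" M "M (T / 2)" x])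
    show "continuous_on (closure {0<..<T}) M" "x \<in> closure {0<..<T}" using contM that True by simp_all
  qed (rule const)
  have "t \<in> {0..T}" "0 \<in> {0..T}" using t True by auto
  then have "M t = M 0" by (metis const')
  moreover have "(LINT s|lebesgue_on {0<..<t}. h s) = integral {0..t} h"
    using t by (intro lint_Ioo_eq_integral(1) integrable_lebesgue_on_mono[OF h]) auto
  ultimately show ?thesis by (simp add: M_def)
qed


subsection \<open>Seminorms and Sobolev spaces\<close>

text \<open>Elements are plain functions and norms are seminorms on them, so linear structure is
  stated relative to a carrier with pointwise operations. The argument type is open because the same
  theory serves functions of a real variable and functionals on such functions.\<close>

locale function_space =
  fixes X :: "('b \<Rightarrow> real) set"
  assumes zero_mem: "(\<lambda>_. 0) \<in> X"
    and add_mem: "f \<in> X \<Longrightarrow> g \<in> X \<Longrightarrow> (\<lambda>x. f x + g x) \<in> X"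
    and scale_mem: "f \<in> X \<Longrightarrow> (\<lambda>x. c * f x) \<in> X"
begin

lemma uminus_mem: "f \<in> X \<Longrightarrow> (\<lambda>x. - f x) \<in> X"
  using scale_mem[of f "-1"] by simp

lemma diff_mem: "f \<in> X \<Longrightarrow> g \<in> X \<Longrightarrow> (\<lambda>x. f x - g x) \<in> X"
  using add_mem[OF _ uminus_mem, of f g] by simp

lemma sum_mem: "(\<And>i. i \<in> A \<Longrightarrow> f i \<in> X) \<Longrightarrow> (\<lambda>x. \<Sum>i\<in>A. c i * f i x) \<in> X"
proof (induction A rule: infinite_finite_induct)
  case (insert i A)
  then have "(\<lambda>x. c i * f i x + (\<Sum>i\<in>A. c i * f i x)) \<in> X" by (intro add_mem scale_mem) auto
  then show ?case using insert by simp
qed (auto simp: zero_mem)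

end

locale linear_functional = function_space X for X :: "('b \<Rightarrow> real) set" +
  fixes l :: "('b \<Rightarrow> real) \<Rightarrow> real"
  assumes add: "f \<in> X \<Longrightarrow> g \<in> X \<Longrightarrow> l (\<lambda>x. f x + g x) = l f + l g"
    and scale: "f \<in> X \<Longrightarrow> l (\<lambda>x. c * f x) = c * l f"
begin

lemma zero [simp]: "l (\<lambda>_. 0) = 0"
  using scale[OF zero_mem, of 0] by simp

lemma minus: "f \<in> X \<Longrightarrow> l (\<lambda>x. - f x) = - l f"
  using scale[of f "-1"] by simp

lemma diff: "f \<in> X \<Longrightarrow> g \<in> X \<Longrightarrow> l (\<lambda>x. f x - g x) = l f - l g"
  using add[OF _ uminus_mem, of f g] minus[of g] by simp

lemma sum: "(\<And>i. i \<in> A \<Longrightarrow> f i \<in> X) \<Longrightarrow> l (\<lambda>x. \<Sum>i\<in>A. c i * f i x) = (\<Sum>i\<in>A. c i * l (f i))"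
proof (induction A rule: infinite_finite_induct)
  case (insert i A)
  have "l (\<lambda>x. c i * f i x + (\<Sum>i\<in>A. c i * f i x)) = l (\<lambda>x. c i * f i x) + l (\<lambda>x. \<Sum>i\<in>A. c i * f i x)"
    using insert by (intro add sum_mem scale_mem) auto
  then show ?case using insert by (simp add: scale)
qed auto

end

locale seminormed_space = function_space X for X :: "('b \<Rightarrow> real) set" +
  fixes N :: "('b \<Rightarrow> real) \<Rightarrow> real"
  assumes nonneg: "f \<in> X \<Longrightarrow> 0 \<le> N f"
    and triangle: "f \<in> X \<Longrightarrow> g \<in> X \<Longrightarrow> N (\<lambda>x. f x + g x) \<le> N f + N g"
    and abs_scale: "f \<in> X \<Longrightarrow> N (\<lambda>x. c * f x) = \<bar>c\<bar> * N f"
begin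

lemma norm_zero: "N (\<lambda>_. 0) = 0"
  using abs_scale[OF zero_mem, of 0] by simp

lemma norm_uminus: "f \<in> X \<Longrightarrow> N (\<lambda>x. - f x) = N f"
  using abs_scale[of f "-1"] by simp

lemma norm_minus_commute: "f \<in> X \<Longrightarrow> g \<in> X \<Longrightarrow> N (\<lambda>x. f x - g x) = N (\<lambda>x. g x - f x)"
  using norm_uminus[OF diff_mem, of f g] by simp

lemma norm_triangle_diff: "f \<in> X \<Longrightarrow> g \<in> X \<Longrightarrow> \<bar>N f - N g\<bar> \<le> N (\<lambda>x. f x - g x)"
  using triangle[OF diff_mem, of f g g] triangle[OF diff_mem, of g f f] norm_minus_commute[of f g] by simp

lemma triangle_diff: "f \<in> X \<Longrightarrow> g \<in> X \<Longrightarrow> N (\<lambda>x. f x - g x) \<le> N f + N g"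
  using triangle[OF _ uminus_mem, of f g] norm_uminus[of g] by simp

end

locale semi_inner_product = function_space X for X :: "('b \<Rightarrow> real) set" +
  fixes ip :: "('b \<Rightarrow> real) \<Rightarrow> ('b \<Rightarrow> real) \<Rightarrow> real"
  assumes sym: "f \<in> X \<Longrightarrow> g \<in> X \<Longrightarrow> ip f g = ip g f"
    and add_left: "f \<in> X \<Longrightarrow> g \<in> X \<Longrightarrow> h \<in> X \<Longrightarrow> ip (\<lambda>x. f x + g x) h = ip f h + ip g h"
    and scale_left: "f \<in> X \<Longrightarrow> h \<in> X \<Longrightarrow> ip (\<lambda>x. c * f x) h = c * ip f h"
    and pos: "f \<in> X \<Longrightarrow> 0 \<le> ip f f"
begin

lemma left_functional: "h \<in> X \<Longrightarrow> linear_functional X (\<lambda>f. ip f h)"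
  by unfold_locales (auto simp: add_left scale_left)

lemma right_functional: "h \<in> X \<Longrightarrow> linear_functional X (ip h)"
  by unfold_locales (auto simp: sym[of h] add_left scale_left add_mem scale_mem)

lemmas diff_left = linear_functional.diff[OF left_functional]
  and diff_right = linear_functional.diff[OF right_functional]
  and add_right = linear_functional.add[OF right_functional]
  and scale_right = linear_functional.scale[OF right_functional]

lemma ip_square_add:
  assumes "f \<in> X" "g \<in> X"
  shows "ip (\<lambda>x. f x + c * g x) (\<lambda>x. f x + c * g x) = ip f f + 2 * c * ip f g + c\<^sup>2 * ip g g"
proof -
  have *: "(\<lambda>x. c * g x) \<in> X" using assms by (intro scale_mem)
  show ?thesis
    using assms * by (simp add: add_left add_right scale_left scale_right add_mem sym[of g f] power2_eq_square algebra_simps)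
qed

text \<open>Besides the usual minimisation in \<open>c\<close> there is a degenerate case, as the
  form is only semidefinite: if \<open>ip g g = 0\<close>, the quadratic is affine in
  \<open>c\<close> and can stay nonnegative only with slope 0.\<close>

lemma cauchy_schwarz_sq:
  assumes "f \<in> X" "g \<in> X"
  shows "(ip f g)\<^sup>2 \<le> ip f f * ip g g"
proof -
  have *: "0 \<le> ip f f + 2 * c * ip f g + c\<^sup>2 * ip g g" for c
    using pos[of "\<lambda>x. f x + c * g x"] ip_square_add[OF assms] assms by (simp add: add_mem scale_mem)
  show ?thesis
  proof (cases "ip g g = 0")
    case True
    have "ip f g = 0"
    proof (rule ccontr)
      assume "ip f g \<noteq> 0"
      \<comment> \<open>The value of \<open>c\<close> chosen here makes the affine expression equal
        to -1.\<close>
      then show False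
        using *[of "- (ip f f + 1) / (2 * ip f g)"] True by (simp add: field_simps)
    qed
    then show ?thesis using True by simp
  next
    case False
    then have g: "ip g g > 0" using pos[OF assms(2)] by simp
    have "0 \<le> ip g g * (ip f f + 2 * (- ip f g / ip g g) * ip f g + (- ip f g / ip g g)\<^sup>2 * ip g g)"
      using *[of "- ip f g / ip g g"] g by simp
    also have "\<dots> = ip f f * ip g g - (ip f g)\<^sup>2"
      using g by (simp add: field_simps power2_eq_square)
    finally show ?thesis by simp
  qed
qed

lemma cauchy_schwarz:
  assumes "f \<in> X" "g \<in> X"
  shows "\<bar>ip f g\<bar> \<le> sqrt (ip f f) * sqrt (ip g g)"
  using real_sqrt_le_mono[OF cauchy_schwarz_sq[OF assms]] by (simp add: real_sqrt_mult)

lemma seminormed: "seminormed_space X (\<lambda>f. sqrt (ip f f))"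
proof
  fix f g :: "'b \<Rightarrow> real" and c :: real
  assume f: "f \<in> X"
  then show "0 \<le> sqrt (ip f f)" using pos by simp
  show "sqrt (ip (\<lambda>x. c * f x) (\<lambda>x. c * f x)) = \<bar>c\<bar> * sqrt (ip f f)"
    using f by (simp add: scale_left scale_right scale_mem real_sqrt_mult mult.assoc[symmetric])
  assume g: "g \<in> X"
  have "ip (\<lambda>x. f x + g x) (\<lambda>x. f x + g x) = ip f f + 2 * ip f g + ip g g"
    using ip_square_add[OF f g, of 1] by simp
  also have "\<dots> \<le> (sqrt (ip f f) + sqrt (ip g g))\<^sup>2"
    using cauchy_schwarz[OF f g] pos[OF f] pos[OF g] by (simp add: power2_sum abs_le_iff)
  finally show "sqrt (ip (\<lambda>x. f x + g x) (\<lambda>x. f x + g x)) \<le> sqrt (ip f f) + sqrt (ip g g)"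
    using pos[OF f] pos[OF g] by (intro real_le_lsqrt) auto
qed

lemma subspace_semi_inner_product:
  assumes "function_space Y" "Y \<subseteq> X"
  shows "semi_inner_product Y ip"
proof -
  interpret Y: function_space Y by fact
  show ?thesis using assms(2) by unfold_locales (auto simp: sym add_left scale_left pos subset_iff)
qed

end

section \<open>The space of square integrable functions\<close>

lemma L2_measurable: "f \<in> L2 A \<Longrightarrow> f \<in> borel_measurable (lebesgue_on A)"
  and L2_integrable_square: "f \<in> L2 A \<Longrightarrow> integrable (lebesgue_on A) (\<lambda>x. (f x)\<^sup>2)"
  by (simp_all add: L2_def)

lemma L2_integrable_mult:
  assumes "f \<in> L2 A" "g \<in> L2 A"
  shows "integrable (lebesgue_on A) (\<lambda>x. f x * g x)"
proof (rule Bochner_Integration.integrable_bound[where f="\<lambda>x. (f x)\<^sup>2 + (g x)\<^sup>2"])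
  show "AE x in lebesgue_on A. norm (f x * g x) \<le> norm ((f x)\<^sup>2 + (g x)\<^sup>2)"
  proof (intro AE_I2)
    fix x
    have "2 * (\<bar>f x\<bar> * \<bar>g x\<bar>) \<le> (f x)\<^sup>2 + (g x)\<^sup>2"
      using zero_le_power2[of "\<bar>f x\<bar> - \<bar>g x\<bar>"] by (simp add: power2_diff)
    moreover have "0 \<le> \<bar>f x\<bar> * \<bar>g x\<bar>" by simp
    ultimately show "norm (f x * g x) \<le> norm ((f x)\<^sup>2 + (g x)\<^sup>2)"
      unfolding real_norm_def abs_mult by linarith
  qed
qed (use assms in \<open>auto simp: L2_def\<close>)

lemma L2_semi_inner_product: "semi_inner_product (L2 A) (L2_inner A)"
proof
  show zero: "(\<lambda>_. 0) \<in> L2 A" by (simp add: L2_def)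
  show add: "(\<lambda>x. f x + g x) \<in> L2 A" if "f \<in> L2 A" "g \<in> L2 A" for f g
    using that L2_integrable_mult[OF that]
    by (auto simp: L2_def power2_sum mult.assoc intro!: Bochner_Integration.integrable_add)
  show scale: "(\<lambda>x. c * f x) \<in> L2 A" if "f \<in> L2 A" for f c
    using that by (auto simp: L2_def power_mult_distrib)
  show "L2_inner A f g = L2_inner A g f" for f g by (simp add: L2_inner_def mult.commute)
  show "L2_inner A (\<lambda>x. f x + g x) h = L2_inner A f h + L2_inner A g h"
    if "f \<in> L2 A" "g \<in> L2 A" "h \<in> L2 A" for f g h
    using that by (simp add: L2_inner_def distrib_right L2_integrable_mult)
  show "L2_inner A (\<lambda>x. c * f x) h = c * L2_inner A f h" for f h c
    by (simp add: L2_inner_def mult.assoc)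
  show "0 \<le> L2_inner A f f" for f by (simp add: L2_inner_def)
qed

interpretation L2: semi_inner_product "L2 A" "L2_inner A" for A
  by (rule L2_semi_inner_product)

interpretation L2n: seminormed_space "L2 A" "L2_norm A" for A
  using L2.seminormed[of A] by (simp add: L2_norm_def[abs_def])

lemma L2_norm_square: "(L2_norm A f)\<^sup>2 = L2_inner A f f"
  by (simp add: L2_norm_def L2_inner_def)

lemma L2_cauchy_schwarz: "f \<in> L2 A \<Longrightarrow> g \<in> L2 A \<Longrightarrow> \<bar>L2_inner A f g\<bar> \<le> L2_norm A f * L2_norm A g"
  unfolding L2_norm_def by (rule L2.cauchy_schwarz)

lemma L2_inner_AE_cong:
  assumes "f \<in> L2 A" "f' \<in> L2 A" "g \<in> L2 A" "g' \<in> L2 A"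
    and "AE x in lebesgue_on A. f x = f' x" "AE x in lebesgue_on A. g x = g' x"
  shows "L2_inner A f g = L2_inner A f' g'"
  unfolding L2_inner_def
proof (rule integral_cong_AE)
  show "AE x in lebesgue_on A. f x * g x = f' x * g' x"
    using assms(5,6) by eventually_elim simp
  show "(\<lambda>x. f x * g x) \<in> borel_measurable (lebesgue_on A)" "(\<lambda>x. f' x * g' x) \<in> borel_measurable (lebesgue_on A)"
    using assms(1-4)[THEN L2_measurable] by auto
qed

lemma L2_compact_support:
  fixes f :: "real \<Rightarrow> real"
  assumes "continuous_on UNIV f" "compact K" "\<And>x. x \<notin> K \<Longrightarrow> f x = 0" "A \<in> sets lebesgue"
  shows "f \<in> L2 A"
proof -
  have "integrable lebesgue (\<lambda>x. (f x)\<^sup>2)"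
    using assms by (intro integrable_compact_support(2)[of _ K] continuous_intros) auto
  then show ?thesis
    using assms by (auto simp: L2_def intro!: integrable_lebesgue_on_subset measurable_restrict_space1 measurable_completion borel_measurable_continuous_onI)
qed

lemma test_functions_L2: "\<phi> \<in> test_functions U \<Longrightarrow> A \<in> sets lebesgue \<Longrightarrow> \<phi> \<in> L2 A"
  by (meson L2_compact_support smooth_continuous_on test_functions_smooth test_functions_support)

section \<open>Weak derivatives and Sobolev spaces\<close>

locale open_set =
  fixes \<Omega> :: "real set"
  assumes open_\<Omega>: "open \<Omega>"
begin

lemma \<Omega>_lebesgue [simp]: "\<Omega> \<in> sets lebesgue"
  using open_\<Omega> by simp

lemma test_L2: "\<phi> \<in> test_functions \<Omega> \<Longrightarrow> \<phi> \<in> L2 \<Omega>"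
  by (simp add: test_functions_L2)

lemma has_weak_deriv_L2:
  assumes "has_weak_deriv \<Omega> g h" shows "g \<in> L2 \<Omega>" "h \<in> L2 \<Omega>"
  using assms by (simp_all add: has_weak_deriv_def)

lemma has_weak_deriv_zero: "has_weak_deriv \<Omega> (\<lambda>_. 0) (\<lambda>_. 0)"
  by (simp add: has_weak_deriv_def L2.zero_mem L2_inner_def)

lemma has_weak_deriv_add:
  assumes "has_weak_deriv \<Omega> g h" "has_weak_deriv \<Omega> g' h'"
  shows "has_weak_deriv \<Omega> (\<lambda>x. g x + g' x) (\<lambda>x. h x + h' x)"
  using assms unfolding has_weak_deriv_def
  by (simp add: L2.add_mem L2.add_left test_L2 test_functions_deriv)

lemma has_weak_deriv_scale:
  assumes "has_weak_deriv \<Omega> g h"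
  shows "has_weak_deriv \<Omega> (\<lambda>x. c * g x) (\<lambda>x. c * h x)"
  using assms unfolding has_weak_deriv_def
  by (simp add: L2.scale_mem L2.scale_left test_L2 test_functions_deriv)

lemma L2_integrable_interval:
  assumes "f \<in> L2 \<Omega>" "{c..d} \<subseteq> \<Omega>"
  shows "integrable (lebesgue_on {c..d}) f"
proof -
  have f: "f \<in> borel_measurable (lebesgue_on {c..d})" "integrable (lebesgue_on {c..d}) (\<lambda>x. (f x)\<^sup>2)"
    using measurable_restrict_mono[OF L2_measurable[OF assms(1)] assms(2)]
      integrable_lebesgue_on_mono[OF L2_integrable_square[OF assms(1)] assms(2)] by simp_all
  have "integrable (lebesgue_on {c..d}) (\<lambda>x. 1 + (f x)\<^sup>2)"
    by (intro Bochner_Integration.integrable_add f continuous_imp_integrable_real) simp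
  then show ?thesis
  proof (rule Bochner_Integration.integrable_bound[OF _ f(1)], intro AE_I2)
    fix x
    have "2 * \<bar>f x\<bar> \<le> 1 + (f x)\<^sup>2" using zero_le_power2[of "\<bar>f x\<bar> - 1"] by (simp add: power2_diff)
    then show "norm (f x) \<le> norm (1 + (f x)\<^sup>2)" by simp
  qed
qed

text \<open>Makes the arbitrary choice in \<open>weak_deriv\<close> harmless: identities between
  weak derivatives hold almost everywhere whichever representative is picked.\<close>

lemma has_weak_deriv_unique:
  assumes "has_weak_deriv \<Omega> g h" "has_weak_deriv \<Omega> g h'"
  shows "AE x in lebesgue_on \<Omega>. h x = h' x"
proof -
  note h = has_weak_deriv_L2[OF assms(1)] has_weak_deriv_L2[OF assms(2)]
  have "AE x in lebesgue_on \<Omega>. h x - h' x = 0"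
  proof (rule fundamental_lemma_calculus_of_variations[OF open_\<Omega>])
    show "(LINT x|lebesgue_on \<Omega>. (h x - h' x) * \<phi> x) = 0" if "\<phi> \<in> test_functions \<Omega>" for \<phi>
    proof -
      have "L2_inner \<Omega> (\<lambda>x. h x - h' x) \<phi> = L2_inner \<Omega> h \<phi> - L2_inner \<Omega> h' \<phi>"
        using h test_L2[OF that] by (intro L2.diff_left) auto
      also have "\<dots> = 0" using assms that unfolding has_weak_deriv_def by fastforce
      finally show ?thesis by (simp add: L2_inner_def)
    qed
    show "(\<lambda>x. h x - h' x) \<in> borel_measurable (lebesgue_on \<Omega>)"
      using h by (intro L2_measurable L2.diff_mem)
  qed (use h in \<open>auto intro!: L2_integrable_interval L2.diff_mem\<close>)
  then show ?thesis by simp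
qed

lemma weak_deriv: "g \<in> H1 \<Omega> \<Longrightarrow> has_weak_deriv \<Omega> g (weak_deriv \<Omega> g)"
  unfolding H1_def weak_deriv_def by (simp, erule someI_ex)

lemma H1_L2: "g \<in> H1 \<Omega> \<Longrightarrow> g \<in> L2 \<Omega>" "g \<in> H1 \<Omega> \<Longrightarrow> weak_deriv \<Omega> g \<in> L2 \<Omega>"
  using weak_deriv has_weak_deriv_L2 by blast+

lemma H1_I: "has_weak_deriv \<Omega> g h \<Longrightarrow> g \<in> H1 \<Omega>"
  by (auto simp: H1_def)

lemma weak_deriv_AE: "has_weak_deriv \<Omega> g h \<Longrightarrow> AE x in lebesgue_on \<Omega>. weak_deriv \<Omega> g x = h x"
  using weak_deriv[OF H1_I] by (rule has_weak_deriv_unique)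

lemma H1_function_space: "function_space (H1 \<Omega>)"
  by unfold_locales
     (blast intro: H1_I has_weak_deriv_zero has_weak_deriv_add has_weak_deriv_scale weak_deriv)+

sublocale H1: function_space "H1 \<Omega>" by (rule H1_function_space)

lemma weak_deriv_add:
  "g \<in> H1 \<Omega> \<Longrightarrow> g' \<in> H1 \<Omega> \<Longrightarrow>
    AE x in lebesgue_on \<Omega>. weak_deriv \<Omega> (\<lambda>x. g x + g' x) x = weak_deriv \<Omega> g x + weak_deriv \<Omega> g' x"
  by (intro weak_deriv_AE has_weak_deriv_add weak_deriv)

lemma weak_deriv_scale:
  "g \<in> H1 \<Omega> \<Longrightarrow> AE x in lebesgue_on \<Omega>. weak_deriv \<Omega> (\<lambda>x. c * g x) x = c * weak_deriv \<Omega> g x"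
  by (intro weak_deriv_AE has_weak_deriv_scale weak_deriv)

lemma weighted_L2:
  assumes "a \<in> borel_measurable (lebesgue_on \<Omega>)" "\<And>x. 0 \<le> a x" "\<And>x. a x \<le> 1" "f \<in> L2 \<Omega>"
  shows "(\<lambda>x. a x * f x) \<in> L2 \<Omega>"
proof -
  have m: "(\<lambda>x. a x * f x) \<in> borel_measurable (lebesgue_on \<Omega>)"
    using assms(1) L2_measurable[OF assms(4)] by (rule borel_measurable_times)
  have "integrable (lebesgue_on \<Omega>) (\<lambda>x. (a x * f x)\<^sup>2)"
  proof (rule Bochner_Integration.integrable_bound[OF L2_integrable_square[OF assms(4)]])
    have "(a x)\<^sup>2 \<le> 1" for x using assms(2,3)[of x] by (simp add: power_le_one)
    then show "AE x in lebesgue_on \<Omega>. norm ((a x * f x)\<^sup>2) \<le> norm ((f x)\<^sup>2)"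
      by (intro AE_I2) (auto simp: power_mult_distrib intro!: mult_left_le_one_le)
  qed (use m in simp)
  with m show ?thesis by (simp add: L2_def)
qed

definition dirichlet_form :: "(real \<Rightarrow> real) \<Rightarrow> (real \<Rightarrow> real) \<Rightarrow> (real \<Rightarrow> real) \<Rightarrow> real" where
  "dirichlet_form a g h = L2_inner \<Omega> (\<lambda>x. a x * weak_deriv \<Omega> g x) (weak_deriv \<Omega> h)"

lemma dirichlet_form_semi_inner_product:
  assumes a: "a \<in> borel_measurable (lebesgue_on \<Omega>)" "\<And>x. 0 \<le> a x" "\<And>x. a x \<le> 1"
  shows "semi_inner_product (H1 \<Omega>) (dirichlet_form a)"
proof
  fix f g h :: "real \<Rightarrow> real" and c :: real
  assume f: "f \<in> H1 \<Omega>"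
  note w = weighted_L2[OF a]
  show "0 \<le> dirichlet_form a f f"
    unfolding dirichlet_form_def L2_inner_def by (rule Bochner_Integration.integral_nonneg) (simp add: mult.assoc a(2))
  show "dirichlet_form a f g = dirichlet_form a g f"
    by (simp add: dirichlet_form_def L2_inner_def mult.commute mult.left_commute)
  assume h: "h \<in> H1 \<Omega>"
  \<comment> \<open>The chosen representative of the weak derivative is homogeneous only almost
    everywhere, so the replacement is made under the integral; additivity is treated in the same
    way.\<close>
  have "L2_inner \<Omega> (\<lambda>x. a x * weak_deriv \<Omega> (\<lambda>x. c * f x) x) (weak_deriv \<Omega> h) =
      L2_inner \<Omega> (\<lambda>x. c * (a x * weak_deriv \<Omega> f x)) (weak_deriv \<Omega> h)"
  proof (rule L2_inner_AE_cong)
    show "AE x in lebesgue_on \<Omega>. a x * weak_deriv \<Omega> (\<lambda>x. c * f x) x = c * (a x * weak_deriv \<Omega> f x)"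
      using weak_deriv_scale[OF f, of c] by eventually_elim simp
  qed (rule w H1_L2(2) L2.scale_mem H1.scale_mem f h AE_I2 refl)+
  then show "dirichlet_form a (\<lambda>x. c * f x) h = c * dirichlet_form a f h"
    unfolding dirichlet_form_def using f h by (simp add: L2.scale_left w H1_L2)
  assume g: "g \<in> H1 \<Omega>"
  have "L2_inner \<Omega> (\<lambda>x. a x * weak_deriv \<Omega> (\<lambda>x. f x + g x) x) (weak_deriv \<Omega> h) =
      L2_inner \<Omega> (\<lambda>x. a x * weak_deriv \<Omega> f x + a x * weak_deriv \<Omega> g x) (weak_deriv \<Omega> h)"
  proof (rule L2_inner_AE_cong)
    show "AE x in lebesgue_on \<Omega>. a x * weak_deriv \<Omega> (\<lambda>x. f x + g x) x =
        a x * weak_deriv \<Omega> f x + a x * weak_deriv \<Omega> g x"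
      using weak_deriv_add[OF f g] by eventually_elim (simp add: algebra_simps)
  qed (rule w H1_L2(2) L2.add_mem H1.add_mem f g h AE_I2 refl)+
  then show "dirichlet_form a (\<lambda>x. f x + g x) h = dirichlet_form a f h + dirichlet_form a g h"
    unfolding dirichlet_form_def using f g h by (simp add: L2.add_left w H1_L2)
qed

text \<open>Exhibits \<open>H1_norm\<close> as the norm of a semi-inner product, so that its
  triangle inequality follows from Cauchy-Schwarz.\<close>

definition H1_inner :: "(real \<Rightarrow> real) \<Rightarrow> (real \<Rightarrow> real) \<Rightarrow> real" where
  "H1_inner g h = L2_inner \<Omega> g h + dirichlet_form (\<lambda>_. 1) g h"

lemma H1_inner_semi_inner_product: "semi_inner_product (H1 \<Omega>) H1_inner"
proof -
  interpret D: semi_inner_product "H1 \<Omega>" "dirichlet_form (\<lambda>_. 1)"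
    by (rule dirichlet_form_semi_inner_product) auto
  show ?thesis
    by unfold_locales
       (simp_all add: H1_inner_def H1_L2 L2.add_left L2.scale_left L2.pos D.add_left D.scale_left D.pos
          L2.sym D.sym algebra_simps)
qed

lemma H1_norm_eq: "H1_norm \<Omega> g = sqrt (H1_inner g g)"
  by (simp add: H1_norm_def H1_inner_def dirichlet_form_def L2_norm_square)

sublocale H1n: seminormed_space "H1 \<Omega>" "H1_norm \<Omega>"
  using semi_inner_product.seminormed[OF H1_inner_semi_inner_product] by (simp add: H1_norm_eq[abs_def])

lemma L2_norm_le_H1_norm: "L2_norm \<Omega> g \<le> H1_norm \<Omega> g"
  unfolding H1_norm_def by (rule real_le_rsqrt) simp

lemma dirichlet_form_le_H1_norm:
  assumes a: "a \<in> borel_measurable (lebesgue_on \<Omega>)" "\<And>x. 0 \<le> a x" "\<And>x. a x \<le> 1" and g: "g \<in> H1 \<Omega>"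
  shows "dirichlet_form a g g \<le> (H1_norm \<Omega> g)\<^sup>2"
proof -
  have "dirichlet_form a g g \<le> L2_inner \<Omega> (weak_deriv \<Omega> g) (weak_deriv \<Omega> g)"
    unfolding dirichlet_form_def L2_inner_def
  proof (rule integral_mono)
    show "a x * weak_deriv \<Omega> g x * weak_deriv \<Omega> g x \<le> weak_deriv \<Omega> g x * weak_deriv \<Omega> g x" for x
      using a(2,3)[of x] by (simp add: mult.assoc mult_left_le_one_le)
  qed (rule L2_integrable_mult weighted_L2 a H1_L2(2) g)+
  also have "\<dots> \<le> (H1_norm \<Omega> g)\<^sup>2"
    unfolding H1_norm_def by (simp add: L2_norm_square L2_inner_def)
  finally show ?thesis .
qed

lemma test_functions_weak_deriv:
  assumes "\<phi> \<in> test_functions \<Omega>" shows "has_weak_deriv \<Omega> \<phi> (deriv \<phi>)"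
  unfolding has_weak_deriv_def L2_inner_def
  using assms test_functions_integral_by_parts[OF assms] by (auto intro: test_L2 test_functions_deriv)

lemma test_functions_H1_0: "\<phi> \<in> test_functions \<Omega> \<Longrightarrow> \<phi> \<in> H1_0 \<Omega>"
  unfolding H1_0_def
  by (auto intro!: H1_I[OF test_functions_weak_deriv] exI[of _ "\<lambda>_. \<phi>"] simp: H1n.norm_zero)

lemma H1_0_H1: "g \<in> H1_0 \<Omega> \<Longrightarrow> g \<in> H1 \<Omega>"
  by (simp add: H1_0_def)

lemma H1_0_subset: "H1_0 \<Omega> \<subseteq> H1 \<Omega>"
  by (auto simp: H1_0_def)

lemma test_functions_H1: "\<phi> \<in> test_functions \<Omega> \<Longrightarrow> \<phi> \<in> H1 \<Omega>"
  by (intro H1_0_H1 test_functions_H1_0)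

lemma H1_0_function_space: "function_space (H1_0 \<Omega>)"
proof
  have "(\<lambda>x. 0 * 0) \<in> test_functions \<Omega>"
    by (rule test_functionsI[of _ "{}"]) (auto simp: smooth_const)
  then show "(\<lambda>_. 0) \<in> H1_0 \<Omega>" by (intro test_functions_H1_0) simp
next
  fix f g assume f: "f \<in> H1_0 \<Omega>" and g: "g \<in> H1_0 \<Omega>"
  obtain \<phi> where \<phi>: "\<And>n::nat. \<phi> n \<in> test_functions \<Omega>" "(\<lambda>n. H1_norm \<Omega> (\<lambda>x. \<phi> n x - f x)) \<longlonglongrightarrow> 0"
    using f by (auto simp: H1_0_def)
  obtain \<psi> where \<psi>: "\<And>n::nat. \<psi> n \<in> test_functions \<Omega>" "(\<lambda>n. H1_norm \<Omega> (\<lambda>x. \<psi> n x - g x)) \<longlonglongrightarrow> 0"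
    using g by (auto simp: H1_0_def)
  note [intro] = H1_0_H1[OF f] H1_0_H1[OF g] test_functions_H1[OF \<phi>(1)] test_functions_H1[OF \<psi>(1)] H1.diff_mem H1.add_mem
  have "(\<lambda>n. H1_norm \<Omega> (\<lambda>x. (\<phi> n x + \<psi> n x) - (f x + g x))) \<longlonglongrightarrow> 0"
  proof (rule tendsto_sandwich[OF always_eventually always_eventually tendsto_const])
    show "\<forall>n. 0 \<le> H1_norm \<Omega> (\<lambda>x. (\<phi> n x + \<psi> n x) - (f x + g x))"
      by (intro allI H1n.nonneg H1.diff_mem H1.add_mem) blast+
    show "\<forall>n. H1_norm \<Omega> (\<lambda>x. (\<phi> n x + \<psi> n x) - (f x + g x)) \<le>
        H1_norm \<Omega> (\<lambda>x. \<phi> n x - f x) + H1_norm \<Omega> (\<lambda>x. \<psi> n x - g x)"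
    proof
      fix n
      have "H1_norm \<Omega> (\<lambda>x. (\<phi> n x - f x) + (\<psi> n x - g x)) \<le>
        H1_norm \<Omega> (\<lambda>x. \<phi> n x - f x) + H1_norm \<Omega> (\<lambda>x. \<psi> n x - g x)"
        by (intro H1n.triangle) blast+
      then show "H1_norm \<Omega> (\<lambda>x. (\<phi> n x + \<psi> n x) - (f x + g x)) \<le>
        H1_norm \<Omega> (\<lambda>x. \<phi> n x - f x) + H1_norm \<Omega> (\<lambda>x. \<psi> n x - g x)"
        by (simp add: algebra_simps)
    qed
    show "(\<lambda>n. H1_norm \<Omega> (\<lambda>x. \<phi> n x - f x) + H1_norm \<Omega> (\<lambda>x. \<psi> n x - g x)) \<longlonglongrightarrow> 0"
      using tendsto_add[OF \<phi>(2) \<psi>(2)] by simp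
  qed
  then show "(\<lambda>x. f x + g x) \<in> H1_0 \<Omega>"
    unfolding H1_0_def using \<phi>(1) \<psi>(1)
    by (auto intro!: exI[of _ "\<lambda>n x. \<phi> n x + \<psi> n x"] intro: test_functions_add)
next
  fix f c assume f: "f \<in> H1_0 \<Omega>"
  obtain \<phi> where \<phi>: "\<And>n::nat. \<phi> n \<in> test_functions \<Omega>" "(\<lambda>n. H1_norm \<Omega> (\<lambda>x. \<phi> n x - f x)) \<longlonglongrightarrow> 0"
    using f by (auto simp: H1_0_def)
  have "H1_norm \<Omega> (\<lambda>x. c * \<phi> n x - c * f x) = \<bar>c\<bar> * H1_norm \<Omega> (\<lambda>x. \<phi> n x - f x)" for n
    using H1n.abs_scale[of "\<lambda>x. \<phi> n x - f x" c] H1.diff_mem[OF test_functions_H1[OF \<phi>(1)] H1_0_H1[OF f], of n]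
    by (simp add: right_diff_distrib)
  then have "(\<lambda>n. H1_norm \<Omega> (\<lambda>x. c * \<phi> n x - c * f x)) \<longlonglongrightarrow> 0"
    using tendsto_mult_left[OF \<phi>(2), of "\<bar>c\<bar>"] by simp
  then show "(\<lambda>x. c * f x) \<in> H1_0 \<Omega>"
    unfolding H1_0_def using \<phi>(1) H1.scale_mem[OF H1_0_H1[OF f]]
    by (auto intro!: exI[of _ "\<lambda>n x. c * \<phi> n x"] intro: test_functions_cmult)
qed

sublocale H1_0: function_space "H1_0 \<Omega>" by (rule H1_0_function_space)

sublocale H1_0n: seminormed_space "H1_0 \<Omega>" "H1_norm \<Omega>"
  by unfold_locales (auto simp: H1_0_H1 H1n.nonneg H1n.triangle H1n.abs_scale)

lemma H1_0_L2: "g \<in> H1_0 \<Omega> \<Longrightarrow> g \<in> L2 \<Omega>"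
  by (intro H1_L2 H1_0_H1)

lemma H1_0_L2_approx:
  assumes "g \<in> H1_0 \<Omega>" "e > 0"
  obtains \<phi> where "\<phi> \<in> test_functions \<Omega>" "L2_norm \<Omega> (\<lambda>x. \<phi> x - g x) < e"
proof -
  obtain \<phi> where \<phi>: "\<And>n::nat. \<phi> n \<in> test_functions \<Omega>" "(\<lambda>n. H1_norm \<Omega> (\<lambda>x. \<phi> n x - g x)) \<longlonglongrightarrow> 0"
    using assms by (auto simp: H1_0_def)
  then obtain n where "H1_norm \<Omega> (\<lambda>x. \<phi> n x - g x) < e"
    using order_tendstoD(2)[OF \<phi>(2) assms(2)] by (auto simp: eventually_sequentially)
  then show ?thesis using that[OF \<phi>(1)[of n]] L2_norm_le_H1_norm[of "\<lambda>x. \<phi> n x - g x"] by simp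
qed

section \<open>The dual of the Sobolev space\<close>

lemma H_minus1_functional: "F \<in> H_minus1 \<Omega> \<Longrightarrow> linear_functional (H1_0 \<Omega>) F"
  by unfold_locales (simp_all add: H_minus1_def)

lemma H_minus1_function_space: "function_space (H_minus1 \<Omega>)"
proof
  show "(\<lambda>_. 0) \<in> H_minus1 \<Omega>"
    using H1_0n.nonneg by (auto simp: H_minus1_def intro!: exI[of _ 0])
next
  fix F G assume "F \<in> H_minus1 \<Omega>" "G \<in> H_minus1 \<Omega>"
  moreover from this obtain C D where "\<forall>v\<in>H1_0 \<Omega>. \<bar>F v\<bar> \<le> C * H1_norm \<Omega> v" "\<forall>v\<in>H1_0 \<Omega>. \<bar>G v\<bar> \<le> D * H1_norm \<Omega> v"
    by (auto simp: H_minus1_def)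
  then have "\<forall>v\<in>H1_0 \<Omega>. \<bar>F v + G v\<bar> \<le> (C + D) * H1_norm \<Omega> v"
    by (fastforce simp: distrib_right)
  then have "\<exists>C. \<forall>v\<in>H1_0 \<Omega>. \<bar>F v + G v\<bar> \<le> C * H1_norm \<Omega> v" by blast
  ultimately show "(\<lambda>v. F v + G v) \<in> H_minus1 \<Omega>"
    unfolding H_minus1_def by (simp add: distrib_left)
next
  fix F c assume F: "F \<in> H_minus1 \<Omega>"
  then obtain C where "\<forall>v\<in>H1_0 \<Omega>. \<bar>F v\<bar> \<le> C * H1_norm \<Omega> v" by (auto simp: H_minus1_def)
  then have "\<forall>v\<in>H1_0 \<Omega>. \<bar>c * F v\<bar> \<le> (\<bar>c\<bar> * C) * H1_norm \<Omega> v"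
    by (auto simp: abs_mult mult.assoc intro!: mult_left_mono)
  then have "\<exists>C. \<forall>v\<in>H1_0 \<Omega>. \<bar>c * F v\<bar> \<le> C * H1_norm \<Omega> v" by blast
  then show "(\<lambda>v. c * F v) \<in> H_minus1 \<Omega>"
    using F unfolding H_minus1_def by (simp add: distrib_left mult.left_commute)
qed

sublocale Hm: function_space "H_minus1 \<Omega>" by (rule H_minus1_function_space)

lemma H_minus1_bdd:
  assumes "F \<in> H_minus1 \<Omega>"
  shows "bdd_above ((\<lambda>v. \<bar>F v\<bar>) ` {v \<in> H1_0 \<Omega>. H1_norm \<Omega> v \<le> 1})"
proof -
  obtain C where C: "\<forall>v\<in>H1_0 \<Omega>. \<bar>F v\<bar> \<le> C * H1_norm \<Omega> v" using assms by (auto simp: H_minus1_def)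
  show ?thesis
  proof (rule bdd_aboveI2[where M="\<bar>C\<bar>"])
    fix v assume v: "v \<in> {v \<in> H1_0 \<Omega>. H1_norm \<Omega> v \<le> 1}"
    then have "\<bar>F v\<bar> \<le> C * H1_norm \<Omega> v" using C by blast
    also have "\<dots> \<le> \<bar>C\<bar> * H1_norm \<Omega> v" using v H1_0n.nonneg by (intro mult_right_mono) auto
    also have "\<dots> \<le> \<bar>C\<bar> * 1" using v by (intro mult_left_mono) auto
    finally show "\<bar>F v\<bar> \<le> \<bar>C\<bar>" by simp
  qed
qed

text \<open>Rescaling to norm 1 reduces the claim to the supremum. A nonzero \<open>v\<close> may
  have seminorm 0 and cannot be rescaled; then the boundedness clause of \<open>H_minus1\<close>
  gives \<open>F v = 0\<close>.\<close>

lemma H_minus1_norm_bound: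
  assumes F: "F \<in> H_minus1 \<Omega>" and v: "v \<in> H1_0 \<Omega>"
  shows "\<bar>F v\<bar> \<le> H_minus1_norm \<Omega> F * H1_norm \<Omega> v"
proof -
  interpret F: linear_functional "H1_0 \<Omega>" F using F by (rule H_minus1_functional)
  have unit: "\<bar>F w\<bar> \<le> H_minus1_norm \<Omega> F" if "w \<in> H1_0 \<Omega>" "H1_norm \<Omega> w \<le> 1" for w
    unfolding H_minus1_norm_def using that by (intro cSUP_upper H_minus1_bdd F) auto
  show ?thesis
  proof (cases "H1_norm \<Omega> v = 0")
    case True
    then show ?thesis using F v by (auto simp: H_minus1_def)
  next
    case False
    then have p: "H1_norm \<Omega> v > 0" using H1_0n.nonneg[OF v] by simp
    have "\<bar>F (\<lambda>x. inverse (H1_norm \<Omega> v) * v x)\<bar> \<le> H_minus1_norm \<Omega> F"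
      using p by (intro unit H1_0.scale_mem v) (simp add: H1_0n.abs_scale[OF v])
    then have "inverse (H1_norm \<Omega> v) * \<bar>F v\<bar> \<le> H_minus1_norm \<Omega> F"
      using p by (simp only: F.scale[OF v] abs_mult) simp
    then show ?thesis using p by (simp add: field_simps)
  qed
qed

sublocale Hmn: seminormed_space "H_minus1 \<Omega>" "H_minus1_norm \<Omega>"
proof
  have ne: "{v \<in> H1_0 \<Omega>. H1_norm \<Omega> v \<le> 1} \<noteq> {}"
    using H1_0.zero_mem H1_0n.norm_zero by auto
  fix F G :: "(real \<Rightarrow> real) \<Rightarrow> real" and c :: real
  assume F: "F \<in> H_minus1 \<Omega>"
  have *: "\<bar>F v\<bar> \<le> H_minus1_norm \<Omega> F" if F: "F \<in> H_minus1 \<Omega>" and "v \<in> H1_0 \<Omega>" "H1_norm \<Omega> v \<le> 1" for F v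
    unfolding H_minus1_norm_def using that by (intro cSUP_upper H_minus1_bdd F) auto
  show nn: "0 \<le> H_minus1_norm \<Omega> F" if F: "F \<in> H_minus1 \<Omega>" for F
    using *[OF F H1_0.zero_mem] H1_0n.norm_zero by (metis abs_ge_zero order_trans zero_le_one)
  show "H_minus1_norm \<Omega> (\<lambda>v. c * F v) = \<bar>c\<bar> * H_minus1_norm \<Omega> F"
  proof (rule antisym)
    have le: "H_minus1_norm \<Omega> (\<lambda>v. c * F v) \<le> \<bar>c\<bar> * H_minus1_norm \<Omega> F" if F: "F \<in> H_minus1 \<Omega>" for c F
      unfolding H_minus1_norm_def[of _ "\<lambda>v. c * F v"]
      by (intro cSUP_least ne) (auto simp: abs_mult intro!: mult_left_mono *[OF F])
    then show "H_minus1_norm \<Omega> (\<lambda>v. c * F v) \<le> \<bar>c\<bar> * H_minus1_norm \<Omega> F" using F .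
    \<comment> \<open>The reverse inequality is the one just shown, applied to the functional
      \<open>c * F\<close> and the scalar 1/c.\<close>
    show "\<bar>c\<bar> * H_minus1_norm \<Omega> F \<le> H_minus1_norm \<Omega> (\<lambda>v. c * F v)"
    proof (cases "c = 0")
      case True
      then show ?thesis using nn[OF Hm.scale_mem[OF F, of c]] by simp
    next
      case False
      have "H_minus1_norm \<Omega> (\<lambda>v. inverse c * (c * F v)) \<le> \<bar>inverse c\<bar> * H_minus1_norm \<Omega> (\<lambda>v. c * F v)"
        by (rule le[OF Hm.scale_mem[OF F]])
      then show ?thesis using False by (simp add: mult.assoc[symmetric] field_simps)
    qed
  qed
  assume G: "G \<in> H_minus1 \<Omega>"
  show "H_minus1_norm \<Omega> (\<lambda>v. F v + G v) \<le> H_minus1_norm \<Omega> F + H_minus1_norm \<Omega> G"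
    unfolding H_minus1_norm_def[of _ "\<lambda>v. F v + G v"]
  proof (intro cSUP_least ne)
    fix v assume v: "v \<in> {v \<in> H1_0 \<Omega>. H1_norm \<Omega> v \<le> 1}"
    then have "\<bar>F v\<bar> \<le> H_minus1_norm \<Omega> F" "\<bar>G v\<bar> \<le> H_minus1_norm \<Omega> G" using *[OF F] *[OF G] by auto
    then show "\<bar>F v + G v\<bar> \<le> H_minus1_norm \<Omega> F + H_minus1_norm \<Omega> G" by linarith
  qed
qed

lemma L2_inner_H_minus1: "g \<in> L2 \<Omega> \<Longrightarrow> L2_inner \<Omega> g \<in> H_minus1 \<Omega>"
  unfolding H_minus1_def
proof (intro CollectI conjI ballI allI exI)
  fix v w c assume g: "g \<in> L2 \<Omega>" and v: "v \<in> H1_0 \<Omega>"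
  show "L2_inner \<Omega> g (\<lambda>x. c * v x) = c * L2_inner \<Omega> g v"
    using g v by (simp add: L2.scale_right H1_0_L2)
  have "\<bar>L2_inner \<Omega> g v\<bar> \<le> L2_norm \<Omega> g * L2_norm \<Omega> v" using g H1_0_L2[OF v] by (rule L2_cauchy_schwarz)
  also have "\<dots> \<le> L2_norm \<Omega> g * H1_norm \<Omega> v" using g by (intro mult_left_mono L2_norm_le_H1_norm L2n.nonneg)
  finally show "\<bar>L2_inner \<Omega> g v\<bar> \<le> L2_norm \<Omega> g * H1_norm \<Omega> v" .
  assume w: "w \<in> H1_0 \<Omega>"
  show "L2_inner \<Omega> g (\<lambda>x. v x + w x) = L2_inner \<Omega> g v + L2_inner \<Omega> g w"
    using g v w by (simp add: L2.add_right H1_0_L2)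
qed

end


subsection \<open>Bochner spaces\<close>

abbreviation time_measure :: "real \<Rightarrow> real measure" where
  "time_measure T \<equiv> lebesgue_on {0<..<T}"

lemma finite_time_measure: "finite_measure (time_measure T)"
  by (rule finite_measure_lebesgue_on) simp

lemma pair_sigma_finite_time: "pair_sigma_finite (time_measure T) (time_measure T)"
  using finite_time_measure[of T] by (simp add: pair_sigma_finite_def finite_measure.axioms(1) finite_measure_def)

lemma integrable_time_bounded:
  fixes f :: "real \<Rightarrow> real"
  assumes "f \<in> borel_measurable (time_measure T)" "\<And>t. t \<in> {0<..<T} \<Longrightarrow> \<bar>f t\<bar> \<le> B"
  shows "integrable (time_measure T) f"
  by (rule finite_measure.integrable_const_bound[OF finite_time_measure, where B=B]) (use assms in \<open>auto intro: AE_I2\<close>)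

lemma integrable_of_square:
  fixes f :: "real \<Rightarrow> real"
  assumes "f \<in> borel_measurable (time_measure T)" "integrable (time_measure T) (\<lambda>t. (f t)\<^sup>2)"
  shows "integrable (time_measure T) f"
proof (rule Bochner_Integration.integrable_bound[OF _ assms(1)])
  show "integrable (time_measure T) (\<lambda>t. 1 + (f t)\<^sup>2)"
    by (intro Bochner_Integration.integrable_add assms finite_measure.integrable_const finite_time_measure)
  show "AE t in time_measure T. norm (f t) \<le> norm (1 + (f t)\<^sup>2)"
  proof (intro AE_I2)
    fix t
    have "2 * \<bar>f t\<bar> \<le> 1 + (f t)\<^sup>2" using zero_le_power2[of "\<bar>f t\<bar> - 1"] by (simp add: power2_diff)
    then show "norm (f t) \<le> norm (1 + (f t)\<^sup>2)" by simp
  qed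
qed

text \<open>Completeness of Lebesgue measure; it carries measurability from a regular representative
  to the given path, which is known only almost everywhere.\<close>

lemma time_measurable_AE:
  fixes f g :: "real \<Rightarrow> real"
  assumes "f \<in> borel_measurable (time_measure T)" "AE t in time_measure T. f t = g t"
  shows "g \<in> borel_measurable (time_measure T)"
proof -
  have "(\<lambda>t. indicator {0<..<T} t *\<^sub>R f t) \<in> borel_measurable lebesgue"
    using assms(1) by (simp add: borel_measurable_restrict_space_iff)
  moreover have "AE t in lebesgue. indicator {0<..<T} t *\<^sub>R f t = indicator {0<..<T} t *\<^sub>R g t"
    using assms(2) by (simp add: AE_restrict_space_iff) (auto elim!: eventually_mono simp: indicator_def)
  ultimately have "(\<lambda>t. indicator {0<..<T} t *\<^sub>R g t) \<in> borel_measurable lebesgue"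
    by (rule borel_measurable_AE)
  then show ?thesis by (simp add: borel_measurable_restrict_space_iff)
qed

lemma time_integrable_AE:
  fixes f g :: "real \<Rightarrow> real"
  assumes "integrable (time_measure T) f" "AE t in time_measure T. f t = g t"
  shows "integrable (time_measure T) g"
  using integrable_cong_AE[THEN iffD1, OF _ _ assms(2) assms(1)]
    time_measurable_AE[OF _ assms(2)] borel_measurable_integrable[OF assms(1)] by blast

text \<open>\<open>F\<close> is arbitrary and need not be linear: a simple path takes finitely many
  values, so anything composed with it is a finite sum over level sets. This yields measurability of
  norms, functionals and pairings along simple paths.\<close>

lemma bochner_simple_expand:
  fixes s :: "real \<Rightarrow> 'b \<Rightarrow> real" and F :: "('b \<Rightarrow> real) \<Rightarrow> real"
  assumes "bochner_simple T X s" "t \<in> {0<..<T}"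
  shows "F (s t) = (\<Sum>w\<in>s ` {0<..<T}. indicator {t\<in>{0<..<T}. s t = w} t * F w)"
proof -
  have "(\<Sum>w\<in>s ` {0<..<T}. indicator {t\<in>{0<..<T}. s t = w} t * F w) = (\<Sum>w\<in>s ` {0<..<T}. if w = s t then F w else 0)"
    using assms(2) by (intro sum.cong) (auto simp: indicator_def)
  also have "\<dots> = F (s t)" using assms by (simp add: bochner_simple_def)
  finally show ?thesis ..
qed

lemma bochner_simple_levelset:
  assumes "bochner_simple T X s" shows "{t\<in>{0<..<T}. s t = w} \<in> sets (time_measure T)"
  using assms by (auto simp: bochner_simple_def sets_restrict_space_iff)

lemma bochner_simple_measurable:
  assumes "bochner_simple T X s"
  shows "(\<lambda>t. F (s t) :: real) \<in> borel_measurable (time_measure T)"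
proof -
  have "(\<lambda>t. \<Sum>w\<in>s ` {0<..<T}. indicator {t\<in>{0<..<T}. s t = w} t * F w) \<in> borel_measurable (time_measure T)"
    by (intro borel_measurable_sum borel_measurable_times borel_measurable_const borel_measurable_indicator
        bochner_simple_levelset[OF assms])
  then show ?thesis
    by (rule measurable_cong[THEN iffD1, rotated]) (simp add: bochner_simple_expand[OF assms])
qed

lemma bochner_simple_pair_measurable:
  assumes "bochner_simple T X s"
  shows "(\<lambda>(r, t). F (s r) (s t) :: real) \<in> borel_measurable (time_measure T \<Otimes>\<^sub>M time_measure T)"
proof -
  define I where "I w = {t\<in>{0<..<T}. s t = w}" for w
  have I [measurable]: "I w \<in> sets (time_measure T)" for w
    unfolding I_def by (rule bochner_simple_levelset[OF assms])
  have "(\<lambda>(r, t). \<Sum>w\<in>s ` {0<..<T}. indicator (I w) r * (\<Sum>w'\<in>s ` {0<..<T}. indicator (I w') t * F w w'))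
      \<in> borel_measurable (time_measure T \<Otimes>\<^sub>M time_measure T)"
    by measurable
  then show ?thesis
  proof (rule measurable_cong[THEN iffD1, rotated])
    fix p assume "p \<in> space (time_measure T \<Otimes>\<^sub>M time_measure T)"
    then obtain r t where p: "p = (r, t)" "r \<in> {0<..<T}" "t \<in> {0<..<T}" by (auto simp: space_pair_measure)
    show "(case p of (r, t) \<Rightarrow> \<Sum>w\<in>s ` {0<..<T}. indicator (I w) r * (\<Sum>w'\<in>s ` {0<..<T}. indicator (I w') t * F w w'))
        = (case p of (r, t) \<Rightarrow> F (s r) (s t))"
      using bochner_simple_expand[OF assms p(2), of "\<lambda>w. F w (s t)"] bochner_simple_expand[OF assms p(3), of "F _"]
      by (simp add: p I_def)
  qed
qed

lemma bochner_simple_integrable: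
  assumes "bochner_simple T X s"
  shows "integrable (time_measure T) (\<lambda>t. F (s t) :: real)"
proof -
  have "finite (F ` s ` {0<..<T})" using assms by (simp add: bochner_simple_def)
  then obtain B where "\<And>x. x \<in> F ` s ` {0<..<T} \<Longrightarrow> \<bar>x\<bar> \<le> B"
    using finite_imp_bounded bounded_iff by (metis real_norm_def)
  then show ?thesis
    by (intro integrable_time_bounded[where B=B] bochner_simple_measurable[OF assms]) auto
qed

text \<open>Linearity moves \<open>l\<close> through a finite sum; interchanges of functionals and
  time integrals for general paths are obtained from this case by limits.\<close>

lemma (in linear_functional) bochner_simple_integral:
  assumes "bochner_simple T X s"
  shows "(LINT t|time_measure T. l (s t)) = l (simple_integral T s)" and "simple_integral T s \<in> X"
proof -
  have fin: "finite (s ` {0<..<T})" "s ` {0<..<T} \<subseteq> X" using assms by (auto simp: bochner_simple_def)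
  show "simple_integral T s \<in> X"
    unfolding simple_integral_def using fin by (intro sum_mem) auto
  note ls = bochner_simple_levelset[OF assms]
  have "(LINT t|time_measure T. l (s t)) =
      (LINT t|time_measure T. (\<Sum>w\<in>s ` {0<..<T}. indicator {t\<in>{0<..<T}. s t = w} t * l w))"
    by (rule Bochner_Integration.integral_cong) (simp_all add: bochner_simple_expand[OF assms])
  also have "\<dots> = (\<Sum>w\<in>s ` {0<..<T}. measure lebesgue {t\<in>{0<..<T}. s t = w} * l w)"
  proof (subst Bochner_Integration.integral_sum)
    show "integrable (time_measure T) (\<lambda>t. indicator {t\<in>{0<..<T}. s t = w} t * l w)" for w
    proof (rule integrable_time_bounded[where B="\<bar>l w\<bar>"])
      show "(\<lambda>t. indicator {t\<in>{0<..<T}. s t = w} t * l w) \<in> borel_measurable (time_measure T)"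
        by (intro borel_measurable_times borel_measurable_indicator borel_measurable_const ls)
    qed (simp add: indicator_def)
    have *: "(LINT t|time_measure T. indicator {t\<in>{0<..<T}. s t = w} t * l w) = measure lebesgue {t\<in>{0<..<T}. s t = w} * l w" for w
    proof -
      have "measure (time_measure T) {t\<in>{0<..<T}. s t = w} = measure lebesgue {t\<in>{0<..<T}. s t = w}"
        by (rule measure_restrict_space) auto
      moreover have "{t\<in>{0<..<T}. s t = w} \<inter> space (time_measure T) = {t\<in>{0<..<T}. s t = w}" by auto
      ultimately show ?thesis by (simp del: Collect_conj_eq)
    qed
    show "(\<Sum>w\<in>s ` {0<..<T}. LINT t|time_measure T. indicator {t\<in>{0<..<T}. s t = w} t * l w) =
        (\<Sum>w\<in>s ` {0<..<T}. measure lebesgue {t\<in>{0<..<T}. s t = w} * l w)" by (simp only: *)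
  qed
  also have "\<dots> = l (simple_integral T s)"
    unfolding simple_integral_def using fin by (subst sum) auto
  finally show "(LINT t|time_measure T. l (s t)) = l (simple_integral T s)" .
qed

section \<open>Regular representatives and bounded functionals\<close>

context seminormed_space
begin

text \<open>Membership in \<open>bochner_L2\<close> supplies values and convergence almost
  everywhere only, without domination. Here values lie in \<open>X\<close> at every time, simple
  approximants converge at every time, and they are dominated by \<open>N (u t) + 1\<close>, so
  dominated convergence applies to functionals and to bilinear expressions.\<close>

definition regular :: "real \<Rightarrow> (real \<Rightarrow> 'b \<Rightarrow> real) \<Rightarrow> (nat \<Rightarrow> real \<Rightarrow> 'b \<Rightarrow> real) \<Rightarrow> bool" where
  "regular T u s \<longleftrightarrow> (\<forall>t. u t \<in> X) \<and> (\<forall>n t. s n t \<in> X) \<and> (\<forall>n. bochner_simple T X (s n)) \<and>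
     (\<forall>n t. N (s n t) \<le> N (u t) + 1) \<and> (\<forall>t. (\<lambda>n. N (\<lambda>b. s n t b - u t b)) \<longlonglongrightarrow> 0) \<and>
     (\<lambda>t. N (u t)) \<in> borel_measurable (time_measure T) \<and> integrable (time_measure T) (\<lambda>t. (N (u t))\<^sup>2)"

lemma regularD:
  assumes "regular T u s"
  shows "u t \<in> X" "s n t \<in> X" "bochner_simple T X (s n)" "N (s n t) \<le> N (u t) + 1"
    "(\<lambda>n. N (\<lambda>b. s n t b - u t b)) \<longlonglongrightarrow> 0" "integrable (time_measure T) (\<lambda>t. (N (u t))\<^sup>2)"
    "integrable (time_measure T) (\<lambda>t. N (u t))"
  using assms integrable_of_square[of "\<lambda>t. N (u t)" T] unfolding regular_def by blast+

text \<open>The energy identity is used at every intermediate time, hence the restriction to shorter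
  intervals.\<close>

lemma regular_mono:
  assumes "regular T u s" "t \<le> T" shows "regular t u s"
proof -
  have sub: "{0<..<t} \<subseteq> {0<..<T}" using assms(2) by auto
  have "bochner_simple t X (s n)" for n
    unfolding bochner_simple_def
  proof (intro conjI allI)
    have bs: "bochner_simple T X (s n)" using assms(1) by (simp add: regular_def)
    have im: "s n ` {0<..<t} \<subseteq> s n ` {0<..<T}" using sub by (rule image_mono)
    show "finite (s n ` {0<..<t})"
      by (rule finite_subset[OF im]) (use bs in \<open>simp add: bochner_simple_def\<close>)
    show "s n ` {0<..<t} \<subseteq> X"
      by (rule subset_trans[OF im]) (use bs in \<open>simp add: bochner_simple_def\<close>)
    fix w
    have "{r \<in> {0<..<t}. s n r = w} = {r \<in> {0<..<T}. s n r = w} \<inter> {0<..<t}" using sub by blast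
    then show "{r \<in> {0<..<t}. s n r = w} \<in> sets lebesgue"
      using bs unfolding bochner_simple_def by auto
  qed
  moreover have "integrable (time_measure t) (\<lambda>t. (N (u t))\<^sup>2)"
    using assms(1) unfolding regular_def by (intro integrable_lebesgue_on_mono[OF _ sub]) auto
  moreover have "(\<lambda>t. N (u t)) \<in> borel_measurable (time_measure t)"
    using assms(1) measurable_restrict_mono[OF _ sub] unfolding regular_def by blast
  ultimately show ?thesis using assms(1) unfolding regular_def by blast
qed

text \<open>The path is set to 0 off the measurable set \<open>G\<close> of good times, and each
  approximant is set to 0 where its norm exceeds \<open>N (v t) + 1\<close>. Norms converge on
  \<open>G\<close>, so at each good time this truncation stops after finitely many indices.\<close>

lemma bochner_L2_regular:
  assumes "u \<in> bochner_L2 T X N"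
  obtains v s where "regular T v s" "AE t in time_measure T. v t = u t"
proof -
  obtain s where s: "\<And>n::nat. bochner_simple T X (s n)"
    and lim: "AE t in time_measure T. (\<lambda>n. N (\<lambda>b. s n t b - u t b)) \<longlonglongrightarrow> 0"
    and uX: "AE t in time_measure T. u t \<in> X"
    and int: "integrable (time_measure T) (\<lambda>t. (N (u t))\<^sup>2)"
    using assms by (auto simp: bochner_L2_def)
  have "AE t in time_measure T. u t \<in> X \<and> (\<lambda>n. N (\<lambda>b. s n t b - u t b)) \<longlonglongrightarrow> 0"
    using uX lim by eventually_elim simp
  then obtain Z where Z: "{t \<in> space (time_measure T). \<not> (u t \<in> X \<and> (\<lambda>n. N (\<lambda>b. s n t b - u t b)) \<longlonglongrightarrow> 0)} \<subseteq> Z"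
    "Z \<in> sets (time_measure T)" "emeasure (time_measure T) Z = 0"
    by (rule AE_E)
  define G where "G = {0<..<T} - Z"
  have G: "G \<in> sets (time_measure T)" "G \<subseteq> {0<..<T}"
    using Z(2) sets.compl_sets[OF Z(2)] by (auto simp: G_def)
  have GP: "u t \<in> X" "(\<lambda>n. N (\<lambda>b. s n t b - u t b)) \<longlonglongrightarrow> 0" if "t \<in> G" for t
    using that Z(1) by (auto simp: G_def)
  have GAE: "AE t in time_measure T. t \<in> G"
    using Z by (intro AE_I[where N=Z]) (auto simp: G_def)
  have sX: "s n t \<in> X" if "t \<in> {0<..<T}" for n t
    using s[of n] that by (auto simp: bochner_simple_def)
  define v where "v t = (if t \<in> G then u t else (\<lambda>_. 0))" for t
  have vX: "v t \<in> X" for t using GP zero_mem by (simp add: v_def)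
  have conv_norm: "(\<lambda>n. N (s n t)) \<longlonglongrightarrow> N (v t)" if "t \<in> G" for t
  proof (rule LIM_zero_cancel, rule tendsto_0_le[OF GP(2)[OF that], where K=1], rule always_eventually, rule allI)
    fix n
    show "norm (N (s n t) - N (v t)) \<le> norm (N (\<lambda>b. s n t b - u t b)) * 1"
      using norm_triangle_diff[OF sX GP(1), of t t n] that G by (auto simp: v_def)
  qed
  have Nv: "(\<lambda>t. N (v t)) \<in> borel_measurable (time_measure T)"
  proof (rule borel_measurable_LIMSEQ_real[where u="\<lambda>n t. indicator G t * N (s n t)"])
    show "(\<lambda>n. indicator G t * N (s n t)) \<longlonglongrightarrow> N (v t)" for t
      using conv_norm[of t] by (cases "t \<in> G") (auto simp: v_def norm_zero)
    show "(\<lambda>t. indicator G t * N (s n t)) \<in> borel_measurable (time_measure T)" for n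
      using G by (intro borel_measurable_times borel_measurable_indicator bochner_simple_measurable[OF s])
  qed
  define C where "C n = {t \<in> space (time_measure T). N (s n t) \<le> N (v t) + 1} \<inter> G" for n
  have C: "C n \<in> sets (time_measure T)" for n
    unfolding C_def using bochner_simple_measurable[OF s, of N] Nv G by (intro sets.Int borel_measurable_le) auto
  define s' where "s' n t = (if t \<in> C n then s n t else (\<lambda>_. 0))" for n t
  have Csub: "C n \<subseteq> {0<..<T}" for n using G by (auto simp: C_def)
  have bs: "bochner_simple T X (s' n)" for n
    unfolding bochner_simple_def
  proof (intro conjI allI)
    have im: "s' n ` {0<..<T} \<subseteq> insert (\<lambda>_. 0) (s n ` {0<..<T})" by (auto simp: s'_def)
    show "finite (s' n ` {0<..<T})"
      by (rule finite_subset[OF im]) (use s[of n] in \<open>simp add: bochner_simple_def\<close>)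
    show "s' n ` {0<..<T} \<subseteq> X"
      by (rule subset_trans[OF im]) (use s[of n] zero_mem in \<open>simp add: bochner_simple_def\<close>)
    fix w
    \<comment> \<open>Truncation enlarges only the level set of the zero function, by the times
      outside \<open>C n\<close>; the other values keep theirs intersected with
      \<open>C n\<close>.\<close>
    have eq: "{t \<in> {0<..<T}. s' n t = w} = ({t \<in> {0<..<T}. s n t = w} \<inter> C n) \<union> (if w = (\<lambda>_. 0) then {0<..<T} - C n else {})"
      using Csub by (auto simp: s'_def)
    have sets: "C n \<in> sets lebesgue" "{t \<in> {0<..<T}. s n t = w} \<in> sets lebesgue"
      using C[of n] s[of n] by (simp_all add: sets_restrict_space_iff bochner_simple_def)
    then have "{0<..<T} - C n \<in> sets lebesgue" by (intro sets.Diff) simp_all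
    with sets show "{t \<in> {0<..<T}. s' n t = w} \<in> sets lebesgue"
      unfolding eq by (intro sets.Un sets.Int) (simp_all only: sets.empty_sets simp_thms split: if_split)
  qed
  have "regular T v s'"
    unfolding regular_def
  proof (intro conjI allI)
    show "s' n t \<in> X" for n t using sX subsetD[OF Csub] zero_mem by (simp add: s'_def)
    show "N (s' n t) \<le> N (v t) + 1" for n t
      using nonneg[OF vX, of t] norm_zero by (auto simp: s'_def C_def)
    show "(\<lambda>n. N (\<lambda>b. s' n t b - v t b)) \<longlonglongrightarrow> 0" for t
    proof (cases "t \<in> G")
      case True
      have "\<forall>\<^sub>F n in sequentially. N (s n t) < N (v t) + 1"
        by (rule order_tendstoD(2)[OF conv_norm[OF True]]) simp
      then have "\<forall>\<^sub>F n in sequentially. N (\<lambda>b. s n t b - u t b) = N (\<lambda>b. s' n t b - v t b)"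
        by eventually_elim (use True G in \<open>auto simp: s'_def C_def v_def\<close>)
      then show ?thesis by (rule Lim_transform_eventually[OF GP(2)[OF True]])
    next
      case False
      then show ?thesis by (simp add: v_def s'_def C_def norm_zero)
    qed
    have eq: "AE t in time_measure T. (N (u t))\<^sup>2 = (N (v t))\<^sup>2"
      using GAE by eventually_elim (simp add: v_def)
    show "integrable (time_measure T) (\<lambda>t. (N (v t))\<^sup>2)"
      by (rule time_integrable_AE[OF int eq])
  qed (use vX bs Nv in auto)
  moreover have "AE t in time_measure T. v t = u t"
    using GAE by eventually_elim (simp add: v_def)
  ultimately show ?thesis using that by blast
qed

end

locale bounded_functional = linear_functional X l + seminormed_space X N
  for X :: "('b \<Rightarrow> real) set" and l N +
  fixes C :: real
  assumes bound: "f \<in> X \<Longrightarrow> \<bar>l f\<bar> \<le> C * N f"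
begin

lemma eq_of_norm_diff_zero: "f \<in> X \<Longrightarrow> g \<in> X \<Longrightarrow> N (\<lambda>b. f b - g b) = 0 \<Longrightarrow> l f = l g"
  using bound[OF diff_mem, of f g] by (simp add: diff)

lemma tendsto_of_norm_diff:
  assumes "\<And>n. f n \<in> X" "g \<in> X" "((\<lambda>n. N (\<lambda>b. f n b - g b)) \<longlongrightarrow> 0) F"
  shows "((\<lambda>n. l (f n)) \<longlongrightarrow> l g) F"
proof (rule LIM_zero_cancel, rule tendsto_0_le[OF assms(3), where K="\<bar>C\<bar>"], rule always_eventually, rule allI)
  fix n
  have "\<bar>l (\<lambda>b. f n b - g b)\<bar> \<le> C * N (\<lambda>b. f n b - g b)" using assms by (intro bound diff_mem)
  also have "\<dots> \<le> \<bar>C\<bar> * \<bar>N (\<lambda>b. f n b - g b)\<bar>" by (metis abs_ge_self abs_mult)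
  finally show "norm (l (f n) - l g) \<le> norm (N (\<lambda>b. f n b - g b)) * \<bar>C\<bar>"
    using assms by (simp add: diff mult.commute)
qed

lemma regular_measurable:
  assumes "regular T u s" shows "(\<lambda>t. l (u t)) \<in> borel_measurable (time_measure T)"
proof (rule borel_measurable_LIMSEQ_real)
  show "(\<lambda>n. l (s n t)) \<longlonglongrightarrow> l (u t)" for t
    by (rule tendsto_of_norm_diff[OF regularD(2,1,5)[OF assms]])
  show "(\<lambda>t. l (s n t)) \<in> borel_measurable (time_measure T)" for n
    by (rule bochner_simple_measurable[OF regularD(3)[OF assms]])
qed

lemma regular_integrable:
  assumes "regular T u s"
  shows "integrable (time_measure T) (\<lambda>t. l (u t))"
proof (rule Bochner_Integration.integrable_bound)
  show "integrable (time_measure T) (\<lambda>t. C * N (u t))" using regularD[OF assms] by auto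
  show "AE t in time_measure T. norm (l (u t)) \<le> norm (C * N (u t))"
    using bound[OF regularD(1)[OF assms]] by (intro AE_I2) (auto intro: order_trans[OF _ abs_ge_self])
qed (rule regular_measurable[OF assms])

lemma regular_integral_tendsto:
  assumes "regular T u s"
  shows "(\<lambda>n. l (simple_integral T (s n))) \<longlonglongrightarrow> (LINT t|time_measure T. l (u t))"
proof -
  note D = regularD[OF assms]
  have "(\<lambda>n. LINT t|time_measure T. l (s n t)) \<longlonglongrightarrow> (LINT t|time_measure T. l (u t))"
  proof (rule integral_dominated_convergence[where w="\<lambda>t. \<bar>C\<bar> * (N (u t) + 1)"])
    show "integrable (time_measure T) (\<lambda>t. \<bar>C\<bar> * (N (u t) + 1))"
      by (intro integrable_mult_right Bochner_Integration.integrable_add D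
          finite_measure.integrable_const finite_time_measure)
    show "AE t in time_measure T. (\<lambda>n. l (s n t)) \<longlonglongrightarrow> l (u t)"
      by (intro AE_I2 tendsto_of_norm_diff D)
    show "AE t in time_measure T. norm (l (s n t)) \<le> \<bar>C\<bar> * (N (u t) + 1)" for n
    proof (intro AE_I2)
      fix t
      have "\<bar>l (s n t)\<bar> \<le> \<bar>C\<bar> * N (s n t)"
        using bound[OF D(2)] mult_right_mono[OF abs_ge_self nonneg[OF D(2)]] order_trans by blast
      also have "\<dots> \<le> \<bar>C\<bar> * (N (u t) + 1)" by (intro mult_left_mono D) auto
      finally show "norm (l (s n t)) \<le> \<bar>C\<bar> * (N (u t) + 1)" by simp
    qed
  qed (intro regular_measurable[OF assms] bochner_simple_measurable[OF D(3)])+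
  then show ?thesis by (simp add: bochner_simple_integral[OF D(3)])
qed

text \<open>Boundedness of \<open>l\<close> turns both convergences in
  \<open>has_bochner_integral_in\<close>, of the averaged distances and of the simple integrals,
  into limits of one scalar sequence; these limits coincide.\<close>

lemma bochner_integral:
  assumes "has_bochner_integral_in T X N f I" and int: "integrable (time_measure T) (\<lambda>t. l (f t))"
  shows "(LINT t|time_measure T. l (f t)) = l I"
proof -
  obtain s where fX: "AE t in time_measure T. f t \<in> X" and I: "I \<in> X"
    and s: "\<And>n::nat. bochner_simple T X (s n)" "\<And>n. integrable (time_measure T) (\<lambda>t. N (\<lambda>b. s n t b - f t b))"
    and lim: "(\<lambda>n. LINT t|time_measure T. N (\<lambda>b. s n t b - f t b)) \<longlonglongrightarrow> 0"
      "(\<lambda>n. N (\<lambda>b. simple_integral T (s n) b - I b)) \<longlonglongrightarrow> 0"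
    using assms(1) unfolding has_bochner_integral_in_def by blast
  have "(\<lambda>n. l (simple_integral T (s n))) \<longlonglongrightarrow> l I"
    by (intro tendsto_of_norm_diff I lim bochner_simple_integral(2)[OF s(1)])
  then have A: "(\<lambda>n. LINT t|time_measure T. l (s n t)) \<longlonglongrightarrow> l I"
    by (simp add: bochner_simple_integral[OF s(1)])
  have "(\<lambda>n. (LINT t|time_measure T. l (s n t)) - (LINT t|time_measure T. l (f t))) \<longlonglongrightarrow> 0"
  proof (rule tendsto_0_le[OF lim(1), where K="\<bar>C\<bar>"], rule always_eventually, rule allI)
    fix n
    have si: "integrable (time_measure T) (\<lambda>t. l (s n t))" by (rule bochner_simple_integrable[OF s(1)])
    have "\<bar>(LINT t|time_measure T. l (s n t)) - (LINT t|time_measure T. l (f t))\<bar> =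
        \<bar>LINT t|time_measure T. l (s n t) - l (f t)\<bar>" using si int by simp
    also have "\<dots> \<le> (LINT t|time_measure T. \<bar>l (s n t) - l (f t)\<bar>)" by (rule integral_abs_bound)
    also have "\<dots> \<le> (LINT t|time_measure T. \<bar>C\<bar> * N (\<lambda>b. s n t b - f t b))"
    proof (rule integral_mono_AE)
      show "AE t in time_measure T. \<bar>l (s n t) - l (f t)\<bar> \<le> \<bar>C\<bar> * N (\<lambda>b. s n t b - f t b)"
        using fX AE_space
      proof eventually_elim
        case (elim t)
        have sX: "s n t \<in> X" using s(1)[of n] elim by (auto simp: bochner_simple_def)
        have "\<bar>l (\<lambda>b. s n t b - f t b)\<bar> \<le> \<bar>C\<bar> * N (\<lambda>b. s n t b - f t b)"
          using bound[OF diff_mem[OF sX elim(1)]] mult_right_mono[OF abs_ge_self nonneg[OF diff_mem[OF sX elim(1)]], of C]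
          by linarith
        then show ?case using sX elim by (simp add: diff)
      qed
    qed (use si int s(2) in auto)
    also have "\<dots> \<le> \<bar>LINT t|time_measure T. N (\<lambda>b. s n t b - f t b)\<bar> * \<bar>C\<bar>"
      by (simp add: mult.commute mult_left_mono)
    finally show "norm ((LINT t|time_measure T. l (s n t)) - (LINT t|time_measure T. l (f t)))
        \<le> norm (LINT t|time_measure T. N (\<lambda>b. s n t b - f t b)) * \<bar>C\<bar>" by simp
  qed
  then have "(\<lambda>n. LINT t|time_measure T. l (s n t)) \<longlonglongrightarrow> (LINT t|time_measure T. l (f t))"
    by (rule LIM_zero_cancel)
  then show ?thesis using A LIMSEQ_unique by blast
qed

text \<open>Applying \<open>l\<close> to the vector-valued weak derivative shows that the scalar
  function \<open>l (w t)\<close> has weak derivative \<open>l (u' t)\<close>. Since it is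
  continuous up to the end points, the scalar fundamental theorem integrates it from time 0.\<close>

lemma time_evolution:
  assumes deriv: "has_time_deriv T X N u u'"
    and uX: "AE t in time_measure T. u t \<in> X" and u'X: "AE t in time_measure T. u' t \<in> X"
    and int': "integrable (time_measure T) (\<lambda>t. l (u' t))"
    and wX: "\<And>t. t \<in> {0..T} \<Longrightarrow> w t \<in> X"
    and cont: "\<And>t. t \<in> {0..T} \<Longrightarrow> ((\<lambda>s. N (\<lambda>b. w s b - w t b)) \<longlongrightarrow> 0) (at t within {0..T})"
    and wu: "AE t in time_measure T. N (\<lambda>b. w t b - u t b) = 0"
    and t: "t \<in> {0..T}"
  shows "continuous_on {0..T} (\<lambda>t. l (w t))" "l (w t) = l (w 0) + (LINT s|time_measure t. l (u' s))"
proof -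
  show m: "continuous_on {0..T} (\<lambda>t. l (w t))"
    unfolding continuous_on_def
  proof
    fix t assume t: "t \<in> {0..T}"
    have "((\<lambda>s. l (w s) - l (w t)) \<longlongrightarrow> 0) (at t within {0..T})"
    proof (rule tendsto_0_le[OF cont[OF t], where K="\<bar>C\<bar>"])
      show "\<forall>\<^sub>F s in at t within {0..T}. norm (l (w s) - l (w t)) \<le> norm (N (\<lambda>b. w s b - w t b)) * \<bar>C\<bar>"
        unfolding eventually_at_filter
      proof (rule always_eventually, intro allI impI)
        fix s assume "s \<noteq> t" "s \<in> {0..T}"
        then have X: "w s \<in> X" "w t \<in> X" using wX t by auto
        have "\<bar>l (\<lambda>b. w s b - w t b)\<bar> \<le> C * N (\<lambda>b. w s b - w t b)" by (intro bound diff_mem X)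
        also have "\<dots> \<le> \<bar>C\<bar> * \<bar>N (\<lambda>b. w s b - w t b)\<bar>" by (metis abs_ge_self abs_mult)
        finally show "norm (l (w s) - l (w t)) \<le> norm (N (\<lambda>b. w s b - w t b)) * \<bar>C\<bar>"
          using X by (simp add: diff mult.commute)
      qed
    qed
    then show "((\<lambda>t. l (w t)) \<longlongrightarrow> l (w t)) (at t within {0..T})" by (rule LIM_zero_cancel)
  qed
  have eq: "AE t in time_measure T. l (w t) = l (u t)"
    using wu uX AE_space
  proof eventually_elim
    case (elim t)
    then show ?case using eq_of_norm_diff_zero[of "w t" "u t"] wX by auto
  qed
  show "l (w t) = l (w 0) + (LINT s|time_measure t. l (u' s))"
  proof (rule weak_derivative_fundamental_theorem[OF m int'])
    fix \<phi> assume \<phi>: "\<phi> \<in> test_functions {0<..<T}"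
    note sm = test_functions_smooth[OF \<phi>]
    have dc: "continuous_on {0..T} (deriv \<phi>)" by (intro smooth_continuous_on smooth_deriv(2) sm)
    obtain I where I: "has_bochner_integral_in T X N (\<lambda>t b. deriv \<phi> t * u t b) I"
      "has_bochner_integral_in T X N (\<lambda>t b. - \<phi> t * u' t b) I"
      using deriv \<phi> unfolding has_time_deriv_def by blast
    have m1: "integrable (time_measure T) (\<lambda>t. deriv \<phi> t * l (w t))"
      by (intro continuous_integrable_Ioo continuous_on_mult dc m)
    have e1: "AE t in time_measure T. deriv \<phi> t * l (w t) = l (\<lambda>b. deriv \<phi> t * u t b)"
      using eq uX by eventually_elim (simp add: scale)
    have i1: "integrable (time_measure T) (\<lambda>t. l (\<lambda>b. deriv \<phi> t * u t b))"
      by (rule time_integrable_AE[OF m1 e1])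
    have m2: "integrable (time_measure T) (\<lambda>t. - \<phi> t * l (u' t))"
    proof -
      obtain B where "\<forall>x\<in>\<phi> ` {0..T}. norm x \<le> B"
        using compact_imp_bounded[OF compact_continuous_image[OF smooth_continuous_on[OF sm] compact_Icc], of 0 T]
        unfolding bounded_iff by blast
      then have B: "\<And>t. t \<in> {0..T} \<Longrightarrow> \<bar>\<phi> t\<bar> \<le> B" by simp
      show ?thesis
      proof (rule Bochner_Integration.integrable_bound)
        show "integrable (time_measure T) (\<lambda>t. B * \<bar>l (u' t)\<bar>)" using int' by auto
        show "AE t in time_measure T. norm (- \<phi> t * l (u' t)) \<le> norm (B * \<bar>l (u' t)\<bar>)"
        proof (intro AE_I2)
          fix t assume "t \<in> space (time_measure T)"
          then have "\<bar>\<phi> t\<bar> \<le> \<bar>B\<bar>" using B[of t] by auto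
          then show "norm (- \<phi> t * l (u' t)) \<le> norm (B * \<bar>l (u' t)\<bar>)"
            by (simp add: abs_mult mult_right_mono)
        qed
        show "(\<lambda>t. - \<phi> t * l (u' t)) \<in> borel_measurable (time_measure T)"
          by (rule borel_measurable_times[OF borel_measurable_uminus[OF measurable_restrict_space1[OF
                smooth_borel_measurable[OF sm]]] borel_measurable_integrable[OF int']])
      qed
    qed
    have e2: "AE t in time_measure T. - \<phi> t * l (u' t) = l (\<lambda>b. - \<phi> t * u' t b)"
      using u'X by eventually_elim (simp only: scale)
    have i2: "integrable (time_measure T) (\<lambda>t. l (\<lambda>b. - \<phi> t * u' t b))"
      by (rule time_integrable_AE[OF m2 e2])
    have "(LINT t|time_measure T. deriv \<phi> t * l (w t)) = (LINT t|time_measure T. l (\<lambda>b. deriv \<phi> t * u t b))"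
      by (intro integral_cong_AE borel_measurable_integrable m1 i1 e1)
    also have "\<dots> = l I" by (rule bochner_integral[OF I(1) i1])
    also have "\<dots> = (LINT t|time_measure T. l (\<lambda>b. - \<phi> t * u' t b))" by (rule bochner_integral[OF I(2) i2, symmetric])
    also have "\<dots> = (LINT t|time_measure T. - \<phi> t * l (u' t))"
      by (intro integral_cong_AE[symmetric] borel_measurable_integrable m2 i2 e2)
    finally show "(LINT t|time_measure T. deriv \<phi> t * l (w t)) = - (LINT t|time_measure T. \<phi> t * l (u' t))"
      by simp
  qed (use t in auto)
qed

end


subsection \<open>Bounded symmetric forms along a path\<close>

lemma integrable_product_function:
  fixes f g :: "_ \<Rightarrow> real"
  assumes "pair_sigma_finite M1 M2" "integrable M1 f" "integrable M2 g"
  shows "integrable (M1 \<Otimes>\<^sub>M M2) (\<lambda>(x, y). f x * g y)"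
proof -
  interpret pair_sigma_finite M1 M2 by fact
  show ?thesis
  proof (rule Fubini_integrable)
    have "(\<lambda>p. f (fst p) * g (snd p)) \<in> borel_measurable (M1 \<Otimes>\<^sub>M M2)"
      using assms by (intro borel_measurable_times measurable_compose[OF measurable_fst] measurable_compose[OF measurable_snd]) auto
    then show "(\<lambda>(x, y). f x * g y) \<in> borel_measurable (M1 \<Otimes>\<^sub>M M2)" by (simp add: case_prod_unfold)
    show "integrable M1 (\<lambda>x. LINT y|M2. norm (case (x, y) of (x, y) \<Rightarrow> f x * g y))"
      using assms by (simp add: abs_mult)
  qed (use assms in auto)
qed

locale bounded_form = semi_inner_product X ip + seminormed_space X N
  for X :: "('b \<Rightarrow> real) set" and ip N +
  fixes C :: real
  assumes form_bound: "f \<in> X \<Longrightarrow> ip f f \<le> C * (N f)\<^sup>2" and C_nonneg: "0 \<le> C"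
begin

text \<open>A bound on the diagonal extends to all pairs by Cauchy-Schwarz.\<close>

lemma ip_bound:
  assumes "f \<in> X" "g \<in> X"
  shows "\<bar>ip f g\<bar> \<le> C * N f * N g"
proof -
  have "(ip f g)\<^sup>2 \<le> ip f f * ip g g" by (rule cauchy_schwarz_sq[OF assms])
  also have "\<dots> \<le> (C * (N f)\<^sup>2) * (C * (N g)\<^sup>2)"
    by (rule mult_mono) (use assms form_bound pos C_nonneg in auto)
  also have "\<dots> = (C * N f * N g)\<^sup>2" by (simp add: power2_eq_square algebra_simps)
  finally have "\<bar>ip f g\<bar> \<le> \<bar>C * N f * N g\<bar>" by (simp add: abs_le_square_iff)
  then show ?thesis using C_nonneg nonneg assms by simp
qed

lemma bounded_left: "g \<in> X \<Longrightarrow> bounded_functional X (\<lambda>f. ip f g) N (C * N g)"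
  using ip_bound by (intro bounded_functional.intro bounded_functional_axioms.intro left_functional)
    (auto simp: seminormed_space_axioms mult.commute mult.left_commute)

lemma form_tendsto:
  assumes fX: "\<And>n. f n \<in> X" "a \<in> X" "\<And>n. g n \<in> X" "b \<in> X"
    and B: "\<And>n. N (g n) \<le> B"
    and lim: "(\<lambda>n. N (\<lambda>x. f n x - a x)) \<longlonglongrightarrow> 0" "(\<lambda>n. N (\<lambda>x. g n x - b x)) \<longlonglongrightarrow> 0"
  shows "(\<lambda>n. ip (f n) (g n)) \<longlonglongrightarrow> ip a b"
proof (rule LIM_zero_cancel, rule Lim_null_comparison)
  show "\<forall>\<^sub>F n in sequentially. norm (ip (f n) (g n) - ip a b) \<le>
      C * N (\<lambda>x. f n x - a x) * B + C * N a * N (\<lambda>x. g n x - b x)"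
  proof (intro always_eventually allI)
    fix n
    have "ip (f n) (g n) - ip a b = ip (\<lambda>x. f n x - a x) (g n) + ip a (\<lambda>x. g n x - b x)"
      using fX by (simp add: diff_left diff_right)
    also have "\<bar>\<dots>\<bar> \<le> C * N (\<lambda>x. f n x - a x) * N (g n) + C * N a * N (\<lambda>x. g n x - b x)"
      using fX by (intro order_trans[OF abs_triangle_ineq] add_mono ip_bound diff_mem) auto
    also have "C * N (\<lambda>x. f n x - a x) * N (g n) \<le> C * N (\<lambda>x. f n x - a x) * B"
      using fX by (intro mult_left_mono B mult_nonneg_nonneg C_nonneg nonneg diff_mem) auto
    finally show "norm (ip (f n) (g n) - ip a b) \<le> C * N (\<lambda>x. f n x - a x) * B + C * N a * N (\<lambda>x. g n x - b x)"
      by simp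
  qed
  have "(\<lambda>n. C * N (\<lambda>x. f n x - a x) * B + C * N a * N (\<lambda>x. g n x - b x)) \<longlonglongrightarrow> C * 0 * B + C * N a * 0"
    by (intro tendsto_intros lim)
  then show "(\<lambda>n. C * N (\<lambda>x. f n x - a x) * B + C * N a * N (\<lambda>x. g n x - b x)) \<longlonglongrightarrow> 0" by simp
qed

section \<open>Double time integrals of a symmetric form\<close>

context
  fixes T u s
  assumes reg: "regular T u s"
begin

lemmas regD = regularD[OF reg]

interpretation P: pair_sigma_finite "time_measure T" "time_measure T"
  by (rule pair_sigma_finite_time)

lemma kernel_tendsto: "(\<lambda>n. ip (s n r) (s n t)) \<longlonglongrightarrow> ip (u r) (u t)"
  by (rule form_tendsto[where B="N (u t) + 1"]) (intro regD)+

text \<open>The domination built into \<open>regular\<close> bounds all approximating kernels by one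
  product of a function of \<open>r\<close> and a function of \<open>t\<close>, which is integrable
  over the square.\<close>

lemma kernel_dominated: "\<bar>ip (s n r) (s n t)\<bar> \<le> C * ((N (u r) + 1) * (N (u t) + 1))"
proof -
  have "\<bar>ip (s n r) (s n t)\<bar> \<le> C * (N (s n r) * N (s n t))"
    using ip_bound[OF regD(2) regD(2)] by (simp add: mult.assoc)
  also have "\<dots> \<le> C * ((N (u r) + 1) * (N (u t) + 1))"
    by (intro mult_left_mono mult_mono regD C_nonneg) (use nonneg[OF regD(1)] nonneg[OF regD(2)] in \<open>auto simp: add_nonneg_nonneg\<close>)
  finally show ?thesis .
qed

lemma kernel_measurable:
  "(\<lambda>(r, t). ip (u r) (u t)) \<in> borel_measurable (time_measure T \<Otimes>\<^sub>M time_measure T)"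
proof (rule borel_measurable_LIMSEQ_real)
  show "(\<lambda>n. case p of (r, t) \<Rightarrow> ip (s n r) (s n t)) \<longlonglongrightarrow> (case p of (r, t) \<Rightarrow> ip (u r) (u t))" for p
    using kernel_tendsto by (cases p) simp
  show "(\<lambda>(r, t). ip (s n r) (s n t)) \<in> borel_measurable (time_measure T \<Otimes>\<^sub>M time_measure T)" for n
    by (rule bochner_simple_pair_measurable[OF regD(3)])
qed

lemma dominating_integrable:
  "integrable (time_measure T \<Otimes>\<^sub>M time_measure T) (\<lambda>(r, t). C * ((N (u r) + 1) * (N (u t) + 1)))"
proof -
  have "integrable (time_measure T) (\<lambda>t. N (u t) + 1)"
    by (intro Bochner_Integration.integrable_add regD finite_measure.integrable_const finite_time_measure)
  from integrable_product_function[OF pair_sigma_finite_time integrable_mult_right[OF this, of C] this]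
  show ?thesis by (simp add: mult.assoc)
qed

lemma kernel_integrable:
  "integrable (time_measure T \<Otimes>\<^sub>M time_measure T) (\<lambda>(r, t). ip (u r) (u t))"
proof (rule Bochner_Integration.integrable_bound[OF dominating_integrable kernel_measurable], intro AE_I2)
  fix p
  show "norm (case p of (r, t) \<Rightarrow> ip (u r) (u t)) \<le> norm (case p of (r, t) \<Rightarrow> C * ((N (u r) + 1) * (N (u t) + 1)))"
  proof (cases p)
    case (Pair r t)
    have "\<bar>ip (u r) (u t)\<bar> \<le> C * ((N (u r) + 1) * (N (u t) + 1))"
      by (rule LIMSEQ_le_const2[OF tendsto_rabs[OF kernel_tendsto]]) (use kernel_dominated in blast)
    then show ?thesis by (simp add: Pair)
  qed
qed

text \<open>This is the value of the form on the time integral of \<open>u\<close>, written as a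
  double integral of scalars so that no integral of \<open>u\<close> in \<open>X\<close> has to be
  formed.\<close>

definition energy :: real where
  "energy = (LINT t|time_measure T. LINT r|time_measure T. ip (u r) (u t))"

lemma simple_integral_mem: "simple_integral T (s n) \<in> X"
  by (rule linear_functional.bochner_simple_integral(2)[OF left_functional[OF zero_mem] regD(3)])

text \<open>For simple paths, linearity in each variable turns the double integral into the form on
  the simple integral; dominated convergence over the square treats the general path. Properties of
  quadratic forms thereby pass to \<open>energy\<close>.\<close>

lemma energy_tendsto: "(\<lambda>n. ip (simple_integral T (s n)) (simple_integral T (s n))) \<longlonglongrightarrow> energy"
proof -
  let ?M = "time_measure T \<Otimes>\<^sub>M time_measure T"
  have "(\<lambda>n. integral\<^sup>L ?M (\<lambda>(r, t). ip (s n r) (s n t))) \<longlonglongrightarrow> integral\<^sup>L ?M (\<lambda>(r, t). ip (u r) (u t))"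
  proof (rule integral_dominated_convergence[OF kernel_measurable _ dominating_integrable])
    show "AE p in ?M. (\<lambda>n. case p of (r, t) \<Rightarrow> ip (s n r) (s n t)) \<longlonglongrightarrow> (case p of (r, t) \<Rightarrow> ip (u r) (u t))"
      using kernel_tendsto by (intro AE_I2) (simp add: case_prod_unfold)
    show "AE p in ?M. norm (case p of (r, t) \<Rightarrow> ip (s n r) (s n t)) \<le> (case p of (r, t) \<Rightarrow> C * ((N (u r) + 1) * (N (u t) + 1)))" for n
      using kernel_dominated by (intro AE_I2) (simp add: case_prod_unfold)
  qed (rule bochner_simple_pair_measurable[OF regD(3)])
  moreover have "integral\<^sup>L ?M (\<lambda>(r, t). ip (u r) (u t)) = energy"
    unfolding energy_def by (rule P.integral_snd[symmetric, OF kernel_integrable])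
  moreover have "integral\<^sup>L ?M (\<lambda>(r, t). ip (s n r) (s n t)) = ip (simple_integral T (s n)) (simple_integral T (s n))" for n
  proof -
    have si: "integrable ?M (\<lambda>(r, t). ip (s n r) (s n t))"
    proof (rule Bochner_Integration.integrable_bound[OF dominating_integrable bochner_simple_pair_measurable[OF regD(3)]], intro AE_I2)
      show "norm (case p of (r, t) \<Rightarrow> ip (s n r) (s n t)) \<le> norm (case p of (r, t) \<Rightarrow> C * ((N (u r) + 1) * (N (u t) + 1)))" for p
        using kernel_dominated[of n "fst p" "snd p"] by (simp add: case_prod_unfold)
    qed
    have "integral\<^sup>L ?M (\<lambda>(r, t). ip (s n r) (s n t)) = (LINT t|time_measure T. LINT r|time_measure T. ip (s n r) (s n t))"
      by (rule P.integral_snd[symmetric, OF si])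
    also have "\<dots> = (LINT t|time_measure T. ip (simple_integral T (s n)) (s n t))"
      using linear_functional.bochner_simple_integral(1)[OF left_functional[OF regD(2)] regD(3)] by simp
    also have "\<dots> = ip (simple_integral T (s n)) (simple_integral T (s n))"
      by (rule linear_functional.bochner_simple_integral(1)[OF right_functional[OF simple_integral_mem] regD(3)])
    finally show ?thesis .
  qed
  ultimately show ?thesis by simp
qed

lemma energy_nonneg: "0 \<le> energy"
  by (rule LIMSEQ_le_const[OF energy_tendsto]) (use pos simple_integral_mem in blast)

text \<open>The inequality \<open>B(\<integral> u, z)\<^sup>2 \<le> B(z, z) B(\<integral> u,
  \<integral> u)\<close>, proved for simple integrals and passed to the limit. It lets a small
  \<open>B(z, z)\<close> annihilate the form term in the equation.\<close>

lemma energy_cauchy_schwarz: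
  assumes z: "z \<in> X"
  shows "(LINT t|time_measure T. ip (u t) z)\<^sup>2 \<le> ip z z * energy"
proof (rule LIMSEQ_le)
  interpret z: bounded_functional X "\<lambda>f. ip f z" N "C * N z" by (rule bounded_left[OF z])
  show "(\<lambda>n. (ip (simple_integral T (s n)) z)\<^sup>2) \<longlonglongrightarrow> (LINT t|time_measure T. ip (u t) z)\<^sup>2"
    by (intro tendsto_power z.regular_integral_tendsto[OF reg])
  show "(\<lambda>n. ip z z * ip (simple_integral T (s n)) (simple_integral T (s n))) \<longlonglongrightarrow> ip z z * energy"
    by (intro tendsto_mult_left energy_tendsto)
  show "\<exists>N. \<forall>n\<ge>N. (ip (simple_integral T (s n)) z)\<^sup>2 \<le> ip z z * ip (simple_integral T (s n)) (simple_integral T (s n))"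
    using cauchy_schwarz_sq[OF simple_integral_mem z] by (auto simp: mult.commute)
qed

lemma energy_integrable: "integrable (time_measure T) (\<lambda>t. LINT r|time_measure T. ip (u r) (u t))"
  by (rule P.integrable_snd[OF kernel_integrable])

text \<open>The kernel is symmetric, so the triangles \<open>r < t\<close> and \<open>t < r\<close>
  contribute equally, and together they fill the square up to the diagonal. This replaces
  differentiating a quadratic form of the integrated path in time.\<close>

lemma energy_half:
  shows "(LINT t|time_measure T. LINT r|time_measure t. ip (u r) (u t)) = energy / 2"
    and "integrable (time_measure T) (\<lambda>t. LINT r|time_measure t. ip (u r) (u t))"
proof -
  let ?M = "time_measure T \<Otimes>\<^sub>M time_measure T"
  define L where "L r t = (if r < t then ip (u r) (u t) else 0)" for r t
  have inner: "(LINT r|time_measure t. ip (u r) (u t)) = (LINT r|time_measure T. L r t)" if "t \<in> {0<..<T}" for t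
    using that by (auto simp: integral_restrict_space L_def indicator_def intro!: Bochner_Integration.integral_cong)
  have Lm: "(\<lambda>(r, t). L r t) \<in> borel_measurable ?M"
  proof -
    have [measurable]: "(\<lambda>t. t) \<in> borel_measurable (time_measure T)" 
      by (intro measurable_restrict_space1 measurable_completion) simp
    have "{p \<in> space ?M. fst p < snd p} \<in> sets ?M" by measurable
    then have "(\<lambda>p. if fst p < snd p then ip (u (fst p)) (u (snd p)) else 0) \<in> borel_measurable ?M"
      using kernel_measurable by (intro measurable_If) (simp_all add: case_prod_unfold)
    then show ?thesis by (simp add: L_def case_prod_unfold)
  qed
  have Li: "integrable ?M (\<lambda>(r, t). L r t)"
    by (rule Bochner_Integration.integrable_bound[OF kernel_integrable Lm]) (auto simp: L_def)
  have Li': "integrable ?M (\<lambda>(r, t). L t r)"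
    using P.integrable_product_swap[OF Li] by (simp add: case_prod_unfold)
  have "integrable (time_measure T) (\<lambda>t. LINT r|time_measure T. L r t)" by (rule P.integrable_snd[OF Li])
  then show "integrable (time_measure T) (\<lambda>t. LINT r|time_measure t. ip (u r) (u t))"
    by (rule Bochner_Integration.integrable_cong[THEN iffD1, rotated 2]) (simp_all add: inner)
  have "(LINT t|time_measure T. LINT r|time_measure T. L r t) = (LINT t|time_measure T. LINT r|time_measure T. L t r)"
    by (rule P.Fubini_integral[OF Li])
  moreover have "(LINT t|time_measure T. LINT r|time_measure T. L r t) + (LINT t|time_measure T. LINT r|time_measure T. L t r) = energy"
  proof -
    have "(LINT t|time_measure T. LINT r|time_measure T. L r t) + (LINT t|time_measure T. LINT r|time_measure T. L t r) =
      integral\<^sup>L ?M (\<lambda>(r, t). L r t) + integral\<^sup>L ?M (\<lambda>(r, t). L t r)"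
      by (simp only: P.integral_snd[OF Li] P.integral_snd[OF Li'])
    also have "\<dots> = integral\<^sup>L ?M (\<lambda>(r, t). L r t + L t r)"
      using Bochner_Integration.integral_add[OF Li Li'] by (simp add: case_prod_unfold)
    also have "\<dots> = (LINT t|time_measure T. LINT r|time_measure T. L r t + L t r)"
      using Bochner_Integration.integrable_add[OF Li Li'] by (intro P.integral_snd[symmetric]) (simp add: case_prod_unfold)
    also have "\<dots> = energy"
      unfolding energy_def
    proof (rule Bochner_Integration.integral_cong[OF refl])
      fix t
      \<comment> \<open>On the diagonal neither triangle contributes; for fixed \<open>t\<close> it
        is the single point \<open>r = t\<close>.\<close>
      have "AE r in time_measure T. r \<noteq> t"
        by (simp add: AE_restrict_space_iff) (intro eventually_mono[OF AE_completion[OF AE_lborel_singleton[of t]]], simp)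
      then have ae: "AE r in time_measure T. L r t + L t r = ip (u r) (u t)"
        by eventually_elim (auto simp: L_def sym[OF regD(1) regD(1)])
      have m: "(\<lambda>r. ip (u r) (u t)) \<in> borel_measurable (time_measure T)"
        by (rule bounded_functional.regular_measurable[OF bounded_left[OF regD(1)] reg])
      have ae': "AE r in time_measure T. ip (u r) (u t) = L r t + L t r"
        using ae by eventually_elim simp
      show "(LINT r|time_measure T. L r t + L t r) = (LINT r|time_measure T. ip (u r) (u t))"
        by (rule integral_cong_AE[OF time_measurable_AE[OF m ae'] m ae])
    qed
    finally show ?thesis .
  qed
  moreover have "(LINT t|time_measure T. LINT r|time_measure t. ip (u r) (u t)) = (LINT t|time_measure T. LINT r|time_measure T. L r t)"
    by (rule Bochner_Integration.integral_cong) (simp_all add: inner)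
  ultimately show "(LINT t|time_measure T. LINT r|time_measure t. ip (u r) (u t)) = energy / 2" by simp
qed

end

end


subsection \<open>Energy estimates\<close>

lemma AE_time_mono:
  assumes "AE s in time_measure T. P s" "t \<le> T" shows "AE s in time_measure t. P s"
  using assms by (auto simp: AE_restrict_space_iff elim!: eventually_mono)

lemma time_integrable_mono:
  fixes f :: "real \<Rightarrow> real"
  shows "integrable (time_measure T) f \<Longrightarrow> t \<le> T \<Longrightarrow> integrable (time_measure t) f"
  by (rule integrable_lebesgue_on_mono[of "{0<..<T}"]) auto

text \<open>In applications the derivative is known through a concrete function \<open>h\<close>
  almost everywhere, and the initial value \<open>g\<close> up to seminorm 0; both suffice because
  \<open>l\<close> does not see these differences.\<close>

lemma (in bounded_functional) time_evolution_AE: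
  assumes deriv: "has_time_deriv T X N u u'"
    and uX: "AE t in time_measure T. u t \<in> X" and u'X: "AE t in time_measure T. u' t \<in> X"
    and h: "integrable (time_measure T) h" and hu: "AE t in time_measure T. h t = l (u' t)"
    and wX: "\<And>t. t \<in> {0..T} \<Longrightarrow> w t \<in> X"
    and cont: "\<And>t. t \<in> {0..T} \<Longrightarrow> ((\<lambda>s. N (\<lambda>b. w s b - w t b)) \<longlongrightarrow> 0) (at t within {0..T})"
    and wu: "AE t in time_measure T. N (\<lambda>b. w t b - u t b) = 0"
    and g: "N (\<lambda>b. w 0 b - g b) = 0" "g \<in> X"
    and t: "t \<in> {0..T}"
  shows "l (w t) = l g + (LINT s|time_measure t. h s)"
proof -
  have int': "integrable (time_measure T) (\<lambda>t. l (u' t))" by (rule time_integrable_AE[OF h hu])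
  have "l (w t) = l (w 0) + (LINT s|time_measure t. l (u' s))"
    using deriv uX u'X int' wX cont wu t by (rule time_evolution(2))
  moreover have "(LINT s|time_measure t. h s) = (LINT s|time_measure t. l (u' s))"
  proof (rule integral_cong_AE)
    show "AE s in time_measure t. h s = l (u' s)" using AE_time_mono[OF hu] t by auto
    show "h \<in> borel_measurable (time_measure t)" "(\<lambda>s. l (u' s)) \<in> borel_measurable (time_measure t)"
      using time_integrable_mono[OF h, of t] time_integrable_mono[OF int', of t] t by auto
  qed
  moreover have "l (w 0) = l g" by (rule eq_of_norm_diff_zero[OF wX g(2,1)]) (use t in auto)
  ultimately show ?thesis by simp
qed

lemma L2_bounded_form: "bounded_form (L2 A) (L2_inner A) (L2_norm A) 1"
  by (intro bounded_form.intro bounded_form_axioms.intro L2_semi_inner_product L2n.seminormed_space_axioms)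
     (simp_all add: L2_norm_square)

context open_set
begin

lemma dirichlet_bounded_form:
  assumes "a \<in> borel_measurable (lebesgue_on \<Omega>)" "\<And>x. 0 \<le> a x" "\<And>x. a x \<le> 1"
  shows "bounded_form (H1_0 \<Omega>) (dirichlet_form a) (H1_norm \<Omega>) 1"
proof -
  have "semi_inner_product (H1_0 \<Omega>) (dirichlet_form a)"
    by (rule semi_inner_product.subspace_semi_inner_product[OF dirichlet_form_semi_inner_product])
       (use assms H1_0_function_space H1_0_subset in auto)
  then show ?thesis
    using dirichlet_form_le_H1_norm[OF assms] H1_0_H1
    by (intro bounded_form.intro bounded_form_axioms.intro H1_0n.seminormed_space_axioms) simp_all
qed

text \<open>Testing an equation in the dual space with \<open>v\<close> is evaluation at
  \<open>v\<close>, so \<open>time_evolution\<close> applies to the equation for the second time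
  derivative.\<close>

lemma evaluation_bounded_functional:
  assumes "v \<in> H1_0 \<Omega>"
  shows "bounded_functional (H_minus1 \<Omega>) (\<lambda>F. F v) (H_minus1_norm \<Omega>) (H1_norm \<Omega> v)"
  using H_minus1_norm_bound[OF _ assms]
  by (intro bounded_functional.intro bounded_functional_axioms.intro linear_functional.intro
      linear_functional_axioms.intro H_minus1_function_space Hmn.seminormed_space_axioms)
     (simp_all add: mult.commute)

text \<open>Three objects represent the solution: \<open>uu\<close> with values in
  \<open>H1_0\<close> at every time, \<open>w\<close> continuous in L2, and a dual-space path
  \<open>y\<close> continuous in time that represents the velocity. The identity arises from pairing
  the integrated equations for \<open>w\<close> and \<open>y\<close> with the solution and comparing
  the double integrals that appear.\<close>

lemma wave_energy:
  assumes T: "T > 0"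
    and a: "a \<in> borel_measurable (lebesgue_on \<Omega>)" "\<And>x. 0 \<le> a x" "\<And>x. a x \<le> 1"
    and u0: "u0 \<in> L2 \<Omega>" and v0: "v0 \<in> L2 \<Omega>"
    and sol: "weak_wave_solution T \<Omega> a (\<lambda>t x. 0) u0 v0 u"
  obtains uu su w where
    "seminormed_space.regular (H1_0 \<Omega>) (H1_norm \<Omega>) T uu su" "AE t in time_measure T. uu t = u t"
    "\<And>t. t \<in> {0..T} \<Longrightarrow> w t \<in> L2 \<Omega>"
    "\<And>t. t \<in> {0..T} \<Longrightarrow> ((\<lambda>s. L2_norm \<Omega> (\<lambda>b. w s b - w t b)) \<longlongrightarrow> 0) (at t within {0..T})"
    "AE t in time_measure T. L2_norm \<Omega> (\<lambda>b. w t b - u t b) = 0"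
    "\<And>v. v \<in> L2 \<Omega> \<Longrightarrow> continuous_on {0..T} (\<lambda>t. L2_inner \<Omega> (w t) v)"
    "\<And>t. t \<in> {0..T} \<Longrightarrow> L2_inner \<Omega> (w t) (w t) = L2_inner \<Omega> u0 u0
        + 2 * (LINT s|time_measure t. L2_inner \<Omega> (w s) v0)
        - bounded_form.energy (dirichlet_form a) t uu"
    "\<And>z t. z \<in> H1_0 \<Omega> \<Longrightarrow> t \<in> {0..T} \<Longrightarrow> \<exists>h. integrable (time_measure t) h \<and>
        L2_inner \<Omega> (w t) z = L2_inner \<Omega> u0 z + (LINT s|time_measure t. h s) \<and>
        (AE s in time_measure t. h s = L2_inner \<Omega> v0 z - (LINT r|time_measure s. dirichlet_form a (uu r) z))"
proof -
  interpret L2b: bounded_form "L2 \<Omega>" "L2_inner \<Omega>" "L2_norm \<Omega>" 1 by (rule L2_bounded_form)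
  interpret D: bounded_form "H1_0 \<Omega>" "dirichlet_form a" "H1_norm \<Omega>" 1 by (rule dirichlet_bounded_form[OF a])
  obtain u' u'' where u: "u \<in> bochner_L2 T (H1_0 \<Omega>) (H1_norm \<Omega>)"
    and u': "u' \<in> bochner_L2 T (L2 \<Omega>) (L2_norm \<Omega>)" "has_time_deriv T (L2 \<Omega>) (L2_norm \<Omega>) u u'"
    and u'': "u'' \<in> bochner_L2 T (H_minus1 \<Omega>) (H_minus1_norm \<Omega>)"
      "has_time_deriv T (H_minus1 \<Omega>) (H_minus1_norm \<Omega>) (\<lambda>t. L2_inner \<Omega> (u' t)) u''"
    and eqn: "\<And>v. v \<in> H1_0 \<Omega> \<Longrightarrow> AE t in time_measure T.
           u'' t v + L2_inner \<Omega> (\<lambda>x. a x * weak_deriv \<Omega> (u t) x) (weak_deriv \<Omega> v) = L2_inner \<Omega> (\<lambda>x. 0) v"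
    and init: "has_initial_value T (L2 \<Omega>) (L2_norm \<Omega>) u u0"
      "has_initial_value T (H_minus1 \<Omega>) (H_minus1_norm \<Omega>) (\<lambda>t. L2_inner \<Omega> (u' t)) (L2_inner \<Omega> v0)"
    using sol unfolding weak_wave_solution_def by blast
  obtain uu su where reg: "H1_0n.regular T uu su" and uu: "AE t in time_measure T. uu t = u t"
    using H1_0n.bochner_L2_regular[OF u] .
  obtain pp sp where regp: "L2n.regular \<Omega> T pp sp" and pp: "AE t in time_measure T. pp t = u' t"
    using L2n.bochner_L2_regular[OF u'(1)] .
  obtain w where wX: "\<And>t. t \<in> {0..T} \<Longrightarrow> w t \<in> L2 \<Omega>"
    and wc: "\<And>t. t \<in> {0..T} \<Longrightarrow> ((\<lambda>s. L2_norm \<Omega> (\<lambda>b. w s b - w t b)) \<longlongrightarrow> 0) (at t within {0..T})"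
    and wu: "AE t in time_measure T. L2_norm \<Omega> (\<lambda>b. w t b - u t b) = 0"
    and w0: "L2_norm \<Omega> (\<lambda>b. w 0 b - u0 b) = 0"
    using init(1) unfolding has_initial_value_def by blast
  obtain y where yX: "\<And>t. t \<in> {0..T} \<Longrightarrow> y t \<in> H_minus1 \<Omega>"
    and yc: "\<And>t. t \<in> {0..T} \<Longrightarrow> ((\<lambda>s. H_minus1_norm \<Omega> (\<lambda>b. y s b - y t b)) \<longlongrightarrow> 0) (at t within {0..T})"
    and yu: "AE t in time_measure T. H_minus1_norm \<Omega> (\<lambda>b. y t b - L2_inner \<Omega> (u' t) b) = 0"
    and y0: "H_minus1_norm \<Omega> (\<lambda>b. y 0 b - L2_inner \<Omega> v0 b) = 0"
    using init(2) unfolding has_initial_value_def by blast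
  have uX: "AE t in time_measure T. u t \<in> H1_0 \<Omega>" and u'X: "AE t in time_measure T. u' t \<in> L2 \<Omega>"
    and u''X: "AE t in time_measure T. u'' t \<in> H_minus1 \<Omega>"
    using u u' u'' by (auto simp: bochner_L2_def)
  have uL: "AE t in time_measure T. u t \<in> L2 \<Omega>" using uX by eventually_elim (rule H1_0_L2)
  have u'H: "AE t in time_measure T. L2_inner \<Omega> (u' t) \<in> H_minus1 \<Omega>"
    using u'X by eventually_elim (rule L2_inner_H_minus1)
  note ppX = L2n.regularD(1)[OF regp] and uuX = H1_0n.regularD(1)[OF reg]

  have pint: "integrable (time_measure t) (\<lambda>s. L2_inner \<Omega> (pp s) v)" if "v \<in> L2 \<Omega>" "t \<le> T" for v t
    by (rule bounded_functional.regular_integrable[OF L2b.bounded_left[OF that(1)] L2n.regular_mono[OF regp that(2)]])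
  \<comment> \<open>The equation \<open>w(t) = u0 + \<integral> u'\<close> for every fixed L2
    function \<open>v\<close> at every time; for fixed \<open>t\<close> it may therefore be used
    with \<open>v = w t\<close>.\<close>
  have F1: "L2_inner \<Omega> (w t) v = L2_inner \<Omega> u0 v + (LINT s|time_measure t. L2_inner \<Omega> (pp s) v)"
    if v: "v \<in> L2 \<Omega>" and t: "t \<in> {0..T}" for v t
  proof (rule bounded_functional.time_evolution_AE[OF L2b.bounded_left[OF v] u'(2) uL u'X pint[OF v order_refl] _ wX wc wu w0 u0 t])
    show "AE t in time_measure T. L2_inner \<Omega> (pp t) v = L2_inner \<Omega> (u' t) v"
      using pp by eventually_elim simp
  qed
  \<comment> \<open>The wave equation integrated once, with the continuous representative
    \<open>y\<close> of the velocity.\<close>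
  have F2: "y t v = L2_inner \<Omega> v0 v - (LINT s|time_measure t. dirichlet_form a (uu s) v)"
    if v: "v \<in> H1_0 \<Omega>" and t: "t \<in> {0..T}" for v t
  proof -
    have "y t v = L2_inner \<Omega> v0 v + (LINT s|time_measure t. - dirichlet_form a (uu s) v)"
    proof (rule bounded_functional.time_evolution_AE[OF evaluation_bounded_functional[OF v] u''(2) u'H u''X _ _ yX yc yu y0 L2_inner_H_minus1[OF v0] t])
      show "integrable (time_measure T) (\<lambda>s. - dirichlet_form a (uu s) v)"
        using bounded_functional.regular_integrable[OF D.bounded_left[OF v] reg] by simp
      show "AE t in time_measure T. - dirichlet_form a (uu t) v = u'' t v"
        using eqn[OF v] uu
      proof eventually_elim
        case (elim t)
        then show ?case by (simp add: dirichlet_form_def L2_inner_def)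
      qed
    qed
    then show ?thesis by simp
  qed
  \<comment> \<open>The null set of exceptional times is independent of \<open>v\<close>, since the
    dual norm of the difference vanishes. Hence \<open>v\<close> may later depend on
    \<open>s\<close>, in particular \<open>v = uu s\<close>.\<close>
  have F3: "AE s in time_measure T. \<forall>v\<in>H1_0 \<Omega>. y s v = L2_inner \<Omega> (pp s) v"
    using yu u'H pp AE_space
  proof eventually_elim
    case (elim s)
    then have ys: "y s \<in> H_minus1 \<Omega>" using yX by auto
    show ?case
    proof
      fix v assume v: "v \<in> H1_0 \<Omega>"
      have "\<bar>y s v - L2_inner \<Omega> (u' s) v\<bar> \<le> 0 * H1_norm \<Omega> v"
        using H_minus1_norm_bound[OF Hm.diff_mem[OF ys elim(2)] v] elim(1) by simp
      then show "y s v = L2_inner \<Omega> (pp s) v" using elim(3) by simp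
    qed
  qed

  have weak: "\<exists>h. integrable (time_measure t) h \<and>
        L2_inner \<Omega> (w t) z = L2_inner \<Omega> u0 z + (LINT s|time_measure t. h s) \<and>
        (AE s in time_measure t. h s = L2_inner \<Omega> v0 z - (LINT r|time_measure s. dirichlet_form a (uu r) z))"
    if z: "z \<in> H1_0 \<Omega>" and t: "t \<in> {0..T}" for z t
  proof (intro exI conjI)
    show "integrable (time_measure t) (\<lambda>s. L2_inner \<Omega> (pp s) z)" using pint[OF H1_0_L2[OF z]] t by auto
    show "L2_inner \<Omega> (w t) z = L2_inner \<Omega> u0 z + (LINT s|time_measure t. L2_inner \<Omega> (pp s) z)"
      by (rule F1[OF H1_0_L2[OF z] t])
    have "AE s in time_measure T. L2_inner \<Omega> (pp s) z = L2_inner \<Omega> v0 z - (LINT r|time_measure s. dirichlet_form a (uu r) z)"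
      using F3 AE_space
    proof eventually_elim
      case (elim s)
      then have "s \<in> {0..T}" by auto
      then show ?case using F2[OF z, of s] elim(1) z by simp
    qed
    then show "AE s in time_measure t. L2_inner \<Omega> (pp s) z = L2_inner \<Omega> v0 z - (LINT r|time_measure s. dirichlet_form a (uu r) z)"
      by (rule AE_time_mono) (use t in simp)
  qed

  have contw: "continuous_on {0..T} (\<lambda>t. L2_inner \<Omega> (w t) v)" if v: "v \<in> L2 \<Omega>" for v
  proof (rule bounded_functional.time_evolution(1)[OF L2b.bounded_left[OF v] u'(2) uL u'X _ wX wc wu])
    have "AE t in time_measure T. L2_inner \<Omega> (pp t) v = L2_inner \<Omega> (u' t) v"
      using pp by eventually_elim simp
    then show "integrable (time_measure T) (\<lambda>t. L2_inner \<Omega> (u' t) v)"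
      by (rule time_integrable_AE[OF pint[OF v order_refl]])
    show "0 \<in> {0..T}" using T by simp
  qed

  have energy: "L2_inner \<Omega> (w t) (w t) = L2_inner \<Omega> u0 u0 + 2 * (LINT s|time_measure t. L2_inner \<Omega> (w s) v0) - D.energy t uu"
    if t: "t \<in> {0..T}" for t
  proof -
    have tT: "t \<le> T" using t by simp
    note rp = L2n.regular_mono[OF regp tT] and ru = H1_0n.regular_mono[OF reg tT]
    define A where "A s = L2_inner \<Omega> (pp s) u0" for s
    define B where "B s = (LINT r|time_measure s. L2_inner \<Omega> (pp r) (pp s))" for s
    define E where "E s = (LINT r|time_measure s. dirichlet_form a (uu r) (uu s))" for s
    have Ai: "integrable (time_measure t) A" unfolding A_def by (rule pint[OF u0 tT])
    have Bi: "integrable (time_measure t) B" unfolding B_def by (rule L2b.energy_half(2)[OF rp])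
    have Ei: "integrable (time_measure t) E" unfolding E_def by (rule D.energy_half(2)[OF ru])
    have "L2_inner \<Omega> (w t) (w t) = L2_inner \<Omega> u0 (w t) + (LINT s|time_measure t. L2_inner \<Omega> (pp s) (w t))"
      by (rule F1[OF wX[OF t] t])
    also have "L2_inner \<Omega> u0 (w t) = L2_inner \<Omega> (w t) u0" by (rule L2.sym[OF u0 wX[OF t]])
    also have "\<dots> = L2_inner \<Omega> u0 u0 + (LINT s|time_measure t. A s)" unfolding A_def by (rule F1[OF u0 t])
    \<comment> \<open>The factor \<open>w t\<close> is expanded once more by \<open>F1\<close>, now
      with test function \<open>pp s\<close>; this produces the double integral of the velocity over
      the square.\<close>
    also have "(LINT s|time_measure t. L2_inner \<Omega> (pp s) (w t)) =
        (LINT s|time_measure t. A s + (LINT r|time_measure t. L2_inner \<Omega> (pp r) (pp s)))"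
    proof (rule Bochner_Integration.integral_cong[OF refl])
      fix s
      show "L2_inner \<Omega> (pp s) (w t) = A s + (LINT r|time_measure t. L2_inner \<Omega> (pp r) (pp s))"
        using F1[OF ppX t, of s] L2.sym[OF ppX wX[OF t], of s] L2.sym[OF u0 ppX, of s] by (simp add: A_def)
    qed
    also have "\<dots> = (LINT s|time_measure t. A s) + L2b.energy t pp"
      unfolding L2b.energy_def[OF rp] using Ai L2b.energy_integrable[OF rp] by simp
    also have "L2b.energy t pp = 2 * (LINT s|time_measure t. B s)"
      unfolding B_def using L2b.energy_half(1)[OF rp] by simp
    finally have e1: "L2_inner \<Omega> (w t) (w t) = L2_inner \<Omega> u0 u0 + 2 * (LINT s|time_measure t. A s + B s)"
      using Ai Bi by simp
    \<comment> \<open>\<open>A s + B s\<close> is the pairing of displacement and velocity at time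
      \<open>s\<close>. Read as \<open>y s (uu s)\<close>, it is evaluated by the integrated wave
      equation, which brings in the form over the triangle.\<close>
    have "AE s in time_measure T. A s + B s = L2_inner \<Omega> (w s) v0 - E s"
      using F3 wu uu AE_space uX
    proof eventually_elim
      case (elim s)
      then have s: "s \<in> {0..T}" by auto
      have "A s + B s = L2_inner \<Omega> (w s) (pp s)"
        unfolding A_def B_def using F1[OF ppX s, of s] L2.sym[OF u0 ppX, of s] by simp
      also have "\<dots> = L2_inner \<Omega> (uu s) (pp s)"
        by (rule bounded_functional.eq_of_norm_diff_zero[OF L2b.bounded_left[OF ppX] wX[OF s] H1_0_L2[OF uuX]])
           (use elim in simp)
      also have "\<dots> = y s (uu s)" using elim(1) uuX[of s] L2.sym[OF ppX H1_0_L2[OF uuX], of s s] by simp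
      also have "\<dots> = L2_inner \<Omega> v0 (uu s) - E s" unfolding E_def by (rule F2[OF uuX s])
      also have "L2_inner \<Omega> v0 (uu s) = L2_inner \<Omega> (uu s) v0" by (rule L2.sym[OF v0 H1_0_L2[OF uuX]])
      also have "\<dots> = L2_inner \<Omega> (w s) v0"
        by (rule bounded_functional.eq_of_norm_diff_zero[OF L2b.bounded_left[OF v0] wX[OF s] H1_0_L2[OF uuX], symmetric])
           (use elim in simp)
      finally show ?case .
    qed
    then have ae: "AE s in time_measure t. A s + B s = L2_inner \<Omega> (w s) v0 - E s"
      using tT by (rule AE_time_mono)
    have wi: "integrable (time_measure t) (\<lambda>s. L2_inner \<Omega> (w s) v0)"
      using continuous_integrable_Ioo[OF contw[OF v0]] tT by (rule time_integrable_mono)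
    have "(LINT s|time_measure t. A s + B s) = (LINT s|time_measure t. L2_inner \<Omega> (w s) v0 - E s)"
      using Ai Bi wi Ei ae by (intro integral_cong_AE) auto
    also have "\<dots> = (LINT s|time_measure t. L2_inner \<Omega> (w s) v0) - (LINT s|time_measure t. E s)"
      using wi Ei by simp
    also have "(LINT s|time_measure t. E s) = D.energy t uu / 2"
      unfolding E_def by (rule D.energy_half(1)[OF ru])
    finally show ?thesis using e1 by simp
  qed
  show ?thesis by (rule that[OF reg uu wX wc wu contw energy weak])
qed

text \<open>Any \<open>m\<close> above this number violates \<open>m\<^sup>2 \<le>
  \<parallel>u0\<parallel>\<^sup>2 + 2 T \<parallel>v0\<parallel> m\<close>, the inequality that the
  energy identity gives for the maximal norm. No coefficient enters.\<close>

definition solution_bound :: "real \<Rightarrow> (real \<Rightarrow> real) \<Rightarrow> (real \<Rightarrow> real) \<Rightarrow> real" where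
  "solution_bound T u0 v0 = L2_norm \<Omega> u0 + 2 * T * L2_norm \<Omega> v0"

text \<open>The energy term is nonnegative: dropping it bounds \<open>w\<close>, and bounding the
  remaining terms of the identity bounds the energy itself. That bound and Cauchy-Schwarz for the
  form give the last estimate.\<close>

lemma wave_estimates:
  assumes T: "T > 0"
    and a: "a \<in> borel_measurable (lebesgue_on \<Omega>)" "\<And>x. 0 \<le> a x" "\<And>x. a x \<le> 1"
    and u0: "u0 \<in> L2 \<Omega>" and v0: "v0 \<in> L2 \<Omega>"
    and sol: "weak_wave_solution T \<Omega> a (\<lambda>t x. 0) u0 v0 u"
  obtains w where
    "\<And>t. t \<in> {0..T} \<Longrightarrow> w t \<in> L2 \<Omega>"
    "AE t in time_measure T. L2_norm \<Omega> (\<lambda>b. w t b - u t b) = 0"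
    "\<And>v. v \<in> L2 \<Omega> \<Longrightarrow> continuous_on {0..T} (\<lambda>t. L2_inner \<Omega> (w t) v)"
    "\<And>t. t \<in> {0..T} \<Longrightarrow> L2_norm \<Omega> (w t) \<le> solution_bound T u0 v0"
    "\<And>t. t \<in> {0..T} \<Longrightarrow> L2_inner \<Omega> (w t) (w t) \<le> L2_inner \<Omega> u0 u0 + 2 * (LINT s|time_measure t. L2_inner \<Omega> (w s) v0)"
    "\<And>z t. z \<in> H1_0 \<Omega> \<Longrightarrow> t \<in> {0..T} \<Longrightarrow> \<bar>L2_inner \<Omega> (w t) z - L2_inner \<Omega> u0 z - t * L2_inner \<Omega> v0 z\<bar>
        \<le> T * (solution_bound T u0 v0 * sqrt (dirichlet_form a z z))"
proof -
  interpret D: bounded_form "H1_0 \<Omega>" "dirichlet_form a" "H1_norm \<Omega>" 1 by (rule dirichlet_bounded_form[OF a])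
  obtain uu su w where reg: "H1_0n.regular T uu su" and "AE t in time_measure T. uu t = u t"
    and wX: "\<And>t. t \<in> {0..T} \<Longrightarrow> w t \<in> L2 \<Omega>"
    and wc: "\<And>t. t \<in> {0..T} \<Longrightarrow> ((\<lambda>s. L2_norm \<Omega> (\<lambda>b. w s b - w t b)) \<longlongrightarrow> 0) (at t within {0..T})"
    and wu: "AE t in time_measure T. L2_norm \<Omega> (\<lambda>b. w t b - u t b) = 0"
    and contw: "\<And>v. v \<in> L2 \<Omega> \<Longrightarrow> continuous_on {0..T} (\<lambda>t. L2_inner \<Omega> (w t) v)"
    and energy: "\<And>t. t \<in> {0..T} \<Longrightarrow> L2_inner \<Omega> (w t) (w t) = L2_inner \<Omega> u0 u0
        + 2 * (LINT s|time_measure t. L2_inner \<Omega> (w s) v0) - D.energy t uu"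
    and weak: "\<And>z t. z \<in> H1_0 \<Omega> \<Longrightarrow> t \<in> {0..T} \<Longrightarrow> \<exists>h. integrable (time_measure t) h \<and>
        L2_inner \<Omega> (w t) z = L2_inner \<Omega> u0 z + (LINT s|time_measure t. h s) \<and>
        (AE s in time_measure t. h s = L2_inner \<Omega> v0 z - (LINT r|time_measure s. dirichlet_form a (uu r) z))"
    by (rule wave_energy[OF T a u0 v0 sol]; rule that; assumption)
  have en0: "0 \<le> D.energy t uu" if "t \<in> {0..T}" for t
    using D.energy_nonneg[OF H1_0n.regular_mono[OF reg]] that by auto
  define R where "R = solution_bound T u0 v0"
  have nn: "0 \<le> L2_norm \<Omega> u0" "0 \<le> L2_norm \<Omega> v0" using u0 v0 by (auto intro: L2n.nonneg)
  have R0: "0 \<le> R" using nn T by (simp add: R_def solution_bound_def)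
  have "continuous_on {0..T} (\<lambda>t. L2_norm \<Omega> (w t))"
    unfolding continuous_on_def
  proof
    fix t assume t: "t \<in> {0..T}"
    have "((\<lambda>s. L2_norm \<Omega> (w s) - L2_norm \<Omega> (w t)) \<longlongrightarrow> 0) (at t within {0..T})"
    proof (rule tendsto_0_le[OF wc[OF t], where K=1])
      show "\<forall>\<^sub>F s in at t within {0..T}. norm (L2_norm \<Omega> (w s) - L2_norm \<Omega> (w t)) \<le> norm (L2_norm \<Omega> (\<lambda>b. w s b - w t b)) * 1"
        unfolding eventually_at_filter
        using L2n.norm_triangle_diff[OF wX wX[OF t]] by (intro always_eventually) (auto intro: order_trans[OF _ abs_ge_self])
    qed
    then show "((\<lambda>t. L2_norm \<Omega> (w t)) \<longlongrightarrow> L2_norm \<Omega> (w t)) (at t within {0..T})" by (rule LIM_zero_cancel)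
  qed
  \<comment> \<open>The norm attains its maximum by continuity. At this time the energy identity
    becomes a quadratic inequality for the maximum alone, since the norm under the time integral is
    at most the same maximum.\<close>
  then obtain tm where tm: "tm \<in> {0..T}" "\<And>t. t \<in> {0..T} \<Longrightarrow> L2_norm \<Omega> (w t) \<le> L2_norm \<Omega> (w tm)"
    using continuous_attains_sup[of "{0..T}" "\<lambda>t. L2_norm \<Omega> (w t)"] T by auto
  define m where "m = L2_norm \<Omega> (w tm)"
  have m0: "0 \<le> m" unfolding m_def by (rule L2n.nonneg[OF wX[OF tm(1)]])
  have intb: "(LINT s|time_measure t. L2_inner \<Omega> (w s) v0) \<le> T * (m * L2_norm \<Omega> v0)" if t: "t \<in> {0..T}" for t
  proof -
    have "(LINT s|time_measure t. L2_inner \<Omega> (w s) v0) \<le> (LINT s|time_measure t. m * L2_norm \<Omega> v0)"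
    proof (rule integral_mono)
      show "integrable (time_measure t) (\<lambda>s. L2_inner \<Omega> (w s) v0)"
        using continuous_integrable_Ioo[OF contw[OF v0]] by (rule time_integrable_mono) (use t in simp)
      show "integrable (time_measure t) (\<lambda>s. m * L2_norm \<Omega> v0)"
        by (rule finite_measure.integrable_const[OF finite_time_measure])
      fix s assume "s \<in> space (time_measure t)"
      then have s: "s \<in> {0..T}" using t by auto
      have "L2_inner \<Omega> (w s) v0 \<le> L2_norm \<Omega> (w s) * L2_norm \<Omega> v0"
        using L2_cauchy_schwarz[OF wX[OF s] v0] by simp
      also have "\<dots> \<le> m * L2_norm \<Omega> v0" unfolding m_def by (intro mult_right_mono tm(2) s nn)
      finally show "L2_inner \<Omega> (w s) v0 \<le> m * L2_norm \<Omega> v0" .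
    qed
    also have "\<dots> = t * (m * L2_norm \<Omega> v0)"
      using t by (simp add: measure_restrict_space)
    also have "\<dots> \<le> T * (m * L2_norm \<Omega> v0)" using t m0 nn by (intro mult_right_mono) auto
    finally show ?thesis .
  qed
  have m2: "m\<^sup>2 \<le> (L2_norm \<Omega> u0)\<^sup>2 + 2 * T * L2_norm \<Omega> v0 * m"
    using energy[OF tm(1)] en0[OF tm(1)] intb[OF tm(1)] unfolding m_def L2_norm_square[symmetric]
    by (simp add: algebra_simps)
  have mR: "m \<le> R"
  proof (rule ccontr)
    assume "\<not> m \<le> R"
    then have lt: "L2_norm \<Omega> u0 + 2 * T * L2_norm \<Omega> v0 < m" by (simp add: R_def solution_bound_def)
    then have lt2: "L2_norm \<Omega> u0 < m" and mp: "0 < m" using nn T R0 \<open>\<not> m \<le> R\<close> by (auto simp: order_le_less_trans[OF _ lt])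
    have "m * (L2_norm \<Omega> u0 + 2 * T * L2_norm \<Omega> v0) < m * m" by (rule mult_strict_left_mono[OF lt mp])
    moreover have "L2_norm \<Omega> u0 * L2_norm \<Omega> u0 \<le> m * L2_norm \<Omega> u0" using lt2 nn by (intro mult_right_mono) auto
    ultimately show False using m2 by (simp add: power2_eq_square algebra_simps)
  qed
  have wR: "L2_norm \<Omega> (w t) \<le> R" if "t \<in> {0..T}" for t
    using tm(2)[OF that] mR by (simp add: m_def)
  have enR: "D.energy t uu \<le> R\<^sup>2" if t: "t \<in> {0..T}" for t
  proof -
    have "D.energy t uu \<le> (L2_norm \<Omega> u0)\<^sup>2 + 2 * (LINT s|time_measure t. L2_inner \<Omega> (w s) v0)"
      using energy[OF t] L2.pos[OF wX[OF t]] by (simp add: L2_norm_square)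
    also have "\<dots> \<le> (L2_norm \<Omega> u0)\<^sup>2 + 2 * (T * (R * L2_norm \<Omega> v0))"
    proof -
      have "T * (m * L2_norm \<Omega> v0) \<le> T * (R * L2_norm \<Omega> v0)" using mR nn T by (intro mult_left_mono mult_right_mono) auto
      then show ?thesis using intb[OF t] by simp
    qed
    \<comment> \<open>One factor of the initial norm is raised to \<open>R\<close> so that the sum
      is \<open>R\<close> times the definition of \<open>R\<close>.\<close>
    also have "\<dots> \<le> L2_norm \<Omega> u0 * R + 2 * (T * (R * L2_norm \<Omega> v0))"
      using nn T by (auto simp: power2_eq_square R_def solution_bound_def intro!: mult_left_mono)
    also have "\<dots> = R\<^sup>2" by (simp add: R_def solution_bound_def power2_eq_square algebra_simps)
    finally show ?thesis .
  qed
  have main: "\<bar>L2_inner \<Omega> (w t) z - L2_inner \<Omega> u0 z - t * L2_inner \<Omega> v0 z\<bar> \<le> T * (R * sqrt (dirichlet_form a z z))"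
    if z: "z \<in> H1_0 \<Omega>" and t: "t \<in> {0..T}" for z t
  proof -
    obtain h where hi: "integrable (time_measure t) h"
      and wh: "L2_inner \<Omega> (w t) z = L2_inner \<Omega> u0 z + (LINT s|time_measure t. h s)"
      and h: "AE s in time_measure t. h s = L2_inner \<Omega> v0 z - (LINT r|time_measure s. dirichlet_form a (uu r) z)"
      using weak[OF z t] by blast
    have ci: "integrable (time_measure t) (\<lambda>s. c)" for c :: real
      by (rule finite_measure.integrable_const[OF finite_time_measure])
    have const: "(LINT s|time_measure t. c) = t * c" for c :: real using t by (simp add: measure_restrict_space)
    have "L2_inner \<Omega> (w t) z - L2_inner \<Omega> u0 z - t * L2_inner \<Omega> v0 z = (LINT s|time_measure t. h s - L2_inner \<Omega> v0 z)"
      unfolding Bochner_Integration.integral_diff[OF hi ci] const using wh by simp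
    also have "\<bar>\<dots>\<bar> \<le> (LINT s|time_measure t. \<bar>h s - L2_inner \<Omega> v0 z\<bar>)" by (rule integral_abs_bound)
    also have "\<dots> \<le> (LINT s|time_measure t. R * sqrt (dirichlet_form a z z))"
    proof (rule integral_mono_AE)
      show "AE s in time_measure t. \<bar>h s - L2_inner \<Omega> v0 z\<bar> \<le> R * sqrt (dirichlet_form a z z)"
        using h AE_space
      proof eventually_elim
        case (elim s)
        then have s: "s \<in> {0..T}" "s \<le> T" using t by auto
        have "(LINT r|time_measure s. dirichlet_form a (uu r) z)\<^sup>2 \<le> dirichlet_form a z z * D.energy s uu"
          by (rule D.energy_cauchy_schwarz[OF H1_0n.regular_mono[OF reg s(2)] z])
        also have "\<dots> \<le> dirichlet_form a z z * R\<^sup>2" by (intro mult_left_mono enR s D.pos z)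
        finally have "sqrt ((LINT r|time_measure s. dirichlet_form a (uu r) z)\<^sup>2) \<le> sqrt (dirichlet_form a z z * R\<^sup>2)"
          by (rule real_sqrt_le_mono)
        then show ?case using elim R0 by (simp add: real_sqrt_mult mult.commute)
      qed
    qed (use hi ci in auto)
    also have "\<dots> = t * (R * sqrt (dirichlet_form a z z))" by (rule const)
    also have "\<dots> \<le> T * (R * sqrt (dirichlet_form a z z))"
      using t R0 D.pos[OF z] by (intro mult_right_mono mult_nonneg_nonneg) auto
    finally show ?thesis .
  qed
  show ?thesis
  proof (rule that[OF wX wu contw])
    show "L2_inner \<Omega> (w t) (w t) \<le> L2_inner \<Omega> u0 u0 + 2 * (LINT s|time_measure t. L2_inner \<Omega> (w s) v0)"
      if "t \<in> {0..T}" for t using energy[OF that] en0[OF that] by simp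
  qed (use wR main in \<open>auto simp: R_def\<close>)
qed

end


subsection \<open>Correctors and strong convergence\<close>

lemma integral_lebesgue_on_bound:
  fixes f :: "real \<Rightarrow> real"
  assumes A: "A \<in> sets lebesgue" and B: "\<And>x. x \<in> A \<Longrightarrow> \<bar>f x\<bar> \<le> B" and z: "\<And>x. x \<in> A \<Longrightarrow> x \<notin> {-\<rho>..\<rho>} \<Longrightarrow> f x = 0"
    and \<rho>: "0 \<le> \<rho>" and B0: "0 \<le> B"
  shows "f \<in> borel_measurable (lebesgue_on A) \<Longrightarrow> integrable (lebesgue_on A) f" "\<bar>LINT x|lebesgue_on A. f x\<bar> \<le> 2 * \<rho> * B"
proof -
  have i: "integrable (lebesgue_on A) (\<lambda>x. indicator {-\<rho>..\<rho>} x * B)"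
  proof (rule integrable_lebesgue_on_subset[OF _ A])
    show "integrable lebesgue (\<lambda>x. indicator {-\<rho>..\<rho>} x * B)"
      by (intro integrable_mult_left integrable_real_indicator) (auto simp: emeasure_lborel_Icc_eq)
  qed
  have le: "\<bar>f x\<bar> \<le> indicator {-\<rho>..\<rho>} x * B" if "x \<in> A" for x
    using B[OF that] z[OF that] by (cases "x \<in> {-\<rho>..\<rho>}") auto
  show int: "integrable (lebesgue_on A) f" if "f \<in> borel_measurable (lebesgue_on A)"
    by (rule Bochner_Integration.integrable_bound[OF i that]) (use le B0 in \<open>auto intro!: AE_I2\<close>)
  have "(LINT x|lebesgue_on A. indicator {-\<rho>..\<rho>} x * B) = (LINT x|lebesgue. indicator (A \<inter> {-\<rho>..\<rho>}) x * B)"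
    by (subst integral_restrict_space) (simp_all add: A indicator_inter_arith mult.assoc)
  also have "\<dots> = measure lebesgue (A \<inter> {-\<rho>..\<rho>}) * B" by simp
  also have "\<dots> \<le> measure lebesgue {-\<rho>..\<rho>} * B"
    using A B0 by (intro mult_right_mono measure_mono_fmeasurable) auto
  also have "\<dots> = 2 * \<rho> * B" using \<rho> by simp
  finally have bd: "(LINT x|lebesgue_on A. indicator {-\<rho>..\<rho>} x * B) \<le> 2 * \<rho> * B" .
  show "\<bar>LINT x|lebesgue_on A. f x\<bar> \<le> 2 * \<rho> * B"
  proof (cases "integrable (lebesgue_on A) f")
    case True
    have "\<bar>LINT x|lebesgue_on A. f x\<bar> \<le> (LINT x|lebesgue_on A. \<bar>f x\<bar>)" by (rule integral_abs_bound)
    also have "\<dots> \<le> (LINT x|lebesgue_on A. indicator {-\<rho>..\<rho>} x * B)"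
      by (rule integral_mono) (use True i le in auto)
    finally show ?thesis using bd by simp
  next
    \<comment> \<open>A function that is not integrable has integral 0 by convention, so the bound
      persists.\<close>
    case False
    then show ?thesis using \<rho> B0 by (simp add: not_integrable_integral_eq)
  qed
qed

lemma L2_inner_bounded_support:
  fixes f :: "real \<Rightarrow> real"
  assumes "\<And>x. \<bar>f x\<bar> \<le> B" "\<And>x. x \<notin> {-\<rho>..\<rho>} \<Longrightarrow> f x = 0" "A \<in> sets lebesgue" "0 \<le> \<rho>"
  shows "L2_inner A f f \<le> 2 * \<rho> * B\<^sup>2"
proof -
  have "\<bar>LINT x|lebesgue_on A. f x * f x\<bar> \<le> 2 * \<rho> * B\<^sup>2"
  proof (rule integral_lebesgue_on_bound(2))
    show "\<bar>f x * f x\<bar> \<le> B\<^sup>2" for x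
      using power_mono[OF assms(1)[of x], of 2] by (simp add: power2_eq_square)
  qed (use assms in auto)
  then show ?thesis by (simp add: L2_inner_def)
qed

lemma test_functions_bounded:
  assumes "\<phi> \<in> test_functions U" obtains B where "B \<ge> 0" "\<And>x. \<bar>\<phi> x\<bar> \<le> B"
proof -
  obtain K where K: "compact K" "\<And>x. x \<notin> K \<Longrightarrow> \<phi> x = 0" using test_functions_support[OF assms] by metis
  have "bounded (\<phi> ` K)"
    by (intro compact_imp_bounded compact_continuous_image K smooth_continuous_on test_functions_smooth[OF assms])
  then obtain B where B: "B > 0" "\<forall>x\<in>\<phi> ` K. norm x \<le> B" unfolding bounded_pos by blast
  have "\<bar>\<phi> x\<bar> \<le> B" for x using B K(2)[of x] by (cases "x \<in> K") auto
  then show ?thesis using that B by (metis less_imp_le)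
qed

lemma smooth_lipschitz:
  fixes g :: "real \<Rightarrow> real"
  assumes "smooth g" "\<And>x. \<bar>deriv g x\<bar> \<le> G"
  shows "\<bar>g x - g y\<bar> \<le> G * \<bar>x - y\<bar>"
  using field_differentiable_bound[of UNIV g "deriv g" G x y] smooth_deriv(1)[OF assms(1)] assms(2) by simp

lemma periodic_set_measurable:
  assumes "open \<Omega>" "open S" "\<epsilon> > 0"
  shows "periodic_set \<Omega> S \<epsilon> \<in> sets lebesgue"
proof -
  have "open ((\<lambda>s. \<epsilon> * (of_int j + s)) ` S)" for j :: int
  proof -
    have "(\<lambda>s. \<epsilon> * (of_int j + s)) ` S = (\<lambda>s. \<epsilon> * of_int j + \<epsilon> *\<^sub>R s) ` S"
      by (simp add: distrib_left)
    then show ?thesis using open_affinity[of S \<epsilon> "\<epsilon> * of_int j"] assms by simp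
  qed
  then have "open (periodic_set \<Omega> S \<epsilon>)" unfolding periodic_set_def using assms by (intro open_Int open_UN) auto
  then show ?thesis by simp
qed

lemma coefficient_properties:
  assumes "open \<Omega>" "open S" "0 < \<epsilon>" "\<epsilon> \<le> 1"
  shows "coefficient (\<epsilon>\<^sup>2) \<Omega> S \<epsilon> \<in> borel_measurable (lebesgue_on \<Omega>)"
    "0 \<le> coefficient (\<epsilon>\<^sup>2) \<Omega> S \<epsilon> x" "coefficient (\<epsilon>\<^sup>2) \<Omega> S \<epsilon> x \<le> 1"
proof -
  have "(\<lambda>x. if x \<in> periodic_set \<Omega> S \<epsilon> then \<epsilon>\<^sup>2 else 1) \<in> borel_measurable lebesgue"
    using periodic_set_measurable[OF assms(1-3)] by (intro measurable_If_set) auto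
  then show "coefficient (\<epsilon>\<^sup>2) \<Omega> S \<epsilon> \<in> borel_measurable (lebesgue_on \<Omega>)"
    unfolding coefficient_def by (intro measurable_restrict_space1)
  show "0 \<le> coefficient (\<epsilon>\<^sup>2) \<Omega> S \<epsilon> x" "coefficient (\<epsilon>\<^sup>2) \<Omega> S \<epsilon> x \<le> 1"
    using assms(3,4) by (auto simp: coefficient_def power_le_one)
qed

context open_set
begin

text \<open>The inner map \<open>p x = \<epsilon> \<theta>(x/\<epsilon>)\<close> stays within
  \<epsilon> of the identity, so \<open>z\<close> is close to \<open>g\<close> by the Lipschitz
  bound. The slope of \<open>z\<close> is bounded uniformly in \<epsilon> and vanishes off the soft
  set, so the form costs a constant times \<epsilon> squared.\<close>

lemma corrector_exists:
  assumes S: "open S" "S \<noteq> {}" and g: "g \<in> test_functions \<Omega>"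
  obtains C \<epsilon>\<^sub>0 where "C > 0" "\<epsilon>\<^sub>0 > 0" "\<epsilon>\<^sub>0 \<le> 1"
    "\<And>\<epsilon>. 0 < \<epsilon> \<Longrightarrow> \<epsilon> \<le> \<epsilon>\<^sub>0 \<Longrightarrow> \<exists>z\<in>test_functions \<Omega>. L2_norm \<Omega> (\<lambda>x. z x - g x) \<le> C * \<epsilon> \<and>
       dirichlet_form (coefficient (\<epsilon>\<^sup>2) \<Omega> S \<epsilon>) z z \<le> (C * \<epsilon>)\<^sup>2"
proof -
  obtain \<theta> where \<theta>: "smooth \<theta>" "\<And>x. deriv \<theta> x \<noteq> 0 \<Longrightarrow> \<exists>j::int. x - of_int j \<in> S"
    "\<And>x. \<bar>\<theta> x - x\<bar> \<le> 1" "bounded (range (deriv \<theta>))"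
    by (rule staircase_exists[OF S]; rule that; assumption)
  obtain M where M: "M > 0" "\<And>x. \<bar>deriv \<theta> x\<bar> \<le> M" using \<theta>(4) unfolding bounded_pos by auto
  obtain K where K: "compact K" "K \<subseteq> \<Omega>" "\<And>x. x \<notin> K \<Longrightarrow> g x = 0" "\<And>x. x \<notin> K \<Longrightarrow> deriv g x = 0"
    using test_functions_support[OF g] by metis
  obtain G where G: "G \<ge> 0" "\<And>x. \<bar>deriv g x\<bar> \<le> G" using test_functions_bounded[OF test_functions_deriv[OF g]] by metis
  obtain R where R: "R > 0" "K \<subseteq> {-R..R}" using compact_real_bounded_by[OF K(1)] .
  obtain \<delta> where \<delta>: "\<delta> > 0" "(\<Union>x\<in>K. cball x \<delta>) \<subseteq> \<Omega>"
    using compact_subset_open_imp_cball_epsilon_subset[OF K(1) open_\<Omega> K(2)] by blast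
  note gs = test_functions_smooth[OF g]
  \<comment> \<open>The root comes from the length of [-(R+1), R+1], which contains all supports.
    \<open>G * (1 + M)\<close> dominates both \<open>G\<close>, needed for the distance, and
    \<open>G * M\<close>, needed for the slope; the summand 1 makes \<open>C\<close>
    positive.\<close>
  define C where "C = sqrt (2 * (R + 1)) * (G * (1 + M)) + 1"
  have sqC: "2 * (R + 1) * (c * \<epsilon>)\<^sup>2 \<le> (C * \<epsilon>)\<^sup>2" if "0 \<le> c" "c \<le> G * (1 + M)" "\<epsilon> > 0" for c \<epsilon>
  proof -
    have "sqrt (2 * (R + 1)) * c \<le> C"
    proof -
      have "0 \<le> sqrt (2 * (R + 1))" using R by simp
      from mult_left_mono[OF that(2) this] show ?thesis unfolding C_def by linarith
    qed
    then have "sqrt (2 * (R + 1)) * (c * \<epsilon>) \<le> C * \<epsilon>"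
      unfolding mult.assoc[symmetric] using that(3) by (intro mult_right_mono) auto
    then have "(sqrt (2 * (R + 1)) * (c * \<epsilon>))\<^sup>2 \<le> (C * \<epsilon>)\<^sup>2"
      using that R by (intro power_mono) auto
    then show ?thesis using R by (simp add: power_mult_distrib)
  qed
  have C0: "C > 0" unfolding C_def using R G M by (intro add_nonneg_pos mult_nonneg_nonneg) auto
  show ?thesis
  \<comment> \<open>The support is displaced by at most \<epsilon>: the bound \<delta> keeps it
    inside \<Omega>, and the bound 1 keeps it in [-(R+1), R+1] and the coefficient at most
    1.\<close>
  proof (rule that[OF C0, of "min 1 \<delta>"])
    fix \<epsilon> :: real assume \<epsilon>: "0 < \<epsilon>" "\<epsilon> \<le> min 1 \<delta>"
    define p where "p x = \<epsilon> * \<theta> (x / \<epsilon>)" for x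
    define z where "z x = g (p x)" for x
    have "smooth (\<lambda>x. \<theta> (inverse \<epsilon> * x))" by (intro smooth_compose[OF \<theta>(1)] smooth_cmult smooth_id)
    then have ps: "smooth p"
      unfolding p_def divide_inverse by (subst mult.commute[of _ "inverse \<epsilon>"]) (rule smooth_cmult)
    have zs: "smooth z" unfolding z_def by (rule smooth_compose[OF gs ps])
    have px: "\<bar>p x - x\<bar> \<le> \<epsilon>" for x
    proof -
      have "p x - x = \<epsilon> * (\<theta> (x / \<epsilon>) - x / \<epsilon>)" using \<epsilon> by (simp add: p_def right_diff_distrib)
      then have "\<bar>p x - x\<bar> = \<epsilon> * \<bar>\<theta> (x / \<epsilon>) - x / \<epsilon>\<bar>" using \<epsilon> by (simp add: abs_mult)
      then show ?thesis using mult_left_mono[OF \<theta>(3)[of "x / \<epsilon>"], of \<epsilon>] \<epsilon> by simp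
    qed
    define K' where "K' = p -` K"
    have K'R: "K' \<subseteq> {-(R+1)..R+1}"
    proof
      fix x assume "x \<in> K'"
      then have "p x \<in> {-R..R}" using R by (auto simp: K'_def)
      then show "x \<in> {-(R+1)..R+1}" using px[of x] \<epsilon> by auto
    qed
    have "closed K'" unfolding K'_def
      using K(1) smooth_continuous_on[OF ps] by (intro closed_vimage) (auto simp: compact_imp_closed)
    then have K'c: "compact K'" using K'R bounded_subset[OF bounded_closed_interval] by (auto simp: compact_eq_bounded_closed)
    have K'\<Omega>: "K' \<subseteq> \<Omega>"
    proof
      fix x assume "x \<in> K'"
      then have "p x \<in> K" by (simp add: K'_def)
      moreover have "x \<in> cball (p x) \<delta>" using px[of x] \<epsilon> by (simp add: dist_real_def)
      ultimately show "x \<in> \<Omega>" using \<delta> by blast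
    qed
    have z0: "z x = 0" if "x \<notin> K'" for x using that K(3) by (simp add: K'_def z_def)
    have zt: "z \<in> test_functions \<Omega>" by (rule test_functionsI[OF zs K'c K'\<Omega> z0])
    have dp: "(p has_real_derivative deriv \<theta> (x / \<epsilon>)) (at x)" for x
    proof -
      have "((\<lambda>x. \<theta> (x / \<epsilon>)) has_real_derivative deriv \<theta> (x / \<epsilon>) * (1 / \<epsilon>)) (at x)"
        by (rule DERIV_chain2[OF smooth_deriv(1)[OF \<theta>(1)]]) (use \<epsilon> in \<open>auto intro!: derivative_eq_intros\<close>)
      then have "((\<lambda>x. \<epsilon> * \<theta> (x / \<epsilon>)) has_real_derivative \<epsilon> * (deriv \<theta> (x / \<epsilon>) * (1 / \<epsilon>))) (at x)"
        by (rule DERIV_cmult)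
      then show ?thesis using \<epsilon> by (simp add: p_def[abs_def])
    qed
    have dz: "deriv z x = deriv g (p x) * deriv \<theta> (x / \<epsilon>)" for x
      unfolding z_def by (rule DERIV_imp_deriv[OF DERIV_chain2[OF smooth_deriv(1)[OF gs] dp]])
    show "\<exists>z\<in>test_functions \<Omega>. L2_norm \<Omega> (\<lambda>x. z x - g x) \<le> C * \<epsilon> \<and>
       dirichlet_form (coefficient (\<epsilon>\<^sup>2) \<Omega> S \<epsilon>) z z \<le> (C * \<epsilon>)\<^sup>2"
    proof (intro bexI[OF _ zt] conjI)
      have "L2_inner \<Omega> (\<lambda>x. z x - g x) (\<lambda>x. z x - g x) \<le> 2 * (R + 1) * (G * \<epsilon>)\<^sup>2"
      proof (rule L2_inner_bounded_support)
        show "\<bar>z x - g x\<bar> \<le> G * \<epsilon>" for x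
          using smooth_lipschitz[OF gs G(2), of "p x" x] mult_left_mono[OF px[of x] G(1)] by (simp add: z_def)
        show "z x - g x = 0" if "x \<notin> {-(R+1)..R+1}" for x
        proof -
          have "x \<notin> K'" "x \<notin> K" using that K'R R by auto
          then show ?thesis using z0 K(3) by simp
        qed
      qed (use R in auto)
      also have "\<dots> \<le> (C * \<epsilon>)\<^sup>2" using G M \<epsilon> by (intro sqC) (auto simp: distrib_left)
      finally show "L2_norm \<Omega> (\<lambda>x. z x - g x) \<le> C * \<epsilon>"
        unfolding L2_norm_def using C0 \<epsilon> by (intro real_le_lsqrt) auto
      have \<epsilon>1: "\<epsilon> \<le> 1" using \<epsilon> by simp
      note co = coefficient_properties[OF open_\<Omega> S(1) \<epsilon>(1) \<epsilon>1]
      have dzt: "deriv z \<in> test_functions \<Omega>" by (rule test_functions_deriv[OF zt])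
      have "dirichlet_form (coefficient (\<epsilon>\<^sup>2) \<Omega> S \<epsilon>) z z =
          L2_inner \<Omega> (\<lambda>x. coefficient (\<epsilon>\<^sup>2) \<Omega> S \<epsilon> x * deriv z x) (deriv z)"
        unfolding dirichlet_form_def
      proof (rule L2_inner_AE_cong)
        have ae: "AE x in lebesgue_on \<Omega>. weak_deriv \<Omega> z x = deriv z x"
          by (rule weak_deriv_AE[OF test_functions_weak_deriv[OF zt]])
        then show "AE x in lebesgue_on \<Omega>. weak_deriv \<Omega> z x = deriv z x" .
        show "AE x in lebesgue_on \<Omega>. coefficient (\<epsilon>\<^sup>2) \<Omega> S \<epsilon> x * weak_deriv \<Omega> z x = coefficient (\<epsilon>\<^sup>2) \<Omega> S \<epsilon> x * deriv z x"
          using ae by eventually_elim simp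
      qed (rule weighted_L2[OF co] H1_L2(2)[OF test_functions_H1[OF zt]] test_L2[OF dzt])+
      \<comment> \<open>Where \<open>z\<close> has nonzero slope the staircase moves, so the point
        lies in the periodic set and the coefficient is \<epsilon> squared; elsewhere both
        integrands are 0.\<close>
      also have "\<dots> = L2_inner \<Omega> (\<lambda>x. \<epsilon> * deriv z x) (\<lambda>x. \<epsilon> * deriv z x)"
        unfolding L2_inner_def
      proof (rule Bochner_Integration.integral_cong[OF refl])
        fix x assume "x \<in> space (lebesgue_on \<Omega>)"
        then have x: "x \<in> \<Omega>" by simp
        show "coefficient (\<epsilon>\<^sup>2) \<Omega> S \<epsilon> x * deriv z x * deriv z x = \<epsilon> * deriv z x * (\<epsilon> * deriv z x)"
        proof (cases "deriv z x = 0")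
          case False
          then obtain j :: int where j: "x / \<epsilon> - of_int j \<in> S" using \<theta>(2)[of "x / \<epsilon>"] dz by auto
          have "x = \<epsilon> * (of_int j + (x / \<epsilon> - of_int j))" using \<epsilon> by simp
          then have "x \<in> periodic_set \<Omega> S \<epsilon>" using x j unfolding periodic_set_def by blast
          then show ?thesis by (simp add: coefficient_def power2_eq_square)
        qed simp
      qed
      also have "\<dots> \<le> 2 * (R + 1) * (G * M * \<epsilon>)\<^sup>2"
      proof (rule L2_inner_bounded_support)
        show "\<bar>\<epsilon> * deriv z x\<bar> \<le> G * M * \<epsilon>" for x
        proof -
          have "\<bar>deriv z x\<bar> \<le> G * M" unfolding dz abs_mult by (intro mult_mono G M) auto
          then show ?thesis using \<epsilon> by (simp add: abs_mult mult.commute)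
        qed
        show "\<epsilon> * deriv z x = 0" if "x \<notin> {-(R+1)..R+1}" for x
        proof -
          have "p x \<notin> K" using that K'R by (auto simp: K'_def)
          then show ?thesis using K(4) by (simp add: dz)
        qed
      qed (use R in auto)
      also have "\<dots> \<le> (C * \<epsilon>)\<^sup>2" using G M \<epsilon> by (intro sqC) (auto simp: distrib_left)
      finally show "dirichlet_form (coefficient (\<epsilon>\<^sup>2) \<Omega> S \<epsilon>) z z \<le> (C * \<epsilon>)\<^sup>2" .
    qed
  qed (use \<delta> in auto)
qed

text \<open>The form bound concerns \<open>z\<close> alone, and \<open>z\<close> has to be close to
  \<open>g\<close> only in L2. Replacing \<open>g\<close> by a nearby test function therefore
  affects nothing but the distance, which is split into two halves of \<open>e\<close>.\<close>

lemma corrector_H1_0: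
  assumes S: "open S" "S \<noteq> {}" and g: "g \<in> H1_0 \<Omega>" and e: "e > 0"
  obtains \<epsilon>\<^sub>0 where "\<epsilon>\<^sub>0 > 0" "\<epsilon>\<^sub>0 \<le> 1"
    "\<And>\<epsilon>. 0 < \<epsilon> \<Longrightarrow> \<epsilon> \<le> \<epsilon>\<^sub>0 \<Longrightarrow> \<exists>z\<in>H1_0 \<Omega>. L2_norm \<Omega> (\<lambda>x. z x - g x) \<le> e \<and>
       dirichlet_form (coefficient (\<epsilon>\<^sup>2) \<Omega> S \<epsilon>) z z \<le> e\<^sup>2"
proof -
  obtain \<phi> where \<phi>: "\<phi> \<in> test_functions \<Omega>" "L2_norm \<Omega> (\<lambda>x. \<phi> x - g x) < e / 2"
    using H1_0_L2_approx[OF g, of "e / 2"] e by auto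
  obtain C \<epsilon>\<^sub>1 where C: "C > 0" "\<epsilon>\<^sub>1 > 0" "\<epsilon>\<^sub>1 \<le> 1"
    "\<And>\<epsilon>. 0 < \<epsilon> \<Longrightarrow> \<epsilon> \<le> \<epsilon>\<^sub>1 \<Longrightarrow> \<exists>z\<in>test_functions \<Omega>. L2_norm \<Omega> (\<lambda>x. z x - \<phi> x) \<le> C * \<epsilon> \<and>
       dirichlet_form (coefficient (\<epsilon>\<^sup>2) \<Omega> S \<epsilon>) z z \<le> (C * \<epsilon>)\<^sup>2"
    by (rule corrector_exists[OF S \<phi>(1)]; rule that; assumption)
  show ?thesis
  proof (rule that[of "min \<epsilon>\<^sub>1 (e / (2 * C))"])
    fix \<epsilon> assume \<epsilon>: "0 < \<epsilon>" "\<epsilon> \<le> min \<epsilon>\<^sub>1 (e / (2 * C))"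
    then obtain z where z: "z \<in> test_functions \<Omega>" "L2_norm \<Omega> (\<lambda>x. z x - \<phi> x) \<le> C * \<epsilon>"
      "dirichlet_form (coefficient (\<epsilon>\<^sup>2) \<Omega> S \<epsilon>) z z \<le> (C * \<epsilon>)\<^sup>2"
      using C(4)[of \<epsilon>] by auto
    have Ce: "C * \<epsilon> \<le> e / 2" using \<epsilon> C(1) by (simp add: field_simps)
    have "L2_norm \<Omega> (\<lambda>x. (z x - \<phi> x) + (\<phi> x - g x)) \<le> L2_norm \<Omega> (\<lambda>x. z x - \<phi> x) + L2_norm \<Omega> (\<lambda>x. \<phi> x - g x)"
      using z \<phi> g by (intro L2n.triangle L2.diff_mem test_L2 H1_0_L2)
    then have "L2_norm \<Omega> (\<lambda>x. z x - g x) \<le> e" using z(2) \<phi>(2) Ce by simp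
    moreover have "(C * \<epsilon>)\<^sup>2 \<le> e\<^sup>2" using Ce \<epsilon> C e by (intro power_mono) auto
    ultimately show "\<exists>z\<in>H1_0 \<Omega>. L2_norm \<Omega> (\<lambda>x. z x - g x) \<le> e \<and>
       dirichlet_form (coefficient (\<epsilon>\<^sup>2) \<Omega> S \<epsilon>) z z \<le> e\<^sup>2"
      using z test_functions_H1_0 by (intro bexI[of _ z]) auto
  qed (use C e in \<open>auto simp: min_le_iff_disj\<close>)
qed

section \<open>Passage from weak to strong convergence\<close>

lemma integral_time_linear:
  assumes "0 \<le> t" shows "(LINT s|time_measure t. c + s * d) = t * c + t\<^sup>2 / 2 * d"
    "integrable (time_measure t) (\<lambda>s. c + s * d :: real)"
proof -
  show i: "integrable (time_measure t) (\<lambda>s. c + s * d)"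
    by (intro continuous_integrable_Ioo continuous_intros)
  have "((\<lambda>s. s * c + s\<^sup>2 / 2 * d) has_real_derivative c + s * d) (at s within {0..t})" for s
    by (auto intro!: derivative_eq_intros)
  then have "((\<lambda>s. c + s * d) has_integral (t * c + t\<^sup>2 / 2 * d) - (0 * c + 0\<^sup>2 / 2 * d)) {0..t}"
    using assms by (intro fundamental_theorem_of_calculus[where f="\<lambda>s. s * c + s\<^sup>2 / 2 * d"])
      (simp_all only: has_real_derivative_iff_has_vector_derivative)
  from integral_unique[OF this] show "(LINT s|time_measure t. c + s * d) = t * c + t\<^sup>2 / 2 * d"
    using lint_Ioo_eq_integral(1)[OF i] by simp
qed

text \<open>Weak convergence together with \<open>limsup \<parallel>w\<parallel> \<le> \<parallel>u0 + t v0\<parallel>\<close>, which is the energy inequality,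
  gives strong convergence.\<close>

lemma wave_strong_estimate:
  assumes T: "T > 0" and u0: "u0 \<in> L2 \<Omega>" and v0: "v0 \<in> L2 \<Omega>"
    and wX: "\<And>t. t \<in> {0..T} \<Longrightarrow> w t \<in> L2 \<Omega>"
    and cont: "continuous_on {0..T} (\<lambda>t. L2_inner \<Omega> (w t) v0)"
    and energy: "\<And>t. t \<in> {0..T} \<Longrightarrow> L2_inner \<Omega> (w t) (w t) \<le> L2_inner \<Omega> u0 u0 + 2 * (LINT s|time_measure t. L2_inner \<Omega> (w s) v0)"
    and weak: "\<And>t g. t \<in> {0..T} \<Longrightarrow> g = u0 \<or> g = v0 \<Longrightarrow> \<bar>L2_inner \<Omega> (w t) g - L2_inner \<Omega> u0 g - t * L2_inner \<Omega> v0 g\<bar> \<le> e"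
    and t: "t \<in> {0..T}"
  shows "(L2_norm \<Omega> (\<lambda>x. w t x - (u0 x + v0 x * t)))\<^sup>2 \<le> (2 + 4 * T) * e"
proof -
  define h where "h x = u0 x + t * v0 x" for x
  have hL: "h \<in> L2 \<Omega>" unfolding h_def by (intro L2.add_mem L2.scale_mem u0 v0)
  define a where "a = L2_inner \<Omega> u0 u0"
  define b where "b = L2_inner \<Omega> u0 v0"
  define c where "c = L2_inner \<Omega> v0 v0"
  have ba: "L2_inner \<Omega> v0 u0 = b" unfolding b_def by (rule L2.sym[OF v0 u0])
  have e0: "0 \<le> e" using weak[of 0 u0] T by auto
  have hh: "L2_inner \<Omega> h h = a + 2 * t * b + t\<^sup>2 * c"
    unfolding h_def a_def b_def c_def by (rule L2.ip_square_add[OF u0 v0])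
  have wh: "L2_inner \<Omega> (w t) h = L2_inner \<Omega> (w t) u0 + t * L2_inner \<Omega> (w t) v0"
    unfolding h_def using wX[OF t] u0 v0 by (simp add: L2.add_right L2.scale_right L2.scale_mem)
  have int: "(LINT s|time_measure t. L2_inner \<Omega> (w s) v0) \<le> t * b + t\<^sup>2 / 2 * c + T * e"
  proof -
    have "(LINT s|time_measure t. L2_inner \<Omega> (w s) v0) \<le> (LINT s|time_measure t. (b + e) + s * c)"
    proof (rule integral_mono)
      show "integrable (time_measure t) (\<lambda>s. L2_inner \<Omega> (w s) v0)"
        using continuous_integrable_Ioo[OF cont] by (rule time_integrable_mono) (use t in simp)
      show "integrable (time_measure t) (\<lambda>s. (b + e) + s * c)" using t by (intro integral_time_linear) simp
      fix s assume "s \<in> space (time_measure t)"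
      then have "s \<in> {0..T}" using t by auto
      from weak[OF this, of v0] show "L2_inner \<Omega> (w s) v0 \<le> (b + e) + s * c"
        by (simp add: b_def c_def)
    qed
    also have "\<dots> = t * (b + e) + t\<^sup>2 / 2 * c" using t by (intro integral_time_linear) simp
    also have "\<dots> \<le> t * b + t\<^sup>2 / 2 * c + T * e"
      using t mult_right_mono[OF _ e0, of t T] by (simp add: algebra_simps)
    finally show ?thesis .
  qed
  have wu0: "L2_inner \<Omega> (w t) u0 \<ge> a + t * b - e" using weak[OF t, of u0] by (simp add: a_def ba)
  have wv0: "L2_inner \<Omega> (w t) v0 \<ge> b + t * c - e" using weak[OF t, of v0] by (simp add: b_def c_def)
  have "t * (b + t * c - e) \<le> t * L2_inner \<Omega> (w t) v0" using wv0 t by (intro mult_left_mono) auto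
  moreover have "t * e \<le> T * e" using t e0 by (intro mult_right_mono) auto
  ultimately have wv0': "t * L2_inner \<Omega> (w t) v0 \<ge> t * b + t\<^sup>2 * c - T * e"
    by (simp add: algebra_simps power2_eq_square)
  have "(L2_norm \<Omega> (\<lambda>x. w t x - (u0 x + v0 x * t)))\<^sup>2 = L2_inner \<Omega> (\<lambda>x. w t x + (-1) * h x) (\<lambda>x. w t x + (-1) * h x)"
  proof -
    have "(\<lambda>x. w t x - (u0 x + v0 x * t)) = (\<lambda>x. w t x + (-1) * h x)"
      by (auto simp: h_def fun_eq_iff mult.commute)
    then show ?thesis by (simp only: L2_norm_square)
  qed
  also have "\<dots> = L2_inner \<Omega> (w t) (w t) - 2 * L2_inner \<Omega> (w t) h + L2_inner \<Omega> h h"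
    using L2.ip_square_add[OF wX[OF t] hL, of "-1"] by simp
  \<comment> \<open>The main terms in \<open>a\<close>, \<open>b\<close> and \<open>c\<close>
    cancel. Of the errors, \<open>2 T e\<close> comes from the energy inequality and
    \<open>2 e + 2 T e\<close> from the doubled cross term.\<close>
  also have "\<dots> \<le> (2 + 4 * T) * e"
    using energy[OF t] int wu0 wv0' unfolding wh hh by (simp add: a_def[symmetric] algebra_simps)
  finally show ?thesis .
qed

text \<open>The strong estimate asks for the weak one only against \<open>u0\<close> and
  \<open>v0\<close>, so correctors for these two functions suffice. All bounds are uniform in time,
  hence one threshold serves almost every time.\<close>

lemma wave_strong_convergence:
  assumes T: "T > 0" and S: "open S" "S \<noteq> {}" and u0: "u0 \<in> H1_0 \<Omega>" and v0: "v0 \<in> H1_0 \<Omega>" and \<eta>: "\<eta> > 0"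
    and sol: "\<And>\<epsilon>. 0 < \<epsilon> \<Longrightarrow> \<epsilon> \<le> 1 \<Longrightarrow>
           weak_wave_solution T \<Omega> (coefficient (\<epsilon>\<^sup>2) \<Omega> S \<epsilon>) (\<lambda>t x. 0) u0 v0 (u \<epsilon>)"
  obtains \<epsilon>\<^sub>0 where "0 < \<epsilon>\<^sub>0" "\<epsilon>\<^sub>0 \<le> 1"
    "\<And>\<epsilon>. 0 < \<epsilon> \<Longrightarrow> \<epsilon> \<le> \<epsilon>\<^sub>0 \<Longrightarrow> AE t in time_measure T. L2_norm \<Omega> (\<lambda>x. u \<epsilon> t x - (u0 x + v0 x * t)) \<le> \<eta>"
proof -
  note uL = H1_0_L2[OF u0] and vL = H1_0_L2[OF v0]
  define R where "R = solution_bound T u0 v0"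
  define Q where "Q = L2_norm \<Omega> u0 + T * L2_norm \<Omega> v0"
  have nn: "0 \<le> L2_norm \<Omega> u0" "0 \<le> L2_norm \<Omega> v0" using uL vL by (auto intro: L2n.nonneg)
  have R0: "0 \<le> R" and Q0: "0 \<le> Q" using nn T by (auto simp: R_def Q_def solution_bound_def)
  \<comment> \<open>\<open>T * R\<close> is the error of the equation tested with a corrector.
    \<open>R + Q\<close> bounds the deviation of \<open>w t\<close> from its limit, which is paired
    with the corrector error. The summand 1 gives positivity, and \<open>e\<close> is then chosen so
    that \<open>(2 + 4 * T) * (\<kappa> * e)\<close> equals the square of \<eta>.\<close>
  define \<kappa> where "\<kappa> = T * R + (R + Q) + 1"
  have \<kappa>: "\<kappa> > 0" unfolding \<kappa>_def using T R0 Q0 by (simp add: add_nonneg_pos)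
  define e where "e = \<eta>\<^sup>2 / ((2 + 4 * T) * \<kappa>)"
  have e: "e > 0" unfolding e_def using \<eta> T \<kappa> by simp
  obtain \<epsilon>\<^sub>1 where \<epsilon>1: "\<epsilon>\<^sub>1 > 0" "\<epsilon>\<^sub>1 \<le> 1"
    "\<And>\<epsilon>. 0 < \<epsilon> \<Longrightarrow> \<epsilon> \<le> \<epsilon>\<^sub>1 \<Longrightarrow> \<exists>z\<in>H1_0 \<Omega>. L2_norm \<Omega> (\<lambda>x. z x - u0 x) \<le> e \<and>
       dirichlet_form (coefficient (\<epsilon>\<^sup>2) \<Omega> S \<epsilon>) z z \<le> e\<^sup>2"
    by (rule corrector_H1_0[OF S u0 e]; rule that; assumption)
  obtain \<epsilon>\<^sub>2 where \<epsilon>2: "\<epsilon>\<^sub>2 > 0" "\<epsilon>\<^sub>2 \<le> 1"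
    "\<And>\<epsilon>. 0 < \<epsilon> \<Longrightarrow> \<epsilon> \<le> \<epsilon>\<^sub>2 \<Longrightarrow> \<exists>z\<in>H1_0 \<Omega>. L2_norm \<Omega> (\<lambda>x. z x - v0 x) \<le> e \<and>
       dirichlet_form (coefficient (\<epsilon>\<^sup>2) \<Omega> S \<epsilon>) z z \<le> e\<^sup>2"
    by (rule corrector_H1_0[OF S v0 e]; rule that; assumption)
  show ?thesis
  proof (rule that[of "min \<epsilon>\<^sub>1 \<epsilon>\<^sub>2"])
    fix \<epsilon> assume \<epsilon>: "0 < \<epsilon>" "\<epsilon> \<le> min \<epsilon>\<^sub>1 \<epsilon>\<^sub>2"
    then have le1: "\<epsilon> \<le> 1" using \<epsilon>1(2) by simp
    let ?a = "coefficient (\<epsilon>\<^sup>2) \<Omega> S \<epsilon>"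
    note co = coefficient_properties[OF open_\<Omega> S(1) \<epsilon>(1) le1]
    obtain w where wX: "\<And>t. t \<in> {0..T} \<Longrightarrow> w t \<in> L2 \<Omega>"
      and wu: "AE t in time_measure T. L2_norm \<Omega> (\<lambda>b. w t b - u \<epsilon> t b) = 0"
      and cont: "\<And>v. v \<in> L2 \<Omega> \<Longrightarrow> continuous_on {0..T} (\<lambda>t. L2_inner \<Omega> (w t) v)"
      and wR: "\<And>t. t \<in> {0..T} \<Longrightarrow> L2_norm \<Omega> (w t) \<le> solution_bound T u0 v0"
      and energy: "\<And>t. t \<in> {0..T} \<Longrightarrow> L2_inner \<Omega> (w t) (w t) \<le> L2_inner \<Omega> u0 u0 + 2 * (LINT s|time_measure t. L2_inner \<Omega> (w s) v0)"
      and weakz: "\<And>z t. z \<in> H1_0 \<Omega> \<Longrightarrow> t \<in> {0..T} \<Longrightarrow> \<bar>L2_inner \<Omega> (w t) z - L2_inner \<Omega> u0 z - t * L2_inner \<Omega> v0 z\<bar>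
        \<le> T * (solution_bound T u0 v0 * sqrt (dirichlet_form ?a z z))"
      by (rule wave_estimates[OF T co uL vL sol[OF \<epsilon>(1) le1]]; rule that; assumption)
    have weak: "\<bar>L2_inner \<Omega> (w t) g - L2_inner \<Omega> u0 g - t * L2_inner \<Omega> v0 g\<bar> \<le> \<kappa> * e"
      if t: "t \<in> {0..T}" and g: "g = u0 \<or> g = v0" for t g
    proof -
      have gL: "g \<in> L2 \<Omega>" using g uL vL by auto
      obtain z where z: "z \<in> H1_0 \<Omega>" "L2_norm \<Omega> (\<lambda>x. z x - g x) \<le> e" "dirichlet_form ?a z z \<le> e\<^sup>2"
        using g \<epsilon>1(3)[of \<epsilon>] \<epsilon>2(3)[of \<epsilon>] \<epsilon> by auto
      note zL = H1_0_L2[OF z(1)]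
      define d where "d x = w t x - (u0 x + t * v0 x)" for x
      have hL: "(\<lambda>x. u0 x + t * v0 x) \<in> L2 \<Omega>" by (intro L2.add_mem L2.scale_mem uL vL)
      have dL: "d \<in> L2 \<Omega>" unfolding d_def by (intro L2.diff_mem wX t hL)
      have dv: "L2_inner \<Omega> d v = L2_inner \<Omega> (w t) v - L2_inner \<Omega> u0 v - t * L2_inner \<Omega> v0 v" if "v \<in> L2 \<Omega>" for v
        unfolding d_def using that wX[OF t] uL vL hL
        by (simp add: L2.diff_left L2.add_left L2.scale_left L2.scale_mem)
      have "L2_norm \<Omega> (\<lambda>x. u0 x + t * v0 x) \<le> L2_norm \<Omega> u0 + t * L2_norm \<Omega> v0"
        using L2n.triangle[OF uL L2.scale_mem[OF vL, of t]] L2n.abs_scale[OF vL, of t] t by simp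
      also have "\<dots> \<le> Q" unfolding Q_def using t nn by (intro add_left_mono mult_right_mono) auto
      finally have dn: "L2_norm \<Omega> d \<le> R + Q"
        unfolding d_def using L2n.triangle_diff[OF wX[OF t] hL] wR[OF t] by (simp add: R_def)
      have "L2_inner \<Omega> d g = L2_inner \<Omega> d z - L2_inner \<Omega> d (\<lambda>x. z x - g x)"
        using dL zL gL by (simp add: L2.diff_right)
      also have "\<bar>\<dots>\<bar> \<le> \<bar>L2_inner \<Omega> d z\<bar> + \<bar>L2_inner \<Omega> d (\<lambda>x. z x - g x)\<bar>" by (rule abs_triangle_ineq4)
      also have "\<bar>L2_inner \<Omega> d z\<bar> \<le> T * (R * e)"
      proof -
        have "\<bar>L2_inner \<Omega> d z\<bar> \<le> T * (R * sqrt (dirichlet_form ?a z z))"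
          unfolding dv[OF zL] R_def by (rule weakz[OF z(1) t])
        also have "\<dots> \<le> T * (R * e)"
          using T R0 e z(3) by (intro mult_left_mono real_le_lsqrt) auto
        finally show ?thesis .
      qed
      also have "\<bar>L2_inner \<Omega> d (\<lambda>x. z x - g x)\<bar> \<le> (R + Q) * e"
      proof -
        have "\<bar>L2_inner \<Omega> d (\<lambda>x. z x - g x)\<bar> \<le> L2_norm \<Omega> d * L2_norm \<Omega> (\<lambda>x. z x - g x)"
          by (intro L2_cauchy_schwarz dL L2.diff_mem zL gL)
        also have "\<dots> \<le> (R + Q) * e"
          by (intro mult_mono dn z(2) L2n.nonneg L2.diff_mem zL gL) (use R0 Q0 in simp)
        finally show ?thesis .
      qed
      also have "T * (R * e) + (R + Q) * e \<le> \<kappa> * e" unfolding \<kappa>_def using e by (simp add: algebra_simps)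
      finally show ?thesis by (simp add: dv[OF gL])
    qed
    have close: "L2_norm \<Omega> (\<lambda>x. w t x - (u0 x + v0 x * t)) \<le> \<eta>" if t: "t \<in> {0..T}" for t
    proof -
      have "(L2_norm \<Omega> (\<lambda>x. w t x - (u0 x + v0 x * t)))\<^sup>2 \<le> (2 + 4 * T) * (\<kappa> * e)"
        by (rule wave_strong_estimate[OF T uL vL wX cont[OF vL] energy weak t])
      also have "\<dots> = \<eta>\<^sup>2"
      proof -
        define q where "q = (2 + 4 * T) * \<kappa>"
        have "q > 0" unfolding q_def using \<kappa> T by (intro mult_pos_pos) auto
        then have "q * (\<eta>\<^sup>2 / q) = \<eta>\<^sup>2" by simp
        then show ?thesis unfolding e_def q_def by (simp only: mult.assoc)
      qed
      finally show ?thesis by (rule power2_le_imp_le) (use \<eta> in simp)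
    qed
    have "AE t in time_measure T. u \<epsilon> t \<in> H1_0 \<Omega>"
      using sol[OF \<epsilon>(1) le1] by (simp add: weak_wave_solution_def bochner_L2_def)
    with wu AE_space show "AE t in time_measure T. L2_norm \<Omega> (\<lambda>x. u \<epsilon> t x - (u0 x + v0 x * t)) \<le> \<eta>"
    proof eventually_elim
      case (elim t)
      then have t: "t \<in> {0..T}" and ut: "u \<epsilon> t \<in> L2 \<Omega>" using H1_0_L2 by auto
      have hL: "(\<lambda>x. u0 x + v0 x * t) \<in> L2 \<Omega>"
        using L2.add_mem[OF uL L2.scale_mem[OF vL, of t]] by (simp add: mult.commute)
      have "L2_norm \<Omega> (\<lambda>x. (u \<epsilon> t x - w t x) + (w t x - (u0 x + v0 x * t))) \<le>
          L2_norm \<Omega> (\<lambda>x. u \<epsilon> t x - w t x) + L2_norm \<Omega> (\<lambda>x. w t x - (u0 x + v0 x * t))"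
        by (intro L2n.triangle L2.diff_mem ut wX t hL)
      moreover have "L2_norm \<Omega> (\<lambda>x. u \<epsilon> t x - w t x) = 0"
        using L2n.norm_minus_commute[OF ut wX[OF t]] elim(1) by simp
      moreover have "(\<lambda>x. (u \<epsilon> t x - w t x) + (w t x - (u0 x + v0 x * t))) = (\<lambda>x. u \<epsilon> t x - (u0 x + v0 x * t))"
        by (simp add: fun_eq_iff)
      ultimately show ?case using close[OF t] by simp
    qed
  qed (use \<epsilon>1 \<epsilon>2 in auto)
qed

end


subsection \<open>Oscillating test functions\<close>

text \<open>A primitive of a periodic function has the same increment over every interval of length
  1, because the derivative of this increment is 0.\<close>

lemma integral_periodic_shift:
  fixes q :: "real \<Rightarrow> real"
  assumes c: "continuous_on UNIV q" and per: "\<And>y. q (y + 1) = q y"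
  shows "(LINT s|time_measure 1. q (c + s)) = (LINT s|time_measure 1. q s)"
proof -
  obtain Q where Q: "\<And>x. (Q has_real_derivative q x) (at x)" using antiderivative_exists[OF c] by blast
  have FTC: "(LINT s|time_measure 1. q (c + s)) = Q (c + 1) - Q c" for c
  proof -
    have i: "integrable (time_measure 1) (\<lambda>s. q (c + s))"
      by (intro continuous_integrable_Ioo continuous_on_compose2[OF c] continuous_intros) auto
    have "((\<lambda>s. Q (c + s)) has_real_derivative q (c + s) * 1) (at s)" for s
      by (rule DERIV_chain2[OF Q]) (auto intro!: derivative_eq_intros)
    then have "((\<lambda>s. Q (c + s)) has_vector_derivative q (c + s)) (at s within {0..1})" for s
      by (simp add: has_real_derivative_iff_has_vector_derivative has_vector_derivative_at_within)
    then have "((\<lambda>s. q (c + s)) has_integral Q (c + 1) - Q (c + 0)) {0..1}"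
      by (intro fundamental_theorem_of_calculus[where f="\<lambda>s. Q (c + s)"]) auto
    from integral_unique[OF this] lint_Ioo_eq_integral(1)[OF i] show ?thesis by simp
  qed
  have "((\<lambda>x. Q (x + 1) - Q x) has_real_derivative 0) (at x)" for x
  proof -
    have "((\<lambda>x. Q (x + 1)) has_real_derivative q (x + 1) * 1) (at x)"
      by (rule DERIV_chain2[OF Q]) (auto intro!: derivative_eq_intros)
    then show ?thesis using Q[of x] per[of x] by (auto intro!: derivative_eq_intros)
  qed
  then have "Q (c + 1) - Q c = Q (0 + 1) - Q 0"
    using DERIV_isconst_all[of "\<lambda>x. Q (x + 1) - Q x"] by blast
  then show ?thesis using FTC[of c] FTC[of 0] by simp
qed

lemma sigma_finite_lebesgue_on:
  "A \<in> sets lebesgue \<Longrightarrow> sigma_finite_measure (lebesgue_on (A :: 'a::euclidean_space set))"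
  by (rule sigma_finite_measure_restrict_space[OF sigma_finite_lebesgue])

lemma borel_measurable_lebesgue_on_id: "(\<lambda>x::'a::euclidean_space. x) \<in> borel_measurable (lebesgue_on A)"
  by (intro measurable_restrict_space1 measurable_completion) simp

text \<open>The integral over \<open>x\<close> is invariant under the shift by \<open>\<epsilon> s\<close>. Averaging over \<open>s \<in> (0,1)\<close>
  turns the oscillating argument \<open>x / \<epsilon>\<close> into the free variable \<open>x / \<epsilon> + s\<close>.\<close>

lemma oscillation_average:
  fixes h :: "real \<Rightarrow> real \<Rightarrow> real"
  assumes c: "continuous_on UNIV (\<lambda>p. h (fst p) (snd p))"
    and per: "\<And>x y. h x (y + 1) = h x y"
    and supp: "\<And>x y. x \<notin> {-R..R} \<Longrightarrow> h x y = 0" and R: "R \<ge> 0"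
    and B: "\<And>x y. \<bar>h x y\<bar> \<le> B"
    and mod: "\<And>x x' y. \<bar>x - x'\<bar> \<le> \<epsilon> \<Longrightarrow> \<bar>h x y - h x' y\<bar> \<le> e"
    and \<epsilon>: "0 < \<epsilon>" "\<epsilon> \<le> 1"
  shows "\<bar>(LINT x|lebesgue. h x (x / \<epsilon>)) - (LINT x|lebesgue. LINT y|time_measure 1. h x y)\<bar> \<le> 2 * (R + 1) * e"
proof -
  have e0: "0 \<le> e" using mod[of 0 0 0] \<epsilon> by simp
  have B0: "0 \<le> B" using B[of 0 0] by simp
  have hc: "continuous_on A (\<lambda>x. h (f x) (g x))" if "continuous_on A f" "continuous_on A g" for A :: "'c::topological_space set" and f g
    using continuous_on_compose2[OF c continuous_on_Pair[OF that]] by simp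
  have meas: "(\<lambda>x. h (f x) (g x)) \<in> borel_measurable lebesgue" if "continuous_on UNIV f" "continuous_on UNIV g" for f g :: "real \<Rightarrow> real"
    using that by (intro measurable_completion) (simp add: borel_measurable_continuous_onI hc)
  have bm: "f \<in> borel_measurable lborel" if "continuous_on UNIV f" for f :: "real \<Rightarrow> real"
    using borel_measurable_continuous_onI[OF that] by simp
  define k where "k s = (LINT x|lebesgue. h x (x / \<epsilon> + s))" for s
  have ki: "integrable lebesgue (\<lambda>x. h (x + d) (x / \<epsilon> + s))" if "\<bar>d\<bar> \<le> 1" for s d
  proof -
    have "integrable (lebesgue_on UNIV) (\<lambda>x. h (x + d) (x / \<epsilon> + s))"
    proof (rule integral_lebesgue_on_bound(1)[where B=B and \<rho>="R + 1"])
      show "h (x + d) (x / \<epsilon> + s) = 0" if "x \<notin> {-(R+1)..R+1}" for x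
        using that \<open>\<bar>d\<bar> \<le> 1\<close> by (intro supp) auto
      show "(\<lambda>x. h (x + d) (x / \<epsilon> + s)) \<in> borel_measurable (lebesgue_on UNIV)"
        unfolding lebesgue_on_UNIV_eq by (intro meas continuous_intros) (use \<epsilon> in auto)
    qed (use B R B0 in auto)
    then show ?thesis by (simp add: lebesgue_on_UNIV_eq)
  qed
  have close: "\<bar>(LINT x|lebesgue. h x (x / \<epsilon>)) - k s\<bar> \<le> 2 * (R + 1) * e" if s: "0 < s" "s < 1" for s
  proof -
    \<comment> \<open>Translation by \<open>\<epsilon> * s\<close> moves the fast variable by
      exactly \<open>s\<close> and the slow one by at most \<epsilon>. Only the slow displacement
      costs anything, namely \<open>e\<close>, uniformly in the fast variable.\<close>
    have shift: "(LINT x|lebesgue. h x (x / \<epsilon>)) = (LINT x|lebesgue. h (x + \<epsilon> * s) (x / \<epsilon> + s))"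
    proof -
      have m: "(\<lambda>x. h x (x / \<epsilon>)) \<in> borel_measurable lborel" "(\<lambda>x. h (x + \<epsilon> * s) (x / \<epsilon> + s)) \<in> borel_measurable lborel"
        by ((rule bm, intro hc continuous_intros; use \<epsilon> in simp)+)
      have "(LINT x|lborel. h x (x / \<epsilon>)) = (LINT x|lborel. h (\<epsilon> * s + 1 * x) ((\<epsilon> * s + 1 * x) / \<epsilon>))"
        using lborel_integral_real_affine[of 1 "\<lambda>x. h x (x / \<epsilon>)" "\<epsilon> * s"] by simp
      also have "\<dots> = (LINT x|lborel. h (x + \<epsilon> * s) (x / \<epsilon> + s))"
        using \<epsilon> by (simp add: add_divide_distrib add.commute)
      finally show ?thesis using m by (simp add: integral_completion)
    qed
    have es: "\<bar>\<epsilon> * s\<bar> \<le> \<epsilon>" "\<bar>\<epsilon> * s\<bar> \<le> 1"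
    proof -
      show "\<bar>\<epsilon> * s\<bar> \<le> \<epsilon>" using s \<epsilon> mult_left_mono[of s 1 \<epsilon>] by (simp add: abs_mult)
      then show "\<bar>\<epsilon> * s\<bar> \<le> 1" using \<epsilon> by simp
    qed
    have "(LINT x|lebesgue. h x (x / \<epsilon>)) - k s = (LINT x|lebesgue. h (x + \<epsilon> * s) (x / \<epsilon> + s) - h x (x / \<epsilon> + s))"
      unfolding shift k_def using ki[of "\<epsilon> * s" s] ki[of 0 s] es by simp
    also have "\<dots> = (LINT x|lebesgue_on UNIV. h (x + \<epsilon> * s) (x / \<epsilon> + s) - h x (x / \<epsilon> + s))"
      by (simp add: lebesgue_on_UNIV_eq)
    also have "\<bar>\<dots>\<bar> \<le> 2 * (R + 1) * e"
    proof (rule integral_lebesgue_on_bound(2))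
      show "\<bar>h (x + \<epsilon> * s) (x / \<epsilon> + s) - h x (x / \<epsilon> + s)\<bar> \<le> e" for x
        using es by (intro mod) simp
      show "h (x + \<epsilon> * s) (x / \<epsilon> + s) - h x (x / \<epsilon> + s) = 0" if "x \<notin> {-(R+1)..R+1}" for x
      proof -
        have "x \<notin> {-R..R}" "x + \<epsilon> * s \<notin> {-R..R}" using that es by auto
        then show ?thesis using supp by simp
      qed
    qed (use R e0 in auto)
    finally show ?thesis .
  qed
  have one: "(LINT s|time_measure 1. c) = c" for c :: real by (simp add: measure_restrict_space)
  have ci: "integrable (time_measure 1) (\<lambda>s. c)" for c :: real
    by (rule finite_measure.integrable_const[OF finite_time_measure])
  interpret P: pair_sigma_finite lebesgue "time_measure 1"
    by (intro pair_sigma_finite.intro sigma_finite_lebesgue sigma_finite_lebesgue_on) simp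
  have pm: "(\<lambda>(x, s). h x (x / \<epsilon> + s)) \<in> borel_measurable (lebesgue \<Otimes>\<^sub>M time_measure 1)"
  proof -
    have "(\<lambda>p. (fst p, fst p / \<epsilon> + snd p)) \<in> lebesgue \<Otimes>\<^sub>M time_measure 1 \<rightarrow>\<^sub>M (borel :: (real \<times> real) measure)"
    proof -
      have [measurable]: "(\<lambda>x::real. x) \<in> borel_measurable lebesgue" by (rule measurable_completion) simp
      note borel_measurable_lebesgue_on_id [measurable]
      have "(\<lambda>p. (fst p, fst p / \<epsilon> + snd p)) \<in> lebesgue \<Otimes>\<^sub>M time_measure 1 \<rightarrow>\<^sub>M (borel \<Otimes>\<^sub>M borel :: (real \<times> real) measure)"
        by measurable
      then show ?thesis by (simp add: borel_prod)
    qed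
    from measurable_compose[OF this borel_measurable_continuous_onI[OF c]]
    show ?thesis by (simp add: case_prod_unfold)
  qed
  have qi: "integrable (time_measure 1) (\<lambda>s. h x (x / \<epsilon> + s))" for x
    by (intro continuous_integrable_Ioo hc continuous_intros)
  have pi: "integrable (lebesgue \<Otimes>\<^sub>M time_measure 1) (\<lambda>(x, s). h x (x / \<epsilon> + s))"
  proof (rule P.Fubini_integrable[OF pm])
    have m2: "(\<lambda>x. LINT s|time_measure 1. norm (case (x, s) of (x, s) \<Rightarrow> h x (x / \<epsilon> + s))) \<in> borel_measurable lebesgue"
      using pm by (intro P.M2.borel_measurable_lebesgue_integral) (simp add: case_prod_unfold)
    have "integrable (lebesgue_on UNIV) (\<lambda>x. LINT s|time_measure 1. norm (case (x, s) of (x, s) \<Rightarrow> h x (x / \<epsilon> + s)))"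
    proof (rule integral_lebesgue_on_bound(1)[where B=B and \<rho>=R])
      fix x
      have "(LINT s|time_measure 1. \<bar>h x (x / \<epsilon> + s)\<bar>) \<le> B"
        using integral_mono[OF integrable_abs[OF qi] ci B] unfolding one .
      then show "\<bar>LINT s|time_measure 1. norm (case (x, s) of (x, s) \<Rightarrow> h x (x / \<epsilon> + s))\<bar> \<le> B"
        by simp
      show "(LINT s|time_measure 1. norm (case (x, s) of (x, s) \<Rightarrow> h x (x / \<epsilon> + s))) = 0" if "x \<notin> {-R..R}"
        using supp[OF that] by simp
    qed (use R B0 m2 in \<open>simp_all add: lebesgue_on_UNIV_eq\<close>)
    then show "integrable lebesgue (\<lambda>x. LINT s|time_measure 1. norm (case (x, s) of (x, s) \<Rightarrow> h x (x / \<epsilon> + s)))"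
      by (simp add: lebesgue_on_UNIV_eq)
  qed (use qi in auto)
  have ki': "integrable (time_measure 1) k" unfolding k_def using P.integrable_snd[OF pi] by simp
  have "(LINT s|time_measure 1. k s) = (LINT x|lebesgue. LINT s|time_measure 1. h x (x / \<epsilon> + s))"
    unfolding k_def by (rule P.Fubini_integral[OF pi])
  \<comment> \<open>For fixed \<open>x\<close> the variable \<open>s\<close> runs over a full
    period, so the phase \<open>x / \<epsilon>\<close> drops out.\<close>
  also have "\<dots> = (LINT x|lebesgue. LINT y|time_measure 1. h x y)"
  proof (rule Bochner_Integration.integral_cong[OF refl])
    fix x
    show "(LINT s|time_measure 1. h x (x / \<epsilon> + s)) = (LINT y|time_measure 1. h x y)"
      by (rule integral_periodic_shift) (use per in \<open>auto intro!: hc continuous_intros\<close>)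
  qed
  finally have avg: "(LINT s|time_measure 1. k s) = (LINT x|lebesgue. LINT y|time_measure 1. h x y)" .
  define I where "I = (LINT x|lebesgue. h x (x / \<epsilon>))"
  have "I - (LINT s|time_measure 1. k s) = (LINT s|time_measure 1. I - k s)"
    unfolding Bochner_Integration.integral_diff[OF ci ki'] one ..
  also have "\<bar>\<dots>\<bar> \<le> (LINT s|time_measure 1. \<bar>I - k s\<bar>)" by (rule integral_abs_bound)
  also have "\<dots> \<le> (LINT s|time_measure 1. 2 * (R + 1) * e)"
    by (rule integral_mono) (use ki' ci close in \<open>auto simp: I_def\<close>)
  also have "\<dots> = 2 * (R + 1) * e" by (rule one)
  finally show ?thesis unfolding avg I_def .
qed


text \<open>The fast variable ranges over the whole line; periodicity reduces it to [0,1], so the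
  bound is that of a continuous function on a compact product.\<close>

lemma two_scale_test_function_properties:
  assumes "\<psi> \<in> two_scale_test_functions T \<Omega>"
  obtains R B where "R \<ge> 0" "B \<ge> 0" "continuous_on UNIV \<psi>"
    "\<And>t x y. t \<notin> {0<..<T} \<or> x \<notin> \<Omega> \<or> x \<notin> {-R..R} \<Longrightarrow> \<psi> (t, x, y) = 0"
    "\<And>t x y. \<bar>\<psi> (t, x, y)\<bar> \<le> B" "\<And>t x y. \<psi> (t, x, y + 1) = \<psi> (t, x, y)"
proof -
  obtain K where K: "compact K" "K \<subseteq> {0<..<T} \<times> \<Omega>" "\<And>t x y. (t, x) \<notin> K \<Longrightarrow> \<psi> (t, x, y) = 0"
    and sm: "smooth \<psi>" and per: "\<And>t x y. \<psi> (t, x, y + 1) = \<psi> (t, x, y)"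
    using assms unfolding two_scale_test_functions_def by blast
  have c: "continuous_on UNIV \<psi>" using sm unfolding smooth_def by (metis C_k.simps(1))
  have "compact (snd ` K)" by (rule compact_continuous_image[OF continuous_on_snd[OF continuous_on_id] K(1)])
  then obtain R where R: "R > 0" "snd ` K \<subseteq> {-R..R}" by (rule compact_real_bounded_by)
  define \<iota> :: "(real \<times> real) \<times> real \<Rightarrow> real \<times> real \<times> real" where "\<iota> p = (fst (fst p), snd (fst p), snd p)" for p
  have "continuous_on (K \<times> {0..1}) \<iota>" unfolding \<iota>_def by (intro continuous_intros)
  then have "compact (\<iota> ` (K \<times> {0..1}))"
    by (rule compact_continuous_image) (rule compact_Times[OF K(1) compact_Icc])
  then have "compact (\<psi> ` (\<iota> ` (K \<times> {0..1})))"
    by (rule compact_continuous_image[OF continuous_on_subset[OF c subset_UNIV]])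
  then obtain B where B: "B > 0" "\<forall>z\<in>\<psi> ` (\<iota> ` (K \<times> {0..1})). norm z \<le> B"
    using compact_imp_bounded[of "\<psi> ` (\<iota> ` (K \<times> {0..1}))"] unfolding bounded_pos by auto
  have bound: "\<bar>\<psi> (t, x, y)\<bar> \<le> B" for t x y
  proof (cases "(t, x) \<in> K")
    case True
    have "\<psi> (t, x, y) = \<psi> (t, x, frac y)" by (rule periodic_frac) (rule per)
    moreover have "(t, x, frac y) = \<iota> ((t, x), frac y)" by (simp add: \<iota>_def)
    moreover have "frac y \<in> {0..1}" using frac_lt_1[of y] by (simp add: less_imp_le)
    ultimately have "\<psi> (t, x, y) \<in> \<psi> ` (\<iota> ` (K \<times> {0..1}))" using True by blast
    then show ?thesis using B by auto
  next
    case False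
    then show ?thesis using K(3) B by simp
  qed
  have supp: "\<psi> (t, x, y) = 0" if "t \<notin> {0<..<T} \<or> x \<notin> \<Omega> \<or> x \<notin> {-R..R}" for t x y
  proof -
    have "(t, x) \<notin> K" using that K(2) R(2) by force
    then show ?thesis by (rule K(3))
  qed
  show ?thesis by (rule that[of R B]) (use R B c supp bound per in auto)
qed

lemma L2_bounded_support:
  fixes f :: "real \<Rightarrow> real"
  assumes A: "A \<in> sets lebesgue" and m: "f \<in> borel_measurable (lebesgue_on A)"
    and B: "\<And>x. \<bar>f x\<bar> \<le> B" and z: "\<And>x. x \<notin> {-\<rho>..\<rho>} \<Longrightarrow> f x = 0" and \<rho>: "0 \<le> \<rho>"
  shows "f \<in> L2 A" "L2_norm A f \<le> sqrt (2 * \<rho>) * B"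
proof -
  have B0: "0 \<le> B" using B[of 0] by simp
  have "integrable (lebesgue_on A) (\<lambda>x. (f x)\<^sup>2)"
  proof (rule integral_lebesgue_on_bound(1)[where B="B\<^sup>2"])
    show "\<bar>(f x)\<^sup>2\<bar> \<le> B\<^sup>2" for x using power_mono[OF B[of x], of 2] by simp
  qed (use A m z \<rho> in auto)
  then show f: "f \<in> L2 A" using m by (simp add: L2_def)
  have "L2_inner A f f \<le> 2 * \<rho> * B\<^sup>2" by (rule L2_inner_bounded_support[OF B z A \<rho>])
  from real_sqrt_le_mono[OF this] show "L2_norm A f \<le> sqrt (2 * \<rho>) * B"
    using B0 by (simp add: L2_norm_def real_sqrt_mult)
qed

context open_set
begin

section \<open>Pairings with a fixed two-scale test function\<close>

context
  fixes T R B :: real and \<psi> :: "real \<times> real \<times> real \<Rightarrow> real"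
  assumes T: "T > 0" and R: "R \<ge> 0" and B: "B \<ge> 0" and c\<psi>: "continuous_on UNIV \<psi>"
    and supp: "\<And>t x y. t \<notin> {0<..<T} \<or> x \<notin> \<Omega> \<or> x \<notin> {-R..R} \<Longrightarrow> \<psi> (t, x, y) = 0"
    and bound: "\<And>t x y. \<bar>\<psi> (t, x, y)\<bar> \<le> B" and per: "\<And>t x y. \<psi> (t, x, y + 1) = \<psi> (t, x, y)"
begin

definition oscillating :: "real \<Rightarrow> real \<Rightarrow> real \<Rightarrow> real" where
  "oscillating \<epsilon> t x = \<psi> (t, x, x / \<epsilon>)"

definition cell_mean :: "real \<Rightarrow> real \<Rightarrow> real" where
  "cell_mean t x = (LINT y|time_measure 1. \<psi> (t, x, y))"

lemma \<psi>_measurable: "\<psi> \<in> borel_measurable borel"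
  by (rule borel_measurable_continuous_onI[OF c\<psi>])

lemma \<psi>_continuous_compose:
  fixes A :: "'c::topological_space set"
  assumes "continuous_on A f" "continuous_on A g" "continuous_on A h"
  shows "continuous_on A (\<lambda>x. \<psi> (f x, g x, h x))"
  using continuous_on_compose2[OF c\<psi> continuous_on_Pair[OF assms(1) continuous_on_Pair[OF assms(2,3)]]] by simp

lemma oscillating_L2:
  shows "oscillating \<epsilon> t \<in> L2 \<Omega>" "L2_norm \<Omega> (oscillating \<epsilon> t) \<le> sqrt (2 * R) * B"
proof -
  have "oscillating \<epsilon> t \<in> borel_measurable (lebesgue_on \<Omega>)"
    unfolding oscillating_def[abs_def] divide_inverse
    by (intro measurable_restrict_space1 measurable_completion) 
       (simp add: borel_measurable_continuous_onI \<psi>_continuous_compose continuous_intros)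
  note L = L2_bounded_support[OF \<Omega>_lebesgue this _ _ R, of B]
  show "oscillating \<epsilon> t \<in> L2 \<Omega>" by (rule L(1)) (auto simp: oscillating_def bound supp)
  show "L2_norm \<Omega> (oscillating \<epsilon> t) \<le> sqrt (2 * R) * B" by (rule L(2)) (auto simp: oscillating_def bound supp)
qed

lemma cell_mean_L2:
  shows "cell_mean t \<in> L2 \<Omega>" "L2_norm \<Omega> (cell_mean t) \<le> sqrt (2 * R) * B"
proof -
  note borel_measurable_lebesgue_on_id [measurable]
  interpret M: sigma_finite_measure "time_measure 1" by (rule sigma_finite_lebesgue_on) simp
  have "(\<lambda>p. (t, fst p, snd p)) \<in> lebesgue_on \<Omega> \<Otimes>\<^sub>M time_measure 1 \<rightarrow>\<^sub>M (borel \<Otimes>\<^sub>M (borel \<Otimes>\<^sub>M borel) :: (real \<times> real \<times> real) measure)"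
    by measurable
  then have "(\<lambda>p. (t, fst p, snd p)) \<in> lebesgue_on \<Omega> \<Otimes>\<^sub>M time_measure 1 \<rightarrow>\<^sub>M borel" by (simp add: borel_prod)
  from measurable_compose[OF this \<psi>_measurable]
  have "cell_mean t \<in> borel_measurable (lebesgue_on \<Omega>)"
    unfolding cell_mean_def[abs_def] by (intro M.borel_measurable_lebesgue_integral) (simp add: case_prod_unfold)
  note L = L2_bounded_support[OF \<Omega>_lebesgue this _ _ R, of B]
  have b: "\<bar>cell_mean t x\<bar> \<le> B" for x
  proof -
    have i: "integrable (time_measure 1) (\<lambda>y. \<psi> (t, x, y))"
      by (intro continuous_integrable_Ioo \<psi>_continuous_compose continuous_intros)
    have one: "(LINT s|time_measure 1. c) = c" for c :: real by (simp add: measure_restrict_space)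
    have "\<bar>cell_mean t x\<bar> \<le> (LINT y|time_measure 1. \<bar>\<psi> (t, x, y)\<bar>)" unfolding cell_mean_def by (rule integral_abs_bound)
    also have "\<dots> \<le> (LINT y|time_measure 1. B)"
      by (rule integral_mono[OF integrable_abs[OF i] finite_measure.integrable_const[OF finite_time_measure] bound])
    finally show ?thesis unfolding one .
  qed
  show "cell_mean t \<in> L2 \<Omega>" by (rule L(1)[OF b]) (simp add: cell_mean_def supp)
  show "L2_norm \<Omega> (cell_mean t) \<le> sqrt (2 * R) * B" by (rule L(2)[OF b]) (simp add: cell_mean_def supp)
qed

lemma oscillating_inner_measurable:
  assumes w: "w \<in> L2 \<Omega>"
  shows "(\<lambda>t. L2_inner \<Omega> w (oscillating \<epsilon> t)) \<in> borel_measurable (time_measure T)"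
proof -
  note borel_measurable_lebesgue_on_id [measurable]
  interpret M: sigma_finite_measure "lebesgue_on \<Omega>" by (rule sigma_finite_lebesgue_on) simp
  have "(\<lambda>p. (fst p, snd p, snd p / \<epsilon>)) \<in> time_measure T \<Otimes>\<^sub>M lebesgue_on \<Omega> \<rightarrow>\<^sub>M (borel \<Otimes>\<^sub>M (borel \<Otimes>\<^sub>M borel) :: (real \<times> real \<times> real) measure)"
    by measurable
  then have "(\<lambda>p. (fst p, snd p, snd p / \<epsilon>)) \<in> time_measure T \<Otimes>\<^sub>M lebesgue_on \<Omega> \<rightarrow>\<^sub>M borel" by (simp add: borel_prod)
  from measurable_compose[OF this \<psi>_measurable]
  have "(\<lambda>p. w (snd p) * \<psi> (fst p, snd p, snd p / \<epsilon>)) \<in> borel_measurable (time_measure T \<Otimes>\<^sub>M lebesgue_on \<Omega>)"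
    by (intro borel_measurable_times measurable_compose[OF measurable_snd L2_measurable[OF w]])
  then show ?thesis
    unfolding L2_inner_def oscillating_def by (intro M.borel_measurable_lebesgue_integral) (simp add: case_prod_unfold)
qed

lemma oscillating_inner_bound:
  assumes w: "w \<in> L2 \<Omega>"
  shows "\<bar>L2_inner \<Omega> w (oscillating \<epsilon> t)\<bar> \<le> L2_norm \<Omega> w * (sqrt (2 * R) * B)"
    "\<bar>L2_inner \<Omega> w (cell_mean t)\<bar> \<le> L2_norm \<Omega> w * (sqrt (2 * R) * B)"
  using L2_cauchy_schwarz[OF w oscillating_L2(1), of \<epsilon> t] L2_cauchy_schwarz[OF w cell_mean_L2(1), of t]
    mult_left_mono[OF oscillating_L2(2), of "L2_norm \<Omega> w" \<epsilon> t] mult_left_mono[OF cell_mean_L2(2), of "L2_norm \<Omega> w" t] L2n.nonneg[OF w]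
  by linarith+

text \<open>The test function moves with \<open>t\<close>, so the pairing is no fixed functional
  along the path. For a simple path it is a finite sum over values \<open>w\<close> of pairings
  measurable in \<open>t\<close>; the limit is then taken at each time with a functional depending
  on that time.\<close>

lemma oscillating_regular_integrable:
  assumes reg: "H1_0n.regular T uu su"
  shows "integrable (time_measure T) (\<lambda>t. L2_inner \<Omega> (uu t) (oscillating \<epsilon> t))"
proof -
  note D = H1_0n.regularD[OF reg]
  have bf: "bounded_functional (H1_0 \<Omega>) (\<lambda>f. L2_inner \<Omega> f g) (H1_norm \<Omega>) (L2_norm \<Omega> g)" if g: "g \<in> L2 \<Omega>" for g
  proof
    fix f assume f: "f \<in> H1_0 \<Omega>"
    show "L2_inner \<Omega> (\<lambda>x. c * f x) g = c * L2_inner \<Omega> f g" for c using H1_0_L2[OF f] g by (simp add: L2.scale_left)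
    show "L2_inner \<Omega> (\<lambda>x. f x + h x) g = L2_inner \<Omega> f g + L2_inner \<Omega> h g" if "h \<in> H1_0 \<Omega>" for h
      using H1_0_L2[OF f] H1_0_L2[OF that] g by (simp add: L2.add_left)
    show "\<bar>L2_inner \<Omega> f g\<bar> \<le> L2_norm \<Omega> g * H1_norm \<Omega> f"
      using L2_cauchy_schwarz[OF H1_0_L2[OF f] g] mult_right_mono[OF L2_norm_le_H1_norm[of f] L2n.nonneg[OF g]]
      by (simp add: mult.commute)
  qed
  have m: "(\<lambda>t. L2_inner \<Omega> (uu t) (oscillating \<epsilon> t)) \<in> borel_measurable (time_measure T)"
  proof (rule borel_measurable_LIMSEQ_real)
    show "(\<lambda>n. L2_inner \<Omega> (su n t) (oscillating \<epsilon> t)) \<longlonglongrightarrow> L2_inner \<Omega> (uu t) (oscillating \<epsilon> t)" for t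
      by (rule bounded_functional.tendsto_of_norm_diff[OF bf[OF oscillating_L2(1)] D(2,1,5)])
    show "(\<lambda>t. L2_inner \<Omega> (su n t) (oscillating \<epsilon> t)) \<in> borel_measurable (time_measure T)" for n
    proof -
      have "(\<lambda>t. \<Sum>w\<in>su n ` {0<..<T}. indicator {t\<in>{0<..<T}. su n t = w} t * L2_inner \<Omega> w (oscillating \<epsilon> t)) \<in> borel_measurable (time_measure T)"
      proof (rule borel_measurable_sum)
        fix w assume "w \<in> su n ` {0<..<T}"
        then have "w \<in> L2 \<Omega>" using D(2) H1_0_L2 by auto
        then show "(\<lambda>t. indicator {t\<in>{0<..<T}. su n t = w} t * L2_inner \<Omega> w (oscillating \<epsilon> t)) \<in> borel_measurable (time_measure T)"
          by (intro borel_measurable_times borel_measurable_indicator bochner_simple_levelset[OF D(3)] oscillating_inner_measurable)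
      qed
      then show ?thesis
      proof (rule measurable_cong[THEN iffD1, rotated])
        fix t assume "t \<in> space (time_measure T)"
        then have t: "t \<in> {0<..<T}" by simp
        show "(\<Sum>w\<in>su n ` {0<..<T}. indicator {t\<in>{0<..<T}. su n t = w} t * L2_inner \<Omega> w (oscillating \<epsilon> t)) =
            L2_inner \<Omega> (su n t) (oscillating \<epsilon> t)"
          by (rule bochner_simple_expand[OF D(3) t, where F="\<lambda>w. L2_inner \<Omega> w (oscillating \<epsilon> t)", symmetric])
      qed
    qed
  qed
  show ?thesis
  proof (rule Bochner_Integration.integrable_bound[OF _ m])
    show "integrable (time_measure T) (\<lambda>t. H1_norm \<Omega> (uu t) * (sqrt (2 * R) * B))"
      using D(7) by simp
    show "AE t in time_measure T. norm (L2_inner \<Omega> (uu t) (oscillating \<epsilon> t)) \<le> norm (H1_norm \<Omega> (uu t) * (sqrt (2 * R) * B))"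
    proof (intro AE_I2)
      fix t
      have "\<bar>L2_inner \<Omega> (uu t) (oscillating \<epsilon> t)\<bar> \<le> L2_norm \<Omega> (uu t) * (sqrt (2 * R) * B)"
        by (rule oscillating_inner_bound(1)[OF H1_0_L2[OF D(1)]])
      also have "\<dots> \<le> H1_norm \<Omega> (uu t) * (sqrt (2 * R) * B)"
        using R B by (intro mult_right_mono L2_norm_le_H1_norm) auto
      finally show "norm (L2_inner \<Omega> (uu t) (oscillating \<epsilon> t)) \<le> norm (H1_norm \<Omega> (uu t) * (sqrt (2 * R) * B))" by simp
    qed
  qed
qed

text \<open>The modulus required by \<open>oscillation_average\<close> comes from uniform continuity
  on a compact set. It holds for every real \<open>t\<close> at once, because \<psi> vanishes for
  \<open>t\<close> outside (0,T).\<close>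

lemma oscillating_converges_test:
  assumes \<phi>: "\<phi> \<in> test_functions \<Omega>" and e: "e > 0"
  obtains \<epsilon>\<^sub>0 where "\<epsilon>\<^sub>0 > 0" "\<And>\<epsilon> t. 0 < \<epsilon> \<Longrightarrow> \<epsilon> \<le> \<epsilon>\<^sub>0 \<Longrightarrow>
    \<bar>L2_inner \<Omega> \<phi> (oscillating \<epsilon> t) - L2_inner \<Omega> \<phi> (cell_mean t)\<bar> \<le> e"
proof -
  obtain G where G: "G \<ge> 0" "\<And>x. \<bar>\<phi> x\<bar> \<le> G" using test_functions_bounded[OF \<phi>] by metis
  define e' where "e' = e / (2 * (R + 1))"
  have e': "e' > 0" using e R by (simp add: e'_def)
  have c\<phi>: "continuous_on A \<phi>" for A by (rule smooth_continuous_on[OF test_functions_smooth[OF \<phi>]])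
  define H where "H p = \<phi> (fst (snd p)) * \<psi> p" for p
  have cH: "continuous_on A H" for A
    unfolding H_def
    by (intro continuous_on_mult continuous_on_compose2[OF c\<phi>[of UNIV]] continuous_intros continuous_on_subset[OF c\<psi>]) auto
  \<comment> \<open>If one of two points at distance at most 1 lies in [-R, R], both lie in
    [-(R+1), R+1]. The last factor is [0,1] because the fast variable is replaced by its fractional
    part.\<close>
  define Q where "Q = {0..T} \<times> {-(R+1)..R+1} \<times> {0..1::real}"
  have "uniformly_continuous_on Q H"
    unfolding Q_def by (intro compact_uniformly_continuous cH compact_Times compact_Icc)
  then obtain \<delta> where \<delta>: "\<delta> > 0" "\<And>p q. p \<in> Q \<Longrightarrow> q \<in> Q \<Longrightarrow> dist q p < \<delta> \<Longrightarrow> dist (H q) (H p) < e'"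
    unfolding uniformly_continuous_on_def using e' by metis
  have mod: "\<bar>\<phi> x * \<psi> (t, x, y) - \<phi> x' * \<psi> (t, x', y)\<bar> \<le> e'" if d: "\<bar>x - x'\<bar> \<le> \<epsilon>" and \<epsilon>: "\<epsilon> \<le> min 1 (\<delta> / 2)" for \<epsilon> t x x' y
  proof (cases "t \<in> {0<..<T} \<and> (x \<in> {-R..R} \<or> x' \<in> {-R..R})")
    case True
    then have "x \<in> {-(R+1)..R+1}" "x' \<in> {-(R+1)..R+1}" using d \<epsilon> by auto
    moreover have "frac y \<in> {0..1}" using frac_lt_1[of y] by (simp add: less_imp_le)
    ultimately have "(t, x, frac y) \<in> Q" "(t, x', frac y) \<in> Q" using True by (auto simp: Q_def)
    moreover have "dist (t, x, frac y) (t, x', frac y) < \<delta>"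
      using d \<epsilon> \<delta>(1) by (simp add: dist_Pair_Pair dist_real_def)
    ultimately have "dist (H (t, x, frac y)) (H (t, x', frac y)) < e'" by (intro \<delta>(2))
    moreover have "\<psi> (t, z, y) = \<psi> (t, z, frac y)" for z by (rule periodic_frac) (rule per)
    ultimately show ?thesis by (simp add: H_def dist_real_def)
  next
    case False
    then have "\<psi> (t, x, y) = 0" "\<psi> (t, x', y) = 0" using supp by blast+
    then show ?thesis using e' by simp
  qed
  show ?thesis
  proof (rule that[of "min 1 (\<delta> / 2)"])
    fix \<epsilon> t :: real assume \<epsilon>: "0 < \<epsilon>" "\<epsilon> \<le> min 1 (\<delta> / 2)"
    have "\<bar>(LINT x|lebesgue. \<phi> x * \<psi> (t, x, x / \<epsilon>)) - (LINT x|lebesgue. LINT y|time_measure 1. \<phi> x * \<psi> (t, x, y))\<bar> \<le> 2 * (R + 1) * e'"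
    proof (rule oscillation_average[where h="\<lambda>x y. \<phi> x * \<psi> (t, x, y)"])
      show "continuous_on UNIV (\<lambda>p. \<phi> (fst p) * \<psi> (t, fst p, snd p))"
        by (intro continuous_on_mult continuous_on_compose2[OF c\<phi>[of UNIV]] \<psi>_continuous_compose continuous_intros) auto
      show "\<bar>\<phi> x * \<psi> (t, x, y)\<bar> \<le> G * B" for x y
        unfolding abs_mult by (intro mult_mono G bound) auto
      show "\<bar>\<phi> x * \<psi> (t, x, y) - \<phi> x' * \<psi> (t, x', y)\<bar> \<le> e'" if "\<bar>x - x'\<bar> \<le> \<epsilon>" for x x' y
        by (rule mod[OF that \<epsilon>(2)])
    qed (use per supp R \<epsilon> in auto)
    also have "2 * (R + 1) * e' = e" using R by (simp add: e'_def)
    also have "(LINT x|lebesgue. \<phi> x * \<psi> (t, x, x / \<epsilon>)) = L2_inner \<Omega> \<phi> (oscillating \<epsilon> t)"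
      unfolding L2_inner_def oscillating_def using supp by (intro integral_lebesgue_on_eq[symmetric]) auto
    also have "(LINT x|lebesgue. LINT y|time_measure 1. \<phi> x * \<psi> (t, x, y)) = L2_inner \<Omega> \<phi> (cell_mean t)"
      unfolding L2_inner_def cell_mean_def using supp by (subst integral_lebesgue_on_eq) auto
    finally show "\<bar>L2_inner \<Omega> \<phi> (oscillating \<epsilon> t) - L2_inner \<Omega> \<phi> (cell_mean t)\<bar> \<le> e" .
  qed (use \<delta> in auto)
qed

text \<open>Test functions approximate \<open>g\<close> in L2, while the oscillating functions and
  their cell means are bounded in L2 by \<open>D\<close> for all \<epsilon> and \<open>t\<close>.
  Hence the approximation error is uniform.\<close>

lemma oscillating_converges:
  assumes g: "g \<in> H1_0 \<Omega>" and e: "e > 0"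
  obtains \<epsilon>\<^sub>0 where "\<epsilon>\<^sub>0 > 0" "\<And>\<epsilon> t. 0 < \<epsilon> \<Longrightarrow> \<epsilon> \<le> \<epsilon>\<^sub>0 \<Longrightarrow>
    \<bar>L2_inner \<Omega> g (oscillating \<epsilon> t) - L2_inner \<Omega> g (cell_mean t)\<bar> \<le> e"
proof -
  define D where "D = sqrt (2 * R) * B"
  have D: "D \<ge> 0" using R B by (simp add: D_def)
  \<comment> \<open>Three errors of \<open>e / 3\<close>: exchanging \<open>g\<close> for the test
    function in either pairing, and the oscillation. \<open>D + 1\<close> replaces \<open>D\<close>,
    which may be 0.\<close>
  define e' where "e' = e / (3 * (D + 1))"
  have e': "e' > 0" "D * e' \<le> e / 3" using e D by (auto simp: e'_def field_simps)
  obtain \<phi> where \<phi>: "\<phi> \<in> test_functions \<Omega>" "L2_norm \<Omega> (\<lambda>x. \<phi> x - g x) < e'"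
    using H1_0_L2_approx[OF g e'(1)] by metis
  note gL = H1_0_L2[OF g] and \<phi>L = test_L2[OF \<phi>(1)]
  have dL: "(\<lambda>x. \<phi> x - g x) \<in> L2 \<Omega>" by (rule L2.diff_mem[OF \<phi>L gL])
  have nD: "L2_norm \<Omega> (\<lambda>x. \<phi> x - g x) * D \<le> e / 3"
    using mult_right_mono[OF less_imp_le[OF \<phi>(2)] D] e'(2) by (simp add: mult.commute)
  obtain \<epsilon>\<^sub>0 where \<epsilon>\<^sub>0: "\<epsilon>\<^sub>0 > 0" "\<And>\<epsilon> t. 0 < \<epsilon> \<Longrightarrow> \<epsilon> \<le> \<epsilon>\<^sub>0 \<Longrightarrow>
    \<bar>L2_inner \<Omega> \<phi> (oscillating \<epsilon> t) - L2_inner \<Omega> \<phi> (cell_mean t)\<bar> \<le> e / 3"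
    by (rule oscillating_converges_test[OF \<phi>(1), of "e / 3"]; (rule that; assumption)?) (use e in simp)
  show ?thesis
  proof (rule that[OF \<epsilon>\<^sub>0(1)])
    fix \<epsilon> t assume \<epsilon>: "0 < \<epsilon>" "\<epsilon> \<le> \<epsilon>\<^sub>0"
    have 1: "\<bar>L2_inner \<Omega> \<phi> (oscillating \<epsilon> t) - L2_inner \<Omega> g (oscillating \<epsilon> t)\<bar> \<le> e / 3"
      using oscillating_inner_bound(1)[OF dL, of \<epsilon> t] nD L2.diff_left[OF oscillating_L2(1) \<phi>L gL, of \<epsilon> t] by (simp add: D_def)
    have 2: "\<bar>L2_inner \<Omega> \<phi> (cell_mean t) - L2_inner \<Omega> g (cell_mean t)\<bar> \<le> e / 3"
      using oscillating_inner_bound(2)[OF dL, of t] nD L2.diff_left[OF cell_mean_L2(1) \<phi>L gL, of t] by (simp add: D_def)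
    show "\<bar>L2_inner \<Omega> g (oscillating \<epsilon> t) - L2_inner \<Omega> g (cell_mean t)\<bar> \<le> e"
      using 1 2 \<epsilon>\<^sub>0(2)[OF \<epsilon>, of t] by linarith
  qed
qed

lemma cell_mean_inner_measurable:
  assumes w: "w \<in> L2 \<Omega>"
  shows "(\<lambda>t. L2_inner \<Omega> w (cell_mean t)) \<in> borel_measurable (time_measure T)"
proof -
  note borel_measurable_lebesgue_on_id [measurable]
  interpret Y: sigma_finite_measure "time_measure 1" by (rule sigma_finite_lebesgue_on) simp
  interpret M: sigma_finite_measure "lebesgue_on \<Omega>" by (rule sigma_finite_lebesgue_on) simp
  have "(\<lambda>p. (fst (fst p), snd (fst p), snd p)) \<in> (time_measure T \<Otimes>\<^sub>M lebesgue_on \<Omega>) \<Otimes>\<^sub>M time_measure 1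
      \<rightarrow>\<^sub>M (borel \<Otimes>\<^sub>M (borel \<Otimes>\<^sub>M borel) :: (real \<times> real \<times> real) measure)"
    by measurable
  then have "(\<lambda>p. (fst (fst p), snd (fst p), snd p)) \<in> (time_measure T \<Otimes>\<^sub>M lebesgue_on \<Omega>) \<Otimes>\<^sub>M time_measure 1 \<rightarrow>\<^sub>M borel"
    by (simp add: borel_prod)
  from measurable_compose[OF this \<psi>_measurable]
  have "(\<lambda>p. cell_mean (fst p) (snd p)) \<in> borel_measurable (time_measure T \<Otimes>\<^sub>M lebesgue_on \<Omega>)"
    unfolding cell_mean_def by (intro Y.borel_measurable_lebesgue_integral) (simp add: case_prod_unfold)
  then have "(\<lambda>p. w (snd p) * cell_mean (fst p) (snd p)) \<in> borel_measurable (time_measure T \<Otimes>\<^sub>M lebesgue_on \<Omega>)"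
    by (intro borel_measurable_times measurable_compose[OF measurable_snd L2_measurable[OF w]])
  then show ?thesis
    unfolding L2_inner_def by (intro M.borel_measurable_lebesgue_integral) (simp add: case_prod_unfold)
qed

text \<open>Strong convergence allows the solution to be replaced by its limit when paired with
  functions bounded in L2. The limit is affine in \<open>t\<close>, so only the oscillating pairings
  with the two fixed functions \<open>u0\<close> and \<open>v0\<close> remain.\<close>

lemma two_scale_limit_of_strong_limit:
  assumes u0: "u0 \<in> H1_0 \<Omega>" and v0: "v0 \<in> H1_0 \<Omega>"
    and strong: "\<And>\<eta>. \<eta> > 0 \<Longrightarrow> \<exists>\<epsilon>\<^sub>0>0. \<forall>\<epsilon>. 0 < \<epsilon> \<longrightarrow> \<epsilon> \<le> \<epsilon>\<^sub>0 \<longrightarrow>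
        (AE t in time_measure T. L2_norm \<Omega> (\<lambda>x. u \<epsilon> t x - (u0 x + v0 x * t)) \<le> \<eta>)"
    and bochner: "\<And>\<epsilon>. 0 < \<epsilon> \<Longrightarrow> \<epsilon> \<le> 1 \<Longrightarrow> u \<epsilon> \<in> bochner_L2 T (H1_0 \<Omega>) (H1_norm \<Omega>)"
  shows "((\<lambda>\<epsilon>. LINT t|time_measure T. LINT x|lebesgue_on \<Omega>. u \<epsilon> t x * \<psi> (t, x, x / \<epsilon>)) \<longlongrightarrow>
      (LINT t|time_measure T. LINT x|lebesgue_on \<Omega>. LINT y|lebesgue_on {0<..<1}. (u0 x + v0 x * t) * \<psi> (t, x, y)))
      (at_right 0)"
proof (rule tendstoI)
  fix e :: real assume e: "e > 0"
  note uL = H1_0_L2[OF u0] and vL = H1_0_L2[OF v0]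
  have hL: "(\<lambda>x. u0 x + v0 x * t) \<in> L2 \<Omega>" for t
    using L2.add_mem[OF uL L2.scale_mem[OF vL, of t]] by (simp add: mult.commute)
  have split: "L2_inner \<Omega> (\<lambda>x. u0 x + v0 x * t) f = L2_inner \<Omega> u0 f + t * L2_inner \<Omega> v0 f" if "f \<in> L2 \<Omega>" for t f
    using L2.add_left[OF uL L2.scale_mem[OF vL, of t] that] L2.scale_left[OF vL that, of t] by (simp add: mult.commute)
  define D where "D = sqrt (2 * R) * B"
  have D: "D \<ge> 0" using R B by (simp add: D_def)
  define L0 where "L0 t = L2_inner \<Omega> u0 (cell_mean t) + t * L2_inner \<Omega> v0 (cell_mean t)" for t
  have L0: "L0 t = L2_inner \<Omega> (\<lambda>x. u0 x + v0 x * t) (cell_mean t)" for t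
    unfolding L0_def by (rule split[OF cell_mean_L2(1), symmetric])
  have limit: "(LINT x|lebesgue_on \<Omega>. LINT y|lebesgue_on {0<..<1}. (u0 x + v0 x * t) * \<psi> (t, x, y)) = L0 t" for t
    unfolding L0 by (simp add: L2_inner_def cell_mean_def)
  have L0m: "L0 \<in> borel_measurable (time_measure T)"
    unfolding L0_def[abs_def]
    by (intro borel_measurable_add borel_measurable_times borel_measurable_lebesgue_on_id cell_mean_inner_measurable uL vL)
  have L0i: "integrable (time_measure T) L0"
  proof (rule integrable_time_bounded[OF L0m])
    fix t assume t: "t \<in> {0<..<T}"
    have "\<bar>L0 t\<bar> \<le> \<bar>L2_inner \<Omega> u0 (cell_mean t)\<bar> + \<bar>t\<bar> * \<bar>L2_inner \<Omega> v0 (cell_mean t)\<bar>"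
      unfolding L0_def by (simp add: abs_mult[symmetric] abs_triangle_ineq)
    also have "\<dots> \<le> L2_norm \<Omega> u0 * D + T * (L2_norm \<Omega> v0 * D)"
      unfolding D_def using t by (intro add_mono mult_mono oscillating_inner_bound(2) uL vL) auto
    finally show "\<bar>L0 t\<bar> \<le> L2_norm \<Omega> u0 * D + T * (L2_norm \<Omega> v0 * D)" .
  qed
  \<comment> \<open>\<open>q\<close> is the admissible error at almost every time; integrated over
    (0,T) it gives \<open>e / 2 < e\<close>. Its thirds go to the strong convergence and to the
    oscillation against \<open>u0\<close> and \<open>v0\<close>, the latter carrying the weight
    \<open>t < T\<close>.\<close>
  define q where "q = e / (2 * T)"
  have q: "q > 0" using e T by (simp add: q_def)
  define \<eta> where "\<eta> = q / (3 * (D + 1))"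
  have \<eta>: "\<eta> > 0" "\<eta> * D \<le> q / 3" using q D by (auto simp: \<eta>_def field_simps)
  define e2 where "e2 = q / (3 * (T + 1))"
  have e2: "e2 > 0" "T * e2 \<le> q / 3" using q T by (auto simp: e2_def field_simps)
  obtain \<epsilon>\<^sub>1 where \<epsilon>1: "\<epsilon>\<^sub>1 > 0" "\<And>\<epsilon>. 0 < \<epsilon> \<Longrightarrow> \<epsilon> \<le> \<epsilon>\<^sub>1 \<Longrightarrow>
      AE t in time_measure T. L2_norm \<Omega> (\<lambda>x. u \<epsilon> t x - (u0 x + v0 x * t)) \<le> \<eta>"
    using strong[OF \<eta>(1)] by blast
  have q3: "q / 3 > 0" using q by simp
  obtain \<epsilon>\<^sub>2 where \<epsilon>2: "\<epsilon>\<^sub>2 > 0" "\<And>\<epsilon> t. 0 < \<epsilon> \<Longrightarrow> \<epsilon> \<le> \<epsilon>\<^sub>2 \<Longrightarrow>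
      \<bar>L2_inner \<Omega> u0 (oscillating \<epsilon> t) - L2_inner \<Omega> u0 (cell_mean t)\<bar> \<le> q / 3"
    by (rule oscillating_converges[OF u0 q3]; rule that; assumption)
  obtain \<epsilon>\<^sub>3 where \<epsilon>3: "\<epsilon>\<^sub>3 > 0" "\<And>\<epsilon> t. 0 < \<epsilon> \<Longrightarrow> \<epsilon> \<le> \<epsilon>\<^sub>3 \<Longrightarrow>
      \<bar>L2_inner \<Omega> v0 (oscillating \<epsilon> t) - L2_inner \<Omega> v0 (cell_mean t)\<bar> \<le> e2"
    by (rule oscillating_converges[OF v0 e2(1)]; rule that; assumption)
  define b where "b = min 1 (min \<epsilon>\<^sub>1 (min \<epsilon>\<^sub>2 \<epsilon>\<^sub>3))"
  have b: "b > 0" using \<epsilon>1 \<epsilon>2 \<epsilon>3 by (simp add: b_def)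
  have close: "dist (LINT t|time_measure T. LINT x|lebesgue_on \<Omega>. u \<epsilon> t x * \<psi> (t, x, x / \<epsilon>)) (LINT t|time_measure T. L0 t) < e"
    if \<epsilon>: "0 < \<epsilon>" "\<epsilon> < b" for \<epsilon>
  proof -
    have le: "\<epsilon> \<le> 1" "\<epsilon> \<le> \<epsilon>\<^sub>1" "\<epsilon> \<le> \<epsilon>\<^sub>2" "\<epsilon> \<le> \<epsilon>\<^sub>3" using \<epsilon>(2) by (auto simp: b_def)
    obtain uu su where reg: "H1_0n.regular T uu su" and uu: "AE t in time_measure T. uu t = u \<epsilon> t"
      using H1_0n.bochner_L2_regular[OF bochner[OF \<epsilon>(1) le(1)]] .
    define F where "F t = L2_inner \<Omega> (u \<epsilon> t) (oscillating \<epsilon> t)" for t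
    have "AE t in time_measure T. L2_inner \<Omega> (uu t) (oscillating \<epsilon> t) = F t"
      using uu by eventually_elim (simp add: F_def)
    then have Fi: "integrable (time_measure T) F"
      by (rule time_integrable_AE[OF oscillating_regular_integrable[OF reg]])
    have Feq: "(LINT x|lebesgue_on \<Omega>. u \<epsilon> t x * \<psi> (t, x, x / \<epsilon>)) = F t" for t
      by (simp add: F_def L2_inner_def oscillating_def)
    have "AE t in time_measure T. \<bar>F t - L0 t\<bar> \<le> q"
      using \<epsilon>1(2)[OF \<epsilon>(1) le(2)] uu AE_space
    proof eventually_elim
      case (elim t)
      have ut: "u \<epsilon> t \<in> L2 \<Omega>" using H1_0_L2[OF H1_0n.regularD(1)[OF reg, of t]] elim(2) by simp
      have "\<bar>L2_inner \<Omega> (\<lambda>x. u \<epsilon> t x - (u0 x + v0 x * t)) (oscillating \<epsilon> t)\<bar> \<le>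
          L2_norm \<Omega> (\<lambda>x. u \<epsilon> t x - (u0 x + v0 x * t)) * D"
        unfolding D_def by (rule oscillating_inner_bound(1)[OF L2.diff_mem[OF ut hL]])
      also have "\<dots> \<le> \<eta> * D" using elim(1) D by (rule mult_right_mono)
      finally have 1: "\<bar>F t - (L2_inner \<Omega> u0 (oscillating \<epsilon> t) + t * L2_inner \<Omega> v0 (oscillating \<epsilon> t))\<bar> \<le> q / 3"
        using \<eta>(2) L2.diff_left[OF oscillating_L2(1) ut hL, of t \<epsilon> t] split[OF oscillating_L2(1), of t \<epsilon> t] by (simp add: F_def)
      have 2: "\<bar>L2_inner \<Omega> u0 (oscillating \<epsilon> t) - L2_inner \<Omega> u0 (cell_mean t)\<bar> \<le> q / 3"
        by (rule \<epsilon>2(2)[OF \<epsilon>(1) le(3)])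
      have "\<bar>t * (L2_inner \<Omega> v0 (oscillating \<epsilon> t) - L2_inner \<Omega> v0 (cell_mean t))\<bar> \<le> T * e2"
        unfolding abs_mult using elim(3) by (intro mult_mono \<epsilon>3(2)[OF \<epsilon>(1) le(4)]) auto
      then have 3: "\<bar>t * L2_inner \<Omega> v0 (oscillating \<epsilon> t) - t * L2_inner \<Omega> v0 (cell_mean t)\<bar> \<le> q / 3"
        using e2(2) by (simp add: right_diff_distrib)
      show ?case unfolding L0_def using 1 2 3 by linarith
    qed
    then have "(LINT t|time_measure T. \<bar>F t - L0 t\<bar>) \<le> (LINT t|time_measure T. q)"
      using Fi L0i by (intro integral_mono_AE finite_measure.integrable_const[OF finite_time_measure]) auto
    also have "\<dots> = e / 2" using T by (simp add: measure_restrict_space q_def)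
    finally have "\<bar>LINT t|time_measure T. F t - L0 t\<bar> \<le> e / 2"
      using integral_abs_bound[of "time_measure T" "\<lambda>t. F t - L0 t"] by linarith
    then show ?thesis using Fi L0i e by (simp add: Feq dist_real_def)
  qed
  show "\<forall>\<^sub>F \<epsilon> in at_right 0. dist (LINT t|time_measure T. LINT x|lebesgue_on \<Omega>. u \<epsilon> t x * \<psi> (t, x, x / \<epsilon>))
      (LINT t|time_measure T. LINT x|lebesgue_on \<Omega>. LINT y|lebesgue_on {0<..<1}. (u0 x + v0 x * t) * \<psi> (t, x, y)) < e"
    unfolding limit eventually_at_right_field using b close by blast
qed

end

end


subsection \<open>Affine paths and the limit function\<close>

text \<open>Values are rounded down to the grid of width 1/(n+1). Continuity bounds \<open>c\<close>
  on [0,T], so finitely many grid points occur, and the floor function keeps the level sets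
  Borel.\<close>

lemma quantization:
  fixes c :: "real \<Rightarrow> real"
  assumes c: "continuous_on UNIV c"
  obtains q where "\<And>n::nat. finite (q n ` {0<..<T})" "\<And>n. q n \<in> borel_measurable borel"
    "\<And>n t. \<bar>q n t - c t\<bar> \<le> 1 / (real n + 1)"
proof -
  define q where "q n t = of_int \<lfloor>(real n + 1) * c t\<rfloor> / (real n + 1)" for n :: nat and t
  have [measurable]: "c \<in> borel_measurable borel" by (rule borel_measurable_continuous_onI[OF c])
  show ?thesis
  proof (rule that[of q])
    fix n :: nat
    show "q n \<in> borel_measurable borel" unfolding q_def[abs_def] by measurable
    have "bounded (c ` {0..T})"
      by (intro compact_imp_bounded compact_continuous_image continuous_on_subset[OF c]) auto
    then obtain B where "\<forall>z\<in>c ` {0..T}. norm z \<le> B" unfolding bounded_iff by blast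
    then have B: "\<And>t. t \<in> {0..T} \<Longrightarrow> \<bar>c t\<bar> \<le> B" by simp
    have "q n ` {0<..<T} \<subseteq> (\<lambda>k. of_int k / (real n + 1)) ` {\<lfloor>- ((real n + 1) * B)\<rfloor>..\<lfloor>(real n + 1) * B\<rfloor>}"
    proof
      fix z assume "z \<in> q n ` {0<..<T}"
      then obtain t where t: "t \<in> {0<..<T}" "z = q n t" by blast
      have "\<bar>(real n + 1) * c t\<bar> \<le> (real n + 1) * B"
        unfolding abs_mult using B[of t] t by (intro mult_mono) auto
      then have "\<lfloor>(real n + 1) * c t\<rfloor> \<in> {\<lfloor>- ((real n + 1) * B)\<rfloor>..\<lfloor>(real n + 1) * B\<rfloor>}"
        unfolding abs_le_iff by (auto intro!: floor_mono)
      then show "z \<in> (\<lambda>k. of_int k / (real n + 1)) ` {\<lfloor>- ((real n + 1) * B)\<rfloor>..\<lfloor>(real n + 1) * B\<rfloor>}"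
        unfolding t q_def by blast
    qed
    then show "finite (q n ` {0<..<T})" by (rule finite_subset) simp
    fix t
    have "\<bar>of_int \<lfloor>(real n + 1) * c t\<rfloor> - (real n + 1) * c t\<bar> \<le> 1" by linarith
    moreover have "q n t - c t = (of_int \<lfloor>(real n + 1) * c t\<rfloor> - (real n + 1) * c t) / (real n + 1)"
      by (simp add: q_def diff_divide_distrib)
    ultimately show "\<bar>q n t - c t\<bar> \<le> 1 / (real n + 1)" by (simp add: abs_divide divide_right_mono)
  qed
qed

context seminormed_space
begin

text \<open>On the span of two elements the seminorm is continuous in the coefficients, so
  measurability of norms along such a path reduces to that of two real functions.\<close>

lemma continuous_combination:
  assumes g: "g \<in> X" "h \<in> X"
  shows "continuous_on UNIV (\<lambda>p. N (\<lambda>b. fst p * g b + snd p * h b))"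
  unfolding continuous_on_def
proof
  fix p :: "real \<times> real"
  have mem: "(\<lambda>b. fst q * g b + snd q * h b) \<in> X" for q :: "real \<times> real" by (intro add_mem scale_mem g)
  have "((\<lambda>q. \<bar>fst q - fst p\<bar> * N g + \<bar>snd q - snd p\<bar> * N h) \<longlongrightarrow> \<bar>fst p - fst p\<bar> * N g + \<bar>snd p - snd p\<bar> * N h) (at p)"
    by (intro tendsto_intros)
  then have lim: "((\<lambda>q. \<bar>fst q - fst p\<bar> * N g + \<bar>snd q - snd p\<bar> * N h) \<longlongrightarrow> 0) (at p)" by simp
  have "((\<lambda>q. N (\<lambda>b. fst q * g b + snd q * h b) - N (\<lambda>b. fst p * g b + snd p * h b)) \<longlongrightarrow> 0) (at p)"
  proof (rule Lim_null_comparison[OF always_eventually lim], intro allI)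
    fix q :: "real \<times> real"
    have "(\<lambda>b. fst q * g b + snd q * h b - (fst p * g b + snd p * h b)) = (\<lambda>b. (fst q - fst p) * g b + (snd q - snd p) * h b)"
      by (simp add: algebra_simps)
    then have "\<bar>N (\<lambda>b. fst q * g b + snd q * h b) - N (\<lambda>b. fst p * g b + snd p * h b)\<bar> \<le> N (\<lambda>b. (fst q - fst p) * g b + (snd q - snd p) * h b)"
      using norm_triangle_diff[OF mem[of q] mem[of p]] by simp
    also have "\<dots> \<le> \<bar>fst q - fst p\<bar> * N g + \<bar>snd q - snd p\<bar> * N h"
      using triangle[OF scale_mem[OF g(1), of "fst q - fst p"] scale_mem[OF g(2), of "snd q - snd p"]] g by (simp add: abs_scale)
    finally show "norm (N (\<lambda>b. fst q * g b + snd q * h b) - N (\<lambda>b. fst p * g b + snd p * h b)) \<le> \<bar>fst q - fst p\<bar> * N g + \<bar>snd q - snd p\<bar> * N h"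
      by simp
  qed
  then show "((\<lambda>p. N (\<lambda>b. fst p * g b + snd p * h b)) \<longlongrightarrow> N (\<lambda>b. fst p * g b + snd p * h b)) (at p within UNIV)"
    by (simp only: LIM_zero_cancel)
qed

lemma combination_norm_measurable:
  assumes "g \<in> X" "h \<in> X" "a \<in> borel_measurable borel" "b \<in> borel_measurable borel"
  shows "(\<lambda>t::real. N (\<lambda>x. a t * g x + b t * h x)) \<in> borel_measurable (time_measure T)"
proof -
  have "(\<lambda>t. (a t, b t)) \<in> borel \<rightarrow>\<^sub>M (borel \<Otimes>\<^sub>M borel :: (real \<times> real) measure)" using assms(3,4) by measurable
  then have "(\<lambda>t. (a t, b t)) \<in> borel_measurable borel" by (simp add: borel_prod)
  from measurable_compose[OF this borel_measurable_continuous_onI[OF continuous_combination[OF assms(1,2)]]]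
  show ?thesis by (intro measurable_restrict_space1 measurable_completion) simp
qed

lemma combination_bochner_simple:
  assumes gh: "g \<in> X" "h \<in> X" and fin: "finite (a ` {0<..<T})" "finite (b ` {0<..<T})"
    and m: "a \<in> borel_measurable borel" "b \<in> borel_measurable borel"
  shows "bochner_simple T X (\<lambda>t x. a t * g x + b t * h x)"
  unfolding bochner_simple_def
proof (intro conjI allI)
  let ?P = "a ` {0<..<T} \<times> b ` {0<..<T}"
  let ?c = "\<lambda>p x. fst p * g x + snd p * h x"
  have "(\<lambda>t x. a t * g x + b t * h x) ` {0<..<T} \<subseteq> ?c ` ?P" by force
  then show "finite ((\<lambda>t x. a t * g x + b t * h x) ` {0<..<T})"
    by (rule finite_subset) (use fin in auto)
  show "(\<lambda>t x. a t * g x + b t * h x) ` {0<..<T} \<subseteq> X" using gh by (auto intro!: add_mem scale_mem)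
  fix w
  \<comment> \<open>Different coefficient pairs may give the same function, so a level set is a
    finite union over all pairs that produce \<open>w\<close>.\<close>
  have eq: "{t \<in> {0<..<T}. (\<lambda>x. a t * g x + b t * h x) = w} =
      (\<Union>p\<in>{p\<in>?P. ?c p = w}. {0<..<T} \<inter> (a -` {fst p} \<inter> b -` {snd p}))"
    by force
  have "a -` {z} \<in> sets lebesgue" "b -` {z} \<in> sets lebesgue" for z
    using m measurable_sets_borel[of a borel "{z}"] measurable_sets_borel[of b borel "{z}"] by auto
  then show "{t \<in> {0<..<T}. (\<lambda>x. a t * g x + b t * h x) = w} \<in> sets lebesgue"
    unfolding eq using fin by (intro sets.finite_UN sets.Int) auto
qed

lemma combination_bochner_L2:
  assumes gh: "g \<in> X" "h \<in> X" and c: "continuous_on UNIV a" "continuous_on UNIV b"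
  shows "(\<lambda>t x. a t * g x + b t * h x) \<in> bochner_L2 T X N"
proof -
  obtain p where p: "\<And>n::nat. finite (p n ` {0<..<T})" "\<And>n. p n \<in> borel_measurable borel"
    "\<And>n t. \<bar>p n t - a t\<bar> \<le> 1 / (real n + 1)" by (rule quantization[OF c(1), where T=T]; rule that; assumption)
  obtain q where q: "\<And>n::nat. finite (q n ` {0<..<T})" "\<And>n. q n \<in> borel_measurable borel"
    "\<And>n t. \<bar>q n t - b t\<bar> \<le> 1 / (real n + 1)" by (rule quantization[OF c(2), where T=T]; rule that; assumption)
  have mem: "(\<lambda>x. \<alpha> * g x + \<beta> * h x) \<in> X" for \<alpha> \<beta> by (intro add_mem scale_mem gh)
  have nb: "N (\<lambda>x. \<alpha> * g x + \<beta> * h x) \<le> \<bar>\<alpha>\<bar> * N g + \<bar>\<beta>\<bar> * N h" for \<alpha> \<beta>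
    using triangle[OF scale_mem[OF gh(1), of \<alpha>] scale_mem[OF gh(2), of \<beta>]] gh by (simp add: abs_scale)
  have lim: "(\<lambda>n. 1 / (real n + 1) * N g + 1 / (real n + 1) * N h) \<longlonglongrightarrow> 0"
  proof -
    have "(\<lambda>n. 1 / (real n + 1) * N g + 1 / (real n + 1) * N h) \<longlonglongrightarrow> 0 * N g + 0 * N h"
      using LIMSEQ_inverse_real_of_nat by (intro tendsto_intros) (simp_all add: inverse_eq_divide add.commute)
    then show ?thesis by simp
  qed
  show ?thesis
    unfolding bochner_L2_def
  proof (intro CollectI conjI exI allI)
    show "AE t in time_measure T. (\<lambda>x. a t * g x + b t * h x) \<in> X" using mem by simp
    show "bochner_simple T X (\<lambda>t x. p n t * g x + q n t * h x)" for n
      by (rule combination_bochner_simple[OF gh p(1) q(1) p(2) q(2)])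
    show "AE t in time_measure T. (\<lambda>n. N (\<lambda>x. p n t * g x + q n t * h x - (a t * g x + b t * h x))) \<longlonglongrightarrow> 0"
    proof (intro AE_I2 tendsto_sandwich[OF always_eventually always_eventually tendsto_const lim] allI)
      fix t n
      have eq: "(\<lambda>x. p n t * g x + q n t * h x - (a t * g x + b t * h x)) = (\<lambda>x. (p n t - a t) * g x + (q n t - b t) * h x)"
        by (simp add: algebra_simps)
      show "0 \<le> N (\<lambda>x. p n t * g x + q n t * h x - (a t * g x + b t * h x))" unfolding eq by (rule nonneg[OF mem])
      show "N (\<lambda>x. p n t * g x + q n t * h x - (a t * g x + b t * h x)) \<le> 1 / (real n + 1) * N g + 1 / (real n + 1) * N h"
        unfolding eq by (rule order_trans[OF nb]) (intro add_mono mult_right_mono p q nonneg gh)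
    qed
    have cN: "continuous_on UNIV (\<lambda>t. N (\<lambda>x. a t * g x + b t * h x))"
      using continuous_on_compose2[OF continuous_combination[OF gh] continuous_on_Pair[OF c]] by simp
    show "integrable (time_measure T) (\<lambda>t. (N (\<lambda>x. a t * g x + b t * h x))\<^sup>2)"
      by (intro continuous_integrable_Ioo continuous_on_power continuous_on_subset[OF cN]) simp
  qed
qed

text \<open>The path stays in the span of \<open>g\<close> and \<open>h\<close>, so its integral is
  computed coefficientwise: quantizing the two coefficients gives simple paths whose integrals have
  the integrated quantized coefficients.\<close>

lemma combination_bochner_integral:
  assumes gh: "g \<in> X" "h \<in> X" and c: "continuous_on UNIV a" "continuous_on UNIV b" and T: "T > 0"
  shows "has_bochner_integral_in T X N (\<lambda>t x. a t * g x + b t * h x)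
     (\<lambda>x. (LINT t|time_measure T. a t) * g x + (LINT t|time_measure T. b t) * h x)"
proof -
  obtain p where p: "\<And>n::nat. finite (p n ` {0<..<T})" "\<And>n. p n \<in> borel_measurable borel"
    "\<And>n t. \<bar>p n t - a t\<bar> \<le> 1 / (real n + 1)" by (rule quantization[OF c(1), where T=T]; rule that; assumption)
  obtain q where q: "\<And>n::nat. finite (q n ` {0<..<T})" "\<And>n. q n \<in> borel_measurable borel"
    "\<And>n t. \<bar>q n t - b t\<bar> \<le> 1 / (real n + 1)" by (rule quantization[OF c(2), where T=T]; rule that; assumption)
  have mem: "(\<lambda>x. \<alpha> * g x + \<beta> * h x) \<in> X" for \<alpha> \<beta> by (intro add_mem scale_mem gh)
  have nb: "N (\<lambda>x. \<alpha> * g x + \<beta> * h x) \<le> \<bar>\<alpha>\<bar> * N g + \<bar>\<beta>\<bar> * N h" for \<alpha> \<beta>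
    using triangle[OF scale_mem[OF gh(1), of \<alpha>] scale_mem[OF gh(2), of \<beta>]] gh by (simp add: abs_scale)
  define r where "r n = 1 / (real n + 1) * N g + 1 / (real n + 1) * N h" for n
  have lim: "(\<lambda>n. T * r n) \<longlonglongrightarrow> 0"
  proof -
    have "(\<lambda>n. T * r n) \<longlonglongrightarrow> T * (0 * N g + 0 * N h)"
      unfolding r_def using LIMSEQ_inverse_real_of_nat by (intro tendsto_intros) (simp_all add: inverse_eq_divide add.commute)
    then show ?thesis by simp
  qed
  define s where "s n = (\<lambda>t x. p n t * g x + q n t * h x)" for n
  have bs: "bochner_simple T X (s n)" for n
    unfolding s_def by (rule combination_bochner_simple[OF gh p(1) q(1) p(2) q(2)])
  have cm: "a \<in> borel_measurable borel" "b \<in> borel_measurable borel" using c by (auto intro: borel_measurable_continuous_onI)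
  have diff: "(\<lambda>x. s n t x - (a t * g x + b t * h x)) = (\<lambda>x. (p n t - a t) * g x + (q n t - b t) * h x)" for n t
    by (simp add: s_def algebra_simps)
  have r: "N (\<lambda>x. (p n t - a t) * g x + (q n t - b t) * h x) \<le> r n" for n t
    unfolding r_def by (rule order_trans[OF nb]) (intro add_mono mult_right_mono p q nonneg gh)
  have di: "integrable (time_measure T) (\<lambda>t. N (\<lambda>x. s n t x - (a t * g x + b t * h x)))" for n
    unfolding diff
  proof (rule integrable_time_bounded)
    show "(\<lambda>t. N (\<lambda>x. (p n t - a t) * g x + (q n t - b t) * h x)) \<in> borel_measurable (time_measure T)"
      by (intro combination_norm_measurable gh borel_measurable_diff p q cm)
    show "\<bar>N (\<lambda>x. (p n t - a t) * g x + (q n t - b t) * h x)\<bar> \<le> r n" for t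
      using r nonneg[OF mem] by simp
  qed
  have ci: "integrable (time_measure T) (\<lambda>t. k)" for k :: real
    by (rule finite_measure.integrable_const[OF finite_time_measure])
  have Tk: "(LINT t|time_measure T. k) = T * k" for k :: real using T by (simp add: measure_restrict_space)
  have coeff: "integrable (time_measure T) (f n)" "\<bar>(LINT t|time_measure T. f n t) - (LINT t|time_measure T. k t)\<bar> \<le> T * (1 / (real n + 1))"
    if k: "continuous_on UNIV k" and f: "\<And>n::nat. f n \<in> borel_measurable borel" "\<And>n t. \<bar>f n t - k t\<bar> \<le> 1 / (real n + 1)"
    for k :: "real \<Rightarrow> real" and f n
  proof -
    have ki: "integrable (time_measure T) k" by (rule continuous_integrable_Ioo[OF continuous_on_subset[OF k subset_UNIV]])
    have dm: "(\<lambda>t. f n t - k t) \<in> borel_measurable (time_measure T)"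
      using f(1) borel_measurable_continuous_onI[OF k]
      by (intro measurable_restrict_space1 measurable_completion) simp
    have di: "integrable (time_measure T) (\<lambda>t. f n t - k t)"
      by (rule integrable_time_bounded[OF dm f(2)])
    from Bochner_Integration.integrable_add[OF di ki] show fi: "integrable (time_measure T) (f n)" by simp
    have "(LINT t|time_measure T. f n t) - (LINT t|time_measure T. k t) = (LINT t|time_measure T. f n t - k t)"
      using fi ki by simp
    also have "\<bar>\<dots>\<bar> \<le> (LINT t|time_measure T. \<bar>f n t - k t\<bar>)" by (rule integral_abs_bound)
    also have "\<dots> \<le> (LINT t|time_measure T. 1 / (real n + 1))"
      by (rule integral_mono[OF integrable_abs[OF di] ci f(2)])
    also have "\<dots> = T * (1 / (real n + 1))" by (rule Tk)
    finally show "\<bar>(LINT t|time_measure T. f n t) - (LINT t|time_measure T. k t)\<bar> \<le> T * (1 / (real n + 1))" .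
  qed
  note ca = coeff[of a p, OF c(1) p(2,3)] and cb = coeff[of b q, OF c(2) q(2,3)]
  have si: "simple_integral T (s n) = (\<lambda>x. (LINT t|time_measure T. p n t) * g x + (LINT t|time_measure T. q n t) * h x)" for n
  proof
    fix x
    \<comment> \<open>Evaluation at a point is linear on \<open>X\<close>, so the values of a simple
      integral are ordinary integrals over time.\<close>
    have "linear_functional X (\<lambda>f. f x)" by unfold_locales simp_all
    from linear_functional.bochner_simple_integral(1)[OF this bs]
    have "simple_integral T (s n) x = (LINT t|time_measure T. p n t * g x + q n t * h x)" by (simp add: s_def)
    also have "\<dots> = (LINT t|time_measure T. p n t) * g x + (LINT t|time_measure T. q n t) * h x"
      using ca(1) cb(1) by simp
    finally show "simple_integral T (s n) x = (LINT t|time_measure T. p n t) * g x + (LINT t|time_measure T. q n t) * h x" .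
  qed
  show ?thesis
    unfolding has_bochner_integral_in_def
  proof (intro conjI exI allI)
    show "AE t in time_measure T. (\<lambda>x. a t * g x + b t * h x) \<in> X" using mem by simp
    show "(\<lambda>x. (LINT t|time_measure T. a t) * g x + (LINT t|time_measure T. b t) * h x) \<in> X" by (rule mem)
    show "bochner_simple T X (s n)" for n by (rule bs)
    show "integrable (time_measure T) (\<lambda>t. N (\<lambda>x. s n t x - (a t * g x + b t * h x)))" for n by (rule di)
    show "(\<lambda>n. LINT t|time_measure T. N (\<lambda>x. s n t x - (a t * g x + b t * h x))) \<longlonglongrightarrow> 0"
    proof (rule tendsto_sandwich[OF always_eventually always_eventually tendsto_const lim]; intro allI)
      fix n
      show "0 \<le> (LINT t|time_measure T. N (\<lambda>x. s n t x - (a t * g x + b t * h x)))"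
        unfolding diff using nonneg[OF mem] by (intro Bochner_Integration.integral_nonneg)
      have "(LINT t|time_measure T. N (\<lambda>x. s n t x - (a t * g x + b t * h x))) \<le> (LINT t|time_measure T. r n)"
        by (rule integral_mono[OF di ci]) (simp only: diff r)
      then show "(LINT t|time_measure T. N (\<lambda>x. s n t x - (a t * g x + b t * h x))) \<le> T * r n" unfolding Tk .
    qed
    show "(\<lambda>n. N (\<lambda>x. simple_integral T (s n) x - ((LINT t|time_measure T. a t) * g x + (LINT t|time_measure T. b t) * h x))) \<longlonglongrightarrow> 0"
    proof (rule tendsto_sandwich[OF always_eventually always_eventually tendsto_const lim]; intro allI)
      fix n
      have eq: "(\<lambda>x. simple_integral T (s n) x - ((LINT t|time_measure T. a t) * g x + (LINT t|time_measure T. b t) * h x)) =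
          (\<lambda>x. ((LINT t|time_measure T. p n t) - (LINT t|time_measure T. a t)) * g x + ((LINT t|time_measure T. q n t) - (LINT t|time_measure T. b t)) * h x)"
        unfolding si by (simp add: algebra_simps)
      show "0 \<le> N (\<lambda>x. simple_integral T (s n) x - ((LINT t|time_measure T. a t) * g x + (LINT t|time_measure T. b t) * h x))"
        unfolding eq by (rule nonneg[OF mem])
      have "N (\<lambda>x. simple_integral T (s n) x - ((LINT t|time_measure T. a t) * g x + (LINT t|time_measure T. b t) * h x)) \<le>
          T * (1 / (real n + 1)) * N g + T * (1 / (real n + 1)) * N h"
        unfolding eq by (rule order_trans[OF nb]) (intro add_mono mult_right_mono ca(2) cb(2) nonneg gh)
      also have "\<dots> = T * r n" by (simp add: r_def distrib_left)
      finally show "N (\<lambda>x. simple_integral T (s n) x - ((LINT t|time_measure T. a t) * g x + (LINT t|time_measure T. b t) * h x)) \<le> T * r n" .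
    qed
  qed
qed

text \<open>Both Bochner integrals equal \<open>h\<close> times minus the integral of \<phi>: the
  derivative of \<phi> integrates to 0, which removes \<open>g\<close>, and its product with
  \<open>t\<close> is integrated by parts without boundary terms.\<close>

lemma affine_has_time_deriv:
  assumes gh: "g \<in> X" "h \<in> X" and T: "T > 0"
  shows "has_time_deriv T X N (\<lambda>t x. g x + h x * t) (\<lambda>t x. h x)"
  unfolding has_time_deriv_def
proof
  fix \<phi> assume \<phi>: "\<phi> \<in> test_functions {0<..<T}"
  note sm = test_functions_smooth[OF \<phi>]
  note cd = smooth_continuous_on[OF smooth_deriv(2)[OF sm], of UNIV] and c\<phi> = smooth_continuous_on[OF sm, of UNIV]
  define id where "id t = t" for t :: real
  have z: "\<phi> 0 = 0" "\<phi> T = 0" using test_functions_outside[OF \<phi>] by auto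
  have i1: "integrable (time_measure T) (deriv \<phi>)" "integrable (time_measure T) (\<lambda>t. deriv \<phi> t * t)"
      "integrable (time_measure T) \<phi>"
    by (intro continuous_integrable_Ioo continuous_intros continuous_on_subset[OF cd] continuous_on_subset[OF c\<phi>]; simp)+
  have I1: "(LINT t|time_measure T. deriv \<phi> t) = 0"
  proof -
    have "(deriv \<phi> has_integral \<phi> T - \<phi> 0) {0..T}"
      using T smooth_deriv(1)[OF sm] by (intro fundamental_theorem_of_calculus)
        (auto simp: has_real_derivative_iff_has_vector_derivative[symmetric] intro: has_field_derivative_at_within)
    from integral_unique[OF this] lint_Ioo_eq_integral(1)[OF i1(1)] z show ?thesis by simp
  qed
  have I2: "(LINT t|time_measure T. deriv \<phi> t * t) = - (LINT t|time_measure T. \<phi> t)"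
  proof -
    have "((\<lambda>t. \<phi> t * t) has_real_derivative deriv \<phi> t * t + \<phi> t) (at t within {0..T})" for t
      using smooth_deriv(1)[OF sm, of t] by (auto intro!: derivative_eq_intros intro: has_field_derivative_at_within)
    then have "((\<lambda>t. deriv \<phi> t * t + \<phi> t) has_integral \<phi> T * T - \<phi> 0 * 0) {0..T}"
      using T by (intro fundamental_theorem_of_calculus[where f="\<lambda>t. \<phi> t * t"])
        (simp_all only: has_real_derivative_iff_has_vector_derivative)
    from integral_unique[OF this] lint_Ioo_eq_integral(1)[OF Bochner_Integration.integrable_add[OF i1(2,3)]] z
    have "(LINT t|time_measure T. deriv \<phi> t * t + \<phi> t) = 0" by simp
    then show ?thesis using i1 by simp
  qed
  have "has_bochner_integral_in T X N (\<lambda>t x. deriv \<phi> t * g x + (deriv \<phi> t * t) * h x)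
     (\<lambda>x. (LINT t|time_measure T. deriv \<phi> t) * g x + (LINT t|time_measure T. deriv \<phi> t * t) * h x)"
    by (intro combination_bochner_integral gh cd T continuous_on_mult continuous_on_id)
  moreover have "(\<lambda>t x. deriv \<phi> t * g x + (deriv \<phi> t * t) * h x) = (\<lambda>t x. deriv \<phi> t * (g x + h x * t))"
    by (simp add: algebra_simps)
  ultimately have 1: "has_bochner_integral_in T X N (\<lambda>t x. deriv \<phi> t * (g x + h x * t)) (\<lambda>x. - (LINT t|time_measure T. \<phi> t) * h x)"
    by (simp add: I1 I2)
  \<comment> \<open>A term with coefficient 0 brings the constant direction \<open>h\<close> into
    the two-term form.\<close>
  have "has_bochner_integral_in T X N (\<lambda>t x. (- \<phi> t) * h x + 0 * h x)
     (\<lambda>x. (LINT t|time_measure T. - \<phi> t) * h x + (LINT t|time_measure T. 0) * h x)"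
    by (intro combination_bochner_integral gh T continuous_intros c\<phi>)
  then have 2: "has_bochner_integral_in T X N (\<lambda>t x. - \<phi> t * h x) (\<lambda>x. - (LINT t|time_measure T. \<phi> t) * h x)"
    by simp
  show "\<exists>I. has_bochner_integral_in T X N (\<lambda>t x. deriv \<phi> t * (g x + h x * t)) I \<and>
      has_bochner_integral_in T X N (\<lambda>t x. - \<phi> t * h x) I"
    using 1 2 by blast
qed

end

text \<open>A Lebesgue measurable function agrees with a Borel function off a null set, and the cylinder over
  that null set is again a null set.\<close>

lemma middle_variable_borel:
  fixes f :: "real \<Rightarrow> real"
  assumes f: "f \<in> borel_measurable (lebesgue_on A)" and A: "A \<in> sets lebesgue"
  obtains f' where "f' \<in> borel_measurable borel" "AE x in lebesgue. indicator A x * f x = f' x"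
    "AE p in (lebesgue :: (real \<times> real \<times> real) measure). indicator A (fst (snd p)) * f (fst (snd p)) = f' (fst (snd p))"
proof -
  have "(\<lambda>x. indicator A x * f x) \<in> borel_measurable lebesgue"
    using f A by (simp add: borel_measurable_restrict_space_iff)
  then obtain f' where f': "f' \<in> borel_measurable lborel" "AE x in lborel. indicator A x * f x = f' x"
    using completion_ex_borel_measurable_real by blast
  obtain Z where Z: "{x \<in> space lborel. \<not> indicator A x * f x = f' x} \<subseteq> Z" "emeasure lborel Z = 0" "Z \<in> sets lborel"
    using AE_E[OF f'(2)] .
  have "UNIV \<times> (Z \<times> UNIV) \<in> null_sets (lborel \<Otimes>\<^sub>M (lborel \<Otimes>\<^sub>M lborel) :: (real \<times> real \<times> real) measure)"
  proof (rule null_setsI)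
    have s: "Z \<times> UNIV \<in> sets (lborel \<Otimes>\<^sub>M lborel :: (real \<times> real) measure)" using Z(3) by (intro pair_measureI) auto
    have "emeasure (lborel \<Otimes>\<^sub>M lborel :: (real \<times> real) measure) (Z \<times> UNIV) = emeasure lborel Z * emeasure lborel (UNIV :: real set)"
      by (rule lborel.emeasure_pair_measure_Times[OF Z(3)]) simp
    then have "emeasure (lborel \<Otimes>\<^sub>M lborel :: (real \<times> real) measure) (Z \<times> UNIV) = 0" using Z(2) by simp
    moreover have "emeasure (lborel \<Otimes>\<^sub>M (lborel \<Otimes>\<^sub>M lborel) :: (real \<times> real \<times> real) measure) (UNIV \<times> (Z \<times> UNIV)) =
        emeasure lborel (UNIV :: real set) * emeasure (lborel \<Otimes>\<^sub>M lborel :: (real \<times> real) measure) (Z \<times> UNIV)"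
      using s sigma_finite_lborel[where 'a="real \<times> real"]
      by (intro sigma_finite_measure.emeasure_pair_measure_Times) (auto simp: lborel_prod)
    ultimately show "emeasure (lborel \<Otimes>\<^sub>M (lborel \<Otimes>\<^sub>M lborel) :: (real \<times> real \<times> real) measure) (UNIV \<times> (Z \<times> UNIV)) = 0" by simp
    show "UNIV \<times> (Z \<times> UNIV) \<in> sets (lborel \<Otimes>\<^sub>M (lborel \<Otimes>\<^sub>M lborel) :: (real \<times> real \<times> real) measure)"
      by (rule pair_measureI[OF _ s]) simp
  qed
  then have N: "UNIV \<times> (Z \<times> UNIV) \<in> null_sets (lborel :: (real \<times> real \<times> real) measure)" by (simp add: lborel_prod)
  have "AE p in (lebesgue :: (real \<times> real \<times> real) measure). p \<notin> UNIV \<times> (Z \<times> UNIV)"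
    by (intro AE_completion AE_not_in N)
  then have "AE p in (lebesgue :: (real \<times> real \<times> real) measure). indicator A (fst (snd p)) * f (fst (snd p)) = f' (fst (snd p))"
    by eventually_elim (use Z(1) in \<open>auto simp: mem_Times_iff\<close>)
  then show ?thesis using that[of f'] f' by (auto intro: AE_completion)
qed

lemma middle_variable_measurable:
  fixes f :: "real \<Rightarrow> real"
  assumes f: "f \<in> borel_measurable (lebesgue_on A)" and A: "A \<in> sets lebesgue"
  shows "(\<lambda>p::real \<times> real \<times> real. indicator A (fst (snd p)) * f (fst (snd p))) \<in> borel_measurable lebesgue"
proof -
  obtain f' where f': "f' \<in> borel_measurable borel"
    "AE p in (lebesgue :: (real \<times> real \<times> real) measure). indicator A (fst (snd p)) * f (fst (snd p)) = f' (fst (snd p))"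
    by (rule middle_variable_borel[OF f A]; rule that; assumption)
  have "(\<lambda>p::real \<times> real \<times> real. fst (snd p)) \<in> borel_measurable borel"
    by (intro borel_measurable_continuous_onI continuous_intros)
  from measurable_compose[OF this f'(1)]
  have "(\<lambda>p::real \<times> real \<times> real. f' (fst (snd p))) \<in> borel_measurable lebesgue"
    by (intro measurable_completion) simp
  then show ?thesis
    by (rule borel_measurable_AE) (use f'(2) in \<open>auto elim: eventually_mono\<close>)
qed

text \<open>For the Borel version the integrand is a product of three one-variable functions, so the
  product lemma applies twice; the original function agrees with it off a null set.\<close>

lemma middle_variable_integrable:
  fixes f :: "real \<Rightarrow> real"
  assumes f: "integrable (lebesgue_on A) f" and A: "A \<in> sets lebesgue"
  shows "integrable lebesgue (\<lambda>p::real \<times> real \<times> real.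
    indicator {0<..<T} (fst p) * (indicator A (fst (snd p)) * f (fst (snd p)) * indicator {0<..<S} (snd (snd p))))"
proof -
  obtain f' where f': "f' \<in> borel_measurable borel" "AE x in lebesgue. indicator A x * f x = f' x"
    "AE p in (lebesgue :: (real \<times> real \<times> real) measure). indicator A (fst (snd p)) * f (fst (snd p)) = f' (fst (snd p))"
    by (rule middle_variable_borel[OF borel_measurable_integrable[OF f] A]; rule that; assumption)
  have "integrable lebesgue (\<lambda>x. indicator A x * f x)"
    using f A by (simp add: integrable_restrict_space)
  then have "integrable lebesgue f'"
    using f'(1,2) by (subst integrable_cong_AE[symmetric]) (auto intro: borel_measurable_integrable measurable_completion)
  then have i: "integrable lborel f'" using f'(1) by (simp add: integrable_completion)
  have ind: "integrable lborel (indicator {0<..<c} :: real \<Rightarrow> real)" for c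
    using emeasure_lborel_box_finite[of 0 c] by (intro integrable_real_indicator) (auto simp: box_real)
  have ps: "pair_sigma_finite (lborel :: real measure) (lborel :: real measure)"
    "pair_sigma_finite (lborel :: real measure) (lborel :: (real \<times> real) measure)"
    by (intro pair_sigma_finite.intro sigma_finite_lborel)+
  have "integrable (lborel \<Otimes>\<^sub>M lborel) (\<lambda>(x, y). f' x * indicator {0<..<S} y)"
    by (rule integrable_product_function[OF ps(1) i ind])
  then have "integrable (lborel :: (real \<times> real) measure) (\<lambda>p. f' (fst p) * indicator {0<..<S} (snd p))"
    by (simp add: lborel_prod case_prod_unfold)
  from integrable_product_function[OF ps(2) ind this]
  have b: "integrable (lborel :: (real \<times> real \<times> real) measure)
      (\<lambda>p. indicator {0<..<T} (fst p) * (f' (fst (snd p)) * indicator {0<..<S} (snd (snd p))))"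
    by (simp add: lborel_prod case_prod_unfold)
  then have "integrable lebesgue (\<lambda>p::real \<times> real \<times> real. indicator {0<..<T} (fst p) * (f' (fst (snd p)) * indicator {0<..<S} (snd (snd p))))"
    by (subst integrable_completion) auto
  moreover have ae: "AE p in (lebesgue :: (real \<times> real \<times> real) measure).
      indicator {0<..<T} (fst p) * (f' (fst (snd p)) * indicator {0<..<S} (snd (snd p))) =
      indicator {0<..<T} (fst p) * (indicator A (fst (snd p)) * f (fst (snd p)) * indicator {0<..<S} (snd (snd p)))"
    using f'(3) by eventually_elim simp
  ultimately show ?thesis
    using borel_measurable_AE[OF borel_measurable_integrable ae] by (subst integrable_cong_AE[symmetric]) auto
qed

context open_set
begin

text \<open>\<open>two_scale_converges\<close> uses the completed measure of three-dimensional space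
  on the product domain, which is why functions of the middle variable are lifted to it.
  Integrability follows from
  \<open>(g + h t)\<^sup>2 \<le> 2 g\<^sup>2 + 2 T\<^sup>2 h\<^sup>2\<close>.\<close>

lemma affine_two_scale_regularity:
  assumes g: "g \<in> L2 \<Omega>" and h: "h \<in> L2 \<Omega>" and T: "T > 0"
  shows "(\<lambda>(t, x, y). g x + h x * t) \<in> borel_measurable (lebesgue_on ({0<..<T} \<times> \<Omega> \<times> {0<..<1::real}))"
    "integrable (lebesgue_on ({0<..<T} \<times> \<Omega> \<times> {0<..<1::real})) (\<lambda>(t, x, y). (g x + h x * t)\<^sup>2)"
proof -
  let ?D = "{0<..<T} \<times> \<Omega> \<times> {0<..<1::real}"
  have "open ?D" using open_\<Omega> by (intro open_Times) auto
  then have D: "?D \<in> sets lebesgue" by simp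
  have eq: "indicator ?D p * F (fst (snd p)) = indicator ?D p * (indicator \<Omega> (fst (snd p)) * F (fst (snd p)))" for F :: "real \<Rightarrow> real" and p
    by (auto simp: indicator_def mem_Times_iff)
  have m: "(\<lambda>p. F (fst (snd p))) \<in> borel_measurable (lebesgue_on ?D)" if F: "F \<in> L2 \<Omega>" for F
  proof -
    have "(\<lambda>p. indicator ?D p *\<^sub>R F (fst (snd p))) \<in> borel_measurable lebesgue"
      unfolding real_scaleR_def eq
      by (intro borel_measurable_times middle_variable_measurable L2_measurable[OF F] \<Omega>_lebesgue borel_measurable_indicator D)
    then show ?thesis using D by (simp add: borel_measurable_restrict_space_iff)
  qed
  have m1: "(\<lambda>p::real \<times> real \<times> real. fst p) \<in> borel_measurable (lebesgue_on ?D)"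
    by (intro measurable_restrict_space1 measurable_completion)
       (simp add: borel_measurable_continuous_onI continuous_on_fst[OF continuous_on_id])
  show meas: "(\<lambda>(t, x, y). g x + h x * t) \<in> borel_measurable (lebesgue_on ?D)"
    using m[OF g] m[OF h] m1 by (simp add: case_prod_unfold)
  have i: "integrable (lebesgue_on ?D) (\<lambda>p. (F (fst (snd p)))\<^sup>2)" if F: "F \<in> L2 \<Omega>" for F
  proof -
    have eqF: "indicator ?D p *\<^sub>R (F (fst (snd p)))\<^sup>2 = indicator {0<..<T} (fst p) *
        (indicator \<Omega> (fst (snd p)) * (F (fst (snd p)))\<^sup>2 * indicator {0<..<1} (snd (snd p)))" for p
      by (auto simp: indicator_def mem_Times_iff)
    have "integrable lebesgue (\<lambda>p. indicator ?D p *\<^sub>R (F (fst (snd p)))\<^sup>2)"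
      unfolding eqF by (rule middle_variable_integrable[OF L2_integrable_square[OF F] \<Omega>_lebesgue])
    then show ?thesis using D by (simp add: integrable_restrict_space)
  qed
  show "integrable (lebesgue_on ?D) (\<lambda>(t, x, y). (g x + h x * t)\<^sup>2)"
  proof (rule Bochner_Integration.integrable_bound)
    show "integrable (lebesgue_on ?D) (\<lambda>p. 2 * (g (fst (snd p)))\<^sup>2 + 2 * T\<^sup>2 * (h (fst (snd p)))\<^sup>2)"
      by (intro Bochner_Integration.integrable_add integrable_mult_right i g h)
    show "(\<lambda>(t, x, y). (g x + h x * t)\<^sup>2) \<in> borel_measurable (lebesgue_on ?D)"
      using meas by (simp add: case_prod_unfold)
    show "AE p in lebesgue_on ?D. norm (case p of (t, x, y) \<Rightarrow> (g x + h x * t)\<^sup>2) \<le>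
        norm (2 * (g (fst (snd p)))\<^sup>2 + 2 * T\<^sup>2 * (h (fst (snd p)))\<^sup>2)"
    proof (intro AE_I2)
      fix p assume "p \<in> space (lebesgue_on ?D)"
      then obtain t x y where p: "p = (t, x, y)" "0 < t" "t < T" by auto
      have "(g x + h x * t)\<^sup>2 \<le> 2 * (g x)\<^sup>2 + 2 * (h x * t)\<^sup>2"
        using zero_le_power2[of "g x - h x * t"] by (simp add: power2_sum power2_diff)
      also have "(h x * t)\<^sup>2 \<le> T\<^sup>2 * (h x)\<^sup>2"
        using mult_right_mono[OF power_mono[of t T 2], of "(h x)\<^sup>2"] p by (simp add: power_mult_distrib mult.commute)
      finally show "norm (case p of (t, x, y) \<Rightarrow> (g x + h x * t)\<^sup>2) \<le> norm (2 * (g (fst (snd p)))\<^sup>2 + 2 * T\<^sup>2 * (h (fst (snd p)))\<^sup>2)"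
        by (simp add: p)
    qed
  qed
qed

end

theorem proposition3p1:
  fixes \<Omega> S :: "real set" and T :: real
    and u0 v0 :: "real \<Rightarrow> real" and u :: "real \<Rightarrow> real \<Rightarrow> real \<Rightarrow> real"
  assumes "open \<Omega>" and "connected \<Omega>" and "\<Omega> \<noteq> {}"
    and "T > 0"
    and "open S" and "connected S" and "S \<noteq> {}" and "S \<subseteq> {0<..<1}" and "S \<noteq> {0<..<1}"
    and "u0 \<in> H1_0 \<Omega>" and "v0 \<in> H1_0 \<Omega>"
    and "\<And>\<epsilon>. 0 < \<epsilon> \<Longrightarrow> \<epsilon> \<le> 1 \<Longrightarrow>
           weak_wave_solution T \<Omega> (coefficient (\<epsilon>\<^sup>2) \<Omega> S \<epsilon>) (\<lambda>t x. 0) u0 v0 (u \<epsilon>)"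
  shows "\<exists>uhat. uhat \<in> bochner_L2 T (H1_0 \<Omega>) (H1_norm \<Omega>) \<and>
           (\<exists>w. w \<in> bochner_L2 T (L2 \<Omega>) (L2_norm \<Omega>) \<and>
                has_time_deriv T (L2 \<Omega>) (L2_norm \<Omega>) uhat w) \<and>
           two_scale_converges T \<Omega> u (\<lambda>t x y. uhat t x) \<and>
           (\<forall>t\<in>{0<..<T}. \<forall>x\<in>\<Omega>. uhat t x = u0 x + v0 x * t)"
proof -
  interpret open_set \<Omega> by unfold_locales fact
  note T = \<open>T > 0\<close> and u0 = \<open>u0 \<in> H1_0 \<Omega>\<close> and v0 = \<open>v0 \<in> H1_0 \<Omega>\<close>
  note uL = H1_0_L2[OF u0] and vL = H1_0_L2[OF v0]
  define uhat where "uhat = (\<lambda>t x. u0 x + v0 x * t)"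
  \<comment> \<open>The limit is a path in the span of \<open>u0\<close> and \<open>v0\<close> with
    coefficients 1 and \<open>t\<close>; its derivative is constant in time and uses the
    coefficients 1 and 0.\<close>
  have "(\<lambda>t x. 1 * u0 x + t * v0 x) \<in> bochner_L2 T (H1_0 \<Omega>) (H1_norm \<Omega>)"
    by (intro H1_0n.combination_bochner_L2 u0 v0 continuous_intros)
  then have "uhat \<in> bochner_L2 T (H1_0 \<Omega>) (H1_norm \<Omega>)" by (simp add: uhat_def mult.commute)
  moreover have "(\<lambda>t x. 1 * v0 x + 0 * v0 x) \<in> bochner_L2 T (L2 \<Omega>) (L2_norm \<Omega>)"
    by (intro L2n.combination_bochner_L2 vL continuous_intros)
  then have "(\<lambda>t x. v0 x) \<in> bochner_L2 T (L2 \<Omega>) (L2_norm \<Omega>)" by simp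
  moreover have "has_time_deriv T (L2 \<Omega>) (L2_norm \<Omega>) uhat (\<lambda>t x. v0 x)"
    unfolding uhat_def by (rule L2n.affine_has_time_deriv[OF uL vL T])
  moreover have "two_scale_converges T \<Omega> u (\<lambda>t x y. uhat t x)"
    unfolding two_scale_converges_def uhat_def
  proof (intro conjI ballI affine_two_scale_regularity uL vL T)
    fix \<psi> assume \<psi>_test: "\<psi> \<in> two_scale_test_functions T \<Omega>"
    obtain R B where \<psi>: "R \<ge> 0" "B \<ge> 0" "continuous_on UNIV \<psi>"
      "\<And>t x y. t \<notin> {0<..<T} \<or> x \<notin> \<Omega> \<or> x \<notin> {-R..R} \<Longrightarrow> \<psi> (t, x, y) = 0"
      "\<And>t x y. \<bar>\<psi> (t, x, y)\<bar> \<le> B" "\<And>t x y. \<psi> (t, x, y + 1) = \<psi> (t, x, y)"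
      by (rule two_scale_test_function_properties[OF \<psi>_test]; rule that; assumption)
    show "((\<lambda>\<epsilon>. LINT t|time_measure T. LINT x|lebesgue_on \<Omega>. u \<epsilon> t x * \<psi> (t, x, x / \<epsilon>)) \<longlongrightarrow>
      (LINT t|time_measure T. LINT x|lebesgue_on \<Omega>. LINT y|lebesgue_on {0<..<1}. (u0 x + v0 x * t) * \<psi> (t, x, y)))
      (at_right 0)"
    proof (rule two_scale_limit_of_strong_limit[OF T \<psi> u0 v0])
      show "\<exists>\<epsilon>\<^sub>0>0. \<forall>\<epsilon>. 0 < \<epsilon> \<longrightarrow> \<epsilon> \<le> \<epsilon>\<^sub>0 \<longrightarrow>
        (AE t in time_measure T. L2_norm \<Omega> (\<lambda>x. u \<epsilon> t x - (u0 x + v0 x * t)) \<le> \<eta>)" if \<eta>: "\<eta> > 0" for \<eta>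
        by (rule wave_strong_convergence[OF T \<open>open S\<close> \<open>S \<noteq> {}\<close> u0 v0 \<eta> assms(12)]) blast+
      show "u \<epsilon> \<in> bochner_L2 T (H1_0 \<Omega>) (H1_norm \<Omega>)" if "0 < \<epsilon>" "\<epsilon> \<le> 1" for \<epsilon>
        using assms(12)[OF that] by (simp add: weak_wave_solution_def)
    qed
  qed
  moreover have "\<forall>t\<in>{0<..<T}. \<forall>x\<in>\<Omega>. uhat t x = u0 x + v0 x * t" by (simp add: uhat_def)
  ultimately show ?thesis by blast
qed

end
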